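(* Let $E,A\in\mathbb{R}^{n\times n}$, $B\in\mathbb{R}^{n\times m}$, $C\in\mathbb{R}^{m\times n}$, and suppose that the descriptor system $E\dot x=Ax+Bu,\ y=Cx$ admits a pH representation. Let $$T_a=T_\infty\big(E\,S_\infty(C)\big),\qquad S_b=S_\infty\left(\begin{bmatrix}E\\ \big(T_\infty(\begin{bmatrix}E&B\end{bmatrix})\big)^TA\\ C\end{bmatrix}\right).$$ Let $r$ be a prescribed integer. Then the following statements are equivalent. (a) There exist $K,F\in\mathbb{R}^{m\times m}$ such that the pair $(E+BFC,A-BKC)$ is regular, impulse-free and asymptotically stable, $\operatorname{rank}(E+BFC)=r$, and the closed-loop system $(E+BFC)\dot x=(A-BKC)x+Bv,\ y=Cx$ admits a pH representation. (b) The following conditions hold: (i) the matrix $T_a^TAS_b$ has full column rank; (ii) for all $s\in\mathbb{C}$ with $\Re(s)=0$, $$\operatorname{rank}\begin{bmatrix}sE-A&B\end{bmatrix}=\operatorname{rank}\begin{bmatrix}sE-A\\C\end{bmatrix}=n;$$ (iii) $$\operatorname{rank}\begin{bmatrix}E&B\end{bmatrix}-\operatorname{rank}(B)\le r\le\operatorname{rank}\begin{bmatrix}E&B\end{bmatrix}-\operatorname{rank}(T_a^TAS_b).$$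
   Context: All matrices are real. $M\ge 0$ means $M$ is symmetric positive semidefinite. For a matrix $M$, $S_\infty(M)$ denotes a matrix whose columns form an orthonormal basis of the right nullspace $\{x: Mx=0\}$, and $T_\infty(M)$ denotes a matrix whose columns form an orthonormal basis of the left nullspace $\{z: z^TM=0\}$. Such matrices may have zero columns; a matrix with zero columns has rank $0$ and full column rank. A pH (port-Hamiltonian) representation of the descriptor system $E\dot x=Ax+Bu,\ y=Cx$ (with $E,A\in\mathbb{R}^{n\times n}$, $B\in\mathbb{R}^{n\times m}$, $C\in\mathbb{R}^{m\times n}$) is a tuple of matrices $J,R,Q\in\mathbb{R}^{n\times n}$, $G,P\in\mathbb{R}^{n\times m}$ with $$A=(J-R)Q,\quad B=G-P,\quad C=(G+P)^TQ,$$ $$Q^TE=E^TQ\ge 0,\quad Q^TJQ=-(Q^TJQ)^T,\quad Q^TRQ\ge 0,\quad Q^TP=0.$$ A system admits a pH representation if at least one such tuple exists. For a closed-loop system, the definition is applied to its own coefficient matrices (here $E+BFC$, $A-BKC$, $B$, $C$). A pair $(E,A)$ is regular if $\det(sE-A)\ne0$ for some $s\in\mathbb{C}$; regular and impulse-free if $\deg(\det(sE-A))=\operatorname{rank}(E)$ (the zero polynomial having degree $-\infty$); regular and asymptotically stable if all roots $s\in\mathbb C$ of $\det(sE-A)=0$ have strictly negative real part. *)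

theory Defs
  imports
    Complex_Main
    "Jordan_Normal_Form.Determinant"
    "Jordan_Normal_Form.Matrix_Kernel"
    "Jordan_Normal_Form.DL_Rank"
begin

abbreviation mat_rank :: "'a::field mat \<Rightarrow> nat" where
  "mat_rank M \<equiv> vec_space.rank (dim_row M) M"

definition append_cols :: "'a::zero mat \<Rightarrow> 'a mat \<Rightarrow> 'a mat" (infixr \<open>@\<^sub>c\<close> 66) where
  "M @\<^sub>c N = four_block_mat M N (0\<^sub>m 0 (dim_col M)) (0\<^sub>m 0 (dim_col N))"

(* S_infinity(M) and T_infinity(M) are only determined up to the choice of an orthonormal
   basis (whose length may be 0), so they are rendered as relations between M and a choice. *)

definition is_S_inf :: "real mat \<Rightarrow> real mat \<Rightarrow> bool" where
  "is_S_inf M S \<longleftrightarrow>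
     dim_row S = dim_col M \<and>
     (\<forall>i < dim_col S. \<forall>j < dim_col S. col S i \<bullet> col S j = (if i = j then 1 else 0)) \<and>
     kernel.basis (dim_col M) M (set (cols S))"

(* z^T M = 0 is the equation M^T z = 0. *)
definition is_T_inf :: "real mat \<Rightarrow> real mat \<Rightarrow> bool" where
  "is_T_inf M T \<longleftrightarrow> is_S_inf (transpose_mat M) T"

definition pos_semidef :: "real mat \<Rightarrow> bool" where
  "pos_semidef M \<longleftrightarrow>
     square_mat M \<and> transpose_mat M = M \<and>
     (\<forall>x \<in> carrier_vec (dim_row M). 0 \<le> x \<bullet> (M *\<^sub>v x))"

definition pH_representation ::
  "nat \<Rightarrow> nat \<Rightarrow> real mat \<Rightarrow> real mat \<Rightarrow> real mat \<Rightarrow> real mat \<Rightarrow>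
   real mat \<Rightarrow> real mat \<Rightarrow> real mat \<Rightarrow> real mat \<Rightarrow> real mat \<Rightarrow> bool" where
  "pH_representation n m E A B C J R Q G P \<longleftrightarrow>
     J \<in> carrier_mat n n \<and> R \<in> carrier_mat n n \<and> Q \<in> carrier_mat n n \<and>
     G \<in> carrier_mat n m \<and> P \<in> carrier_mat n m \<and>
     A = (J - R) * Q \<and> B = G - P \<and> C = transpose_mat (G + P) * Q \<and>
     transpose_mat Q * E = transpose_mat E * Q \<and> pos_semidef (transpose_mat Q * E) \<and>
     transpose_mat Q * J * Q = - transpose_mat (transpose_mat Q * J * Q) \<and>
     pos_semidef (transpose_mat Q * R * Q) \<and>
     transpose_mat Q * P = 0\<^sub>m n m"

definition admits_pH ::
  "nat \<Rightarrow> nat \<Rightarrow> real mat \<Rightarrow> real mat \<Rightarrow> real mat \<Rightarrow> real mat \<Rightarrow> bool" where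
  "admits_pH n m E A B C \<longleftrightarrow> (\<exists>J R Q G P. pH_representation n m E A B C J R Q G P)"

abbreviation cmat :: "real mat \<Rightarrow> complex mat" where
  "cmat \<equiv> map_mat complex_of_real"

definition pencil :: "complex \<Rightarrow> real mat \<Rightarrow> real mat \<Rightarrow> complex mat" where
  "pencil s E A = s \<cdot>\<^sub>m cmat E - cmat A"

(* det(sE - A) as a polynomial in s. *)
definition pencil_det_poly :: "real mat \<Rightarrow> real mat \<Rightarrow> real poly" where
  "pencil_det_poly E A = det ([:0, 1:] \<cdot>\<^sub>m map_mat (\<lambda>a. [:a:]) E - map_mat (\<lambda>a. [:a:]) A)"

definition regular_pair :: "real mat \<Rightarrow> real mat \<Rightarrow> bool" where
  "regular_pair E A \<longleftrightarrow> (\<exists>s. det (pencil s E A) \<noteq> 0)"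

(* The library has degree 0 = 0 rather than -infinity, so the zero polynomial is ruled out
   explicitly. *)
definition regular_impulse_free :: "real mat \<Rightarrow> real mat \<Rightarrow> bool" where
  "regular_impulse_free E A \<longleftrightarrow>
     pencil_det_poly E A \<noteq> 0 \<and> degree (pencil_det_poly E A) = mat_rank E"

definition regular_asymp_stable :: "real mat \<Rightarrow> real mat \<Rightarrow> bool" where
  "regular_asymp_stable E A \<longleftrightarrow>
     regular_pair E A \<and> (\<forall>s. det (pencil s E A) = 0 \<longrightarrow> Re s < 0)"

end

theory Submission
  imports Defs
begin

text \<open>
  A regular pair \<open>(E, A)\<close> is impulse-free iff \<open>E x = 0\<close> and \<open>A x = E w\<close> force \<open>x = 0\<close>. The columns of
  \<open>S\<^sub>b\<close> lie in the kernel of every \<open>E + B F C\<close>, and every \<open>A - B K C\<close> acts on them as \<open>A\<close>, with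
  values in the range of \<open>[E B]\<close>. Impulse-freeness of the closed loop thus makes
  \<open>A S\<^sub>b\<close> injective with range meeting that of \<open>E + B F C\<close> trivially, which yields (i) and the
  upper bound in (iii).

  Conversely, (ii) at \<open>s = 0\<close> makes \<open>Q\<close> invertible, and multiplication by \<open>Q\<^sup>T\<close> reduces to the case where
  \<open>E\<close> is symmetric positive semidefinite, \<open>x\<^sup>T A x \<le> 0\<close> and \<open>C = B\<^sup>T\<close>. There \<open>E\<close> splits as
  \<open>X + B H B\<^sup>T\<close> with \<open>X\<close> positive semidefinite of range \<open>E (ker B\<^sup>T)\<close>. Taking \<open>F = V V\<^sup>T - H\<close> gives
  \<open>E + B F C = X + (B V) (B V)\<^sup>T\<close>, whose range is \<open>E (ker B\<^sup>T) \<oplus> range (B V)\<close>; condition (i) lets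
  one choose \<open>V\<close> so that this range has dimension \<open>r\<close> and misses the range of \<open>A S\<^sub>b\<close>. With \<open>K = I\<close> the
  same \<open>Q\<close> serves the closed loop, and the dissipation \<open>x\<^sup>T (A - B C) x \<le> - |C x|\<^sup>2\<close> forces \<open>C x = 0\<close> on
  impulsive or unstable modes, so that they are modes of \<open>(E, A)\<close> excluded by (i) and (ii).
\<close>

subsection \<open>Range, injectivity and rank of matrices\<close>

text \<open>The bounds on \<open>r\<close> come from what output feedback cannot alter. On
  \<open>ker C\<close> the matrix \<open>E + B F C\<close> agrees with \<open>E\<close>, so its
  range always contains \<open>E (ker C)\<close>. In the reduced setting \<open>C = B^T\<close>,
  semidefiniteness makes \<open>E (ker B^T)\<close> meet the range of \<open>B\<close> only in 0: if
  \<open>E z = B v\<close> with \<open>B^T z = 0\<close>, then \<open>z^T E z = 0\<close>, hence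
  \<open>E z = 0\<close>. The unalterable part therefore has dimension
  \<open>rank [E B] - rank B\<close>, the lower bound. Every further unit of rank costs one
  direction from the range of \<open>B\<close>, while the directions of \<open>A S_b\<close> must
  stay free; this is the upper bound. Since \<open>T_a^T v = 0\<close> means \<open>v\<close> lies
  in \<open>E (ker C)\<close>, condition (i) says that \<open>A S_b\<close> is injective and avoids
  the unalterable part.

  The obstacle is that one \<open>F\<close> has to fix the rank, avoid \<open>A S_b\<close> and keep
  \<open>Q^T (E + B F C)\<close> symmetric positive semidefinite. An arbitrary \<open>F\<close> of
  suitable rank fails the last demand, so \<open>F\<close> is taken from a splitting of
  \<open>E\<close> that isolates the part of the form \<open>B H B^T\<close>, the only part feedback
  can replace.\<close>

definition mat_range :: "'a::semiring_0 mat \<Rightarrow> 'a vec set" where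
  "mat_range M = (\<lambda>v. M *\<^sub>v v) ` carrier_vec (dim_col M)"

text \<open>Kernel form of full column rank. Rank inequalities are obtained by exhibiting injective
  matrices with the right number of columns, because kernels of products and concatenations are easy
  to control.\<close>

definition inj_mat :: "'a::semiring_0 mat \<Rightarrow> bool" where
  "inj_mat M \<longleftrightarrow>
     (\<forall>v \<in> carrier_vec (dim_col M). M *\<^sub>v v = 0\<^sub>v (dim_row M) \<longrightarrow> v = 0\<^sub>v (dim_col M))"

lemma inj_matI:
  assumes "M \<in> carrier_mat n c"
    and "\<And>v. v \<in> carrier_vec c \<Longrightarrow> M *\<^sub>v v = 0\<^sub>v n \<Longrightarrow> v = 0\<^sub>v c"
  shows "inj_mat M"
  using assms unfolding inj_mat_def by auto

lemma inj_matD: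
  assumes "inj_mat M" "M \<in> carrier_mat n c" "v \<in> carrier_vec c" "M *\<^sub>v v = 0\<^sub>v n"
  shows "v = 0\<^sub>v c"
  using assms unfolding inj_mat_def by auto

lemma mat_range_iff:
  assumes "M \<in> carrier_mat n c"
  shows "y \<in> mat_range M \<longleftrightarrow> (\<exists>v \<in> carrier_vec c. y = M *\<^sub>v v)"
  using assms unfolding mat_range_def by auto

lemma mat_range_carrier:
  assumes "M \<in> carrier_mat n c"
  shows "mat_range M \<subseteq> carrier_vec n"
  using assms unfolding mat_range_def by auto

lemma mat_mult_unit_vec:
  fixes M :: "'a::comm_ring_1 mat"
  assumes "M \<in> carrier_mat n c" "j < c"
  shows "M *\<^sub>v unit_vec c j = col M j"
  using assms by (intro eq_vecI) auto

lemma mat_mult_zero_vec: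
  fixes M :: "'a::comm_ring_1 mat"
  assumes "M \<in> carrier_mat n c"
  shows "M *\<^sub>v 0\<^sub>v c = 0\<^sub>v n"
  using assms by (intro eq_vecI) auto

lemma mat_range_mult_subset:
  fixes M :: "'a::comm_semiring_0 mat"
  assumes M: "M \<in> carrier_mat n c" and X: "X \<in> carrier_mat c d"
  shows "mat_range (M * X) \<subseteq> mat_range M"
proof
  fix y assume "y \<in> mat_range (M * X)"
  then obtain v where v: "v \<in> carrier_vec d" "y = (M * X) *\<^sub>v v"
    using mat_range_iff[of "M * X" n d y] M X by auto
  then have "y = M *\<^sub>v (X *\<^sub>v v)" using assoc_mult_mat_vec[OF M X] by simp
  then show "y \<in> mat_range M" using mat_range_iff[OF M] X v by auto
qed

lemma col_space_mat_range:
  fixes M :: "'a::field mat"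
  assumes M: "M \<in> carrier_mat n c"
  shows "vec_space.col_space n M = mat_range M"
proof -
  interpret vec_space "TYPE('a)" n .
  show ?thesis using col_space_eq[OF M] M mat_range_carrier[OF M] unfolding mat_range_def by auto
qed

lemma rank_cong_mat_range:
  fixes M :: "'a::field mat"
  assumes M: "M \<in> carrier_mat n c" and N: "N \<in> carrier_mat n d"
    and r: "mat_range M = mat_range N"
  shows "vec_space.rank n M = vec_space.rank n N"
  using r unfolding vec_space.rank_def col_space_mat_range[OF M, symmetric]
    col_space_mat_range[OF N, symmetric] vec_space.col_space_def by simp

lemma inj_mat_rank:
  fixes M :: "'a::field mat"
  assumes M: "M \<in> carrier_mat n c" and i: "inj_mat M"
  shows "vec_space.rank n M = c" "c \<le> n"
proof -
  interpret vec_space "TYPE('a)" n .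
  \<comment> \<open>Linear independence concerns the set of columns, which forgets repetitions. Two
    equal columns would put the difference of two unit vectors into the kernel.\<close>
  have d: "distinct (cols M)"
  proof (rule ccontr)
    assume "\<not> distinct (cols M)"
    then obtain i j where ij: "i < c" "j < c" "i \<noteq> j" "col M i = col M j"
      using M unfolding distinct_conv_nth by auto
    let ?v = "unit_vec c i - unit_vec c j :: 'a vec"
    have "M *\<^sub>v ?v = M *\<^sub>v unit_vec c i - M *\<^sub>v unit_vec c j"
      using mult_minus_distrib_mat_vec[OF M] by simp
    also have "\<dots> = 0\<^sub>v n" using ij M by (simp add: mat_mult_unit_vec[OF M])
    finally have "?v = 0\<^sub>v c" using inj_matD[OF \<open>inj_mat M\<close> M] by simp
    then have "?v $ i = 0" using ij by simp
    then show False using ij by simp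
  qed
  have li: "lin_indpt (set (cols M))"
  proof
    assume "lin_dep (set (cols M))"
    then obtain v where "v \<in> carrier_vec c" "v \<noteq> 0\<^sub>v c" "M *\<^sub>v v = 0\<^sub>v n"
      using lin_depE[OF M _ d] by metis
    then show False using inj_matD[OF i M] by blast
  qed
  show "rank M = c" by (rule lin_indpt_full_rank[OF M d li])
  have "card (set (cols M)) \<le> dim"
    using li_le_dim(2)[OF fin_dim _ li] cols_dim[of M] M by auto
  then show "c \<le> n" using d M by (simp add: distinct_card dim_is_n)
qed

section \<open>Concatenation of columns\<close>

lemma col_vec_mult:
  fixes v :: "'a::comm_ring_1 vec"
  assumes "v \<in> carrier_vec n" "a \<in> carrier_vec 1"
  shows "mat_of_cols n [v] *\<^sub>v a = a $ 0 \<cdot>\<^sub>v v"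
  using assms by (intro eq_vecI) (auto simp: scalar_prod_def mat_of_cols_def)

lemma append_cols_carrier [simp, intro]:
  "M \<in> carrier_mat n c \<Longrightarrow> N \<in> carrier_mat n d \<Longrightarrow> M @\<^sub>c N \<in> carrier_mat n (c + d)"
  unfolding append_cols_def by auto

lemma append_cols_mult_vec:
  fixes M :: "'a::comm_ring_1 mat"
  assumes M: "M \<in> carrier_mat n c" and N: "N \<in> carrier_mat n d"
    and u: "u \<in> carrier_vec c" and v: "v \<in> carrier_vec d"
  shows "(M @\<^sub>c N) *\<^sub>v (u @\<^sub>v v) = M *\<^sub>v u + N *\<^sub>v v"
proof -
  have "(M @\<^sub>c N) *\<^sub>v (u @\<^sub>v v) = (M *\<^sub>v u + N *\<^sub>v v) @\<^sub>v
      (0\<^sub>m 0 (dim_col M) *\<^sub>v u + 0\<^sub>m 0 (dim_col N) *\<^sub>v v)"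
    unfolding append_cols_def by (rule four_block_mat_mult_vec[OF M N _ _ u v]) (use M N in auto)
  also have "\<dots> = M *\<^sub>v u + N *\<^sub>v v" using M N by (intro eq_vecI) auto
  finally show ?thesis .
qed

lemma vec_splitE:
  assumes "v \<in> carrier_vec (c + d)"
  obtains u w where "u \<in> carrier_vec c" "w \<in> carrier_vec d" "v = u @\<^sub>v w"
  using vec_first_last_append[OF assms] vec_first_carrier vec_last_carrier by metis

lemma zero_append_vec: "0\<^sub>v c @\<^sub>v 0\<^sub>v d = (0\<^sub>v (c + d) :: 'a::zero vec)"
  by (intro eq_vecI) auto

lemma append_vec_zero_iff:
  assumes "u \<in> carrier_vec c" "w \<in> carrier_vec d"
  shows "u @\<^sub>v w = (0\<^sub>v (c + d) :: 'a::zero vec) \<longleftrightarrow> u = 0\<^sub>v c \<and> w = 0\<^sub>v d"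
  using append_vec_eq[OF assms(1), of "0\<^sub>v c" w "0\<^sub>v d"] zero_append_vec[of c d] by auto

lemma mat_range_append_cols:
  fixes M :: "'a::comm_ring_1 mat"
  assumes M: "M \<in> carrier_mat n c" and N: "N \<in> carrier_mat n d"
  shows "y \<in> mat_range (M @\<^sub>c N) \<longleftrightarrow>
    (\<exists>u \<in> carrier_vec c. \<exists>v \<in> carrier_vec d. y = M *\<^sub>v u + N *\<^sub>v v)" (is "?l \<longleftrightarrow> ?r")
proof
  assume ?l
  then obtain w where w: "w \<in> carrier_vec (c + d)" "y = (M @\<^sub>c N) *\<^sub>v w"
    using mat_range_iff[OF append_cols_carrier[OF M N]] by auto
  from w(1) obtain u v where "u \<in> carrier_vec c" "v \<in> carrier_vec d" "w = u @\<^sub>v v"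
    by (rule vec_splitE)
  then show ?r using append_cols_mult_vec[OF M N] w(2) by blast
next
  assume ?r
  then obtain u v where "u \<in> carrier_vec c" "v \<in> carrier_vec d" "y = M *\<^sub>v u + N *\<^sub>v v" by blast
  then have "y = (M @\<^sub>c N) *\<^sub>v (u @\<^sub>v v)" "u @\<^sub>v v \<in> carrier_vec (c + d)"
    using append_cols_mult_vec[OF M N] by auto
  then show ?l using mat_range_iff[OF append_cols_carrier[OF M N]] by blast
qed

lemma inj_mat_append_cols:
  fixes M :: "'a::comm_ring_1 mat"
  assumes M: "M \<in> carrier_mat n c" and N: "N \<in> carrier_mat n d"
  shows "inj_mat (M @\<^sub>c N) \<longleftrightarrow>
    (\<forall>u \<in> carrier_vec c. \<forall>v \<in> carrier_vec d.
       M *\<^sub>v u + N *\<^sub>v v = 0\<^sub>v n \<longrightarrow> u = 0\<^sub>v c \<and> v = 0\<^sub>v d)" (is "?l \<longleftrightarrow> ?r")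
proof
  assume l: ?l
  show ?r
  proof (intro ballI impI)
    fix u v assume uv: "u \<in> carrier_vec c" "v \<in> carrier_vec d" "M *\<^sub>v u + N *\<^sub>v v = 0\<^sub>v n"
    have "u @\<^sub>v v = 0\<^sub>v (c + d)"
      by (rule inj_matD[OF l append_cols_carrier[OF M N]])
        (use uv append_cols_mult_vec[OF M N] in auto)
    then show "u = 0\<^sub>v c \<and> v = 0\<^sub>v d" using append_vec_zero_iff uv by blast
  qed
next
  assume r: ?r
  show ?l
  proof (rule inj_matI[OF append_cols_carrier[OF M N]])
    fix w assume w: "w \<in> carrier_vec (c + d)" "(M @\<^sub>c N) *\<^sub>v w = 0\<^sub>v n"
    from w(1) obtain u v where "u \<in> carrier_vec c" "v \<in> carrier_vec d" "w = u @\<^sub>v v"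
      by (rule vec_splitE)
    then show "w = 0\<^sub>v (c + d)"
      using append_cols_mult_vec[OF M N] w(2) r zero_append_vec by metis
  qed
qed

text \<open>A nonzero coefficient of the new column could be divided out, which would place
  \<open>v\<close> in the range of \<open>M\<close>.\<close>

lemma inj_mat_append_col:
  fixes M :: "'a::field mat"
  assumes M: "M \<in> carrier_mat n c" and i: "inj_mat M"
    and v: "v \<in> carrier_vec n" "v \<notin> mat_range M"
  shows "inj_mat (M @\<^sub>c mat_of_cols n [v])"
proof -
  have N: "mat_of_cols n [v] \<in> carrier_mat n 1" using mat_of_cols_carrier(1)[of n "[v]"] by simp
  show ?thesis unfolding inj_mat_append_cols[OF M N]
  proof (intro ballI impI)
    fix u a assume u: "u \<in> carrier_vec c" and a: "a \<in> carrier_vec 1"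
      and z: "M *\<^sub>v u + mat_of_cols n [v] *\<^sub>v a = (0\<^sub>v n :: 'a vec)"
    have z': "M *\<^sub>v u + a $ 0 \<cdot>\<^sub>v v = 0\<^sub>v n" using z col_vec_mult[OF v(1) a] by simp
    have Mu: "M *\<^sub>v u \<in> carrier_vec n" using M u by auto
    have a0: "a $ 0 = 0"
    proof (rule ccontr)
      assume ne: "a $ 0 \<noteq> 0"
      have "M *\<^sub>v ((- inverse (a $ 0)) \<cdot>\<^sub>v u) = (- inverse (a $ 0)) \<cdot>\<^sub>v (M *\<^sub>v u)"
        using mult_mat_vec[OF M u] by simp
      also have "\<dots> = v"
      proof (rule eq_vecI)
        fix i assume "i < dim_vec v"
        then have i: "i < n" using v by simp
        then have "(M *\<^sub>v u + a $ 0 \<cdot>\<^sub>v v) $ i = 0" using z' by simp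
        then have "(M *\<^sub>v u) $ i = - (a $ 0 * v $ i)" using i v M by (simp add: eq_neg_iff_add_eq_0)
        then show "((- inverse (a $ 0)) \<cdot>\<^sub>v (M *\<^sub>v u)) $ i = v $ i"
          using ne i M by (simp del: index_mult_mat_vec)
      qed (use v M in auto)
      finally show False using v(2) mat_range_iff[OF M] u by (metis smult_carrier_vec)
    qed
    have "0 \<cdot>\<^sub>v v = 0\<^sub>v n" using v by (intro eq_vecI) auto
    then have "M *\<^sub>v u = 0\<^sub>v n" using z' Mu v a0 by simp
    then have "u = 0\<^sub>v c" using inj_matD[OF i M u] by simp
    moreover have "a = 0\<^sub>v 1" using a a0 by (intro eq_vecI) auto
    ultimately show "u = 0\<^sub>v c \<and> a = 0\<^sub>v 1" by simp
  qed
qed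

text \<open>Take the largest number of columns for which some \<open>Y\<close> keeps
  \<open>M * Y\<close> injective; it exists because an injective matrix has at most \<open>n\<close>
  columns. By maximality no vector of the range of \<open>M\<close> can be adjoined, so the ranges
  agree. The basis of the range is given as \<open>M * Y\<close> so that its elements come with
  preimages.\<close>

lemma rank_factorization:
  fixes M :: "'a::field mat"
  assumes M: "M \<in> carrier_mat n c"
  obtains Y where "Y \<in> carrier_mat c (vec_space.rank n M)" "inj_mat (M * Y)"
    "mat_range (M * Y) = mat_range M"
proof -
  let ?P = "\<lambda>q. \<exists>Y \<in> carrier_mat c q. inj_mat (M * Y)"
  have bnd: "\<forall>q. ?P q \<longrightarrow> q \<le> n"
  proof (intro allI impI)
    fix q assume "?P q"
    then obtain Y where "Y \<in> carrier_mat c q" "inj_mat (M * Y)" by blast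
    then show "q \<le> n" using inj_mat_rank(2)[of "M * Y" n q] M by auto
  qed
  have "?P 0" by (intro bexI[of _ "0\<^sub>m c 0"]) (auto simp: inj_mat_def)
  define q where "q = Greatest ?P"
  have q: "?P q" unfolding q_def by (rule GreatestI_nat[of ?P 0 n]) (use \<open>?P 0\<close> bnd in blast)+
  have mx: "\<And>q'. ?P q' \<Longrightarrow> q' \<le> q" unfolding q_def
    by (rule Greatest_le_nat[of ?P _ n]) (use bnd in blast)+
  from q obtain Y where Y: "Y \<in> carrier_mat c q" and iY: "inj_mat (M * Y)" by blast
  have MY: "M * Y \<in> carrier_mat n q" using M Y by auto
  have "mat_range M \<subseteq> mat_range (M * Y)"
  proof
    fix y assume "y \<in> mat_range M"
    then obtain u where u: "u \<in> carrier_vec c" "y = M *\<^sub>v u" using mat_range_iff[OF M] by auto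
    show "y \<in> mat_range (M * Y)"
    proof (rule ccontr)
      assume ny: "y \<notin> mat_range (M * Y)"
      have y: "y \<in> carrier_vec n" using u M by auto
      have inj: "inj_mat (M * Y @\<^sub>c mat_of_cols n [y])"
        by (rule inj_mat_append_col[OF MY iY y ny])
      have C: "mat_of_cols n [y] \<in> carrier_mat n 1" using mat_of_cols_carrier(1)[of n "[y]"] by simp
      have U: "mat_of_cols c [u] \<in> carrier_mat c 1" using mat_of_cols_carrier(1)[of c "[u]"] by simp
      \<comment> \<open>Adjoining the preimage \<open>u\<close> to \<open>Y\<close> adjoins
        \<open>y = M u\<close> to \<open>M * Y\<close>.\<close>
      let ?Y = "Y @\<^sub>c mat_of_cols c [u]"
      have Y': "?Y \<in> carrier_mat c (q + 1)" by (rule append_cols_carrier[OF Y U])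
      have "inj_mat (M * ?Y)"
      proof (rule inj_matI)
        show "M * ?Y \<in> carrier_mat n (q + 1)" using M Y' by auto
        fix v assume v: "v \<in> carrier_vec (q + 1)" and z: "M * ?Y *\<^sub>v v = 0\<^sub>v n"
        from v obtain a b where ab: "a \<in> carrier_vec q" "b \<in> carrier_vec 1" "v = a @\<^sub>v b"
          by (rule vec_splitE)
        have "M * ?Y *\<^sub>v v = M *\<^sub>v (Y *\<^sub>v a + b $ 0 \<cdot>\<^sub>v u)"
          using assoc_mult_mat_vec[OF M Y' v] append_cols_mult_vec[OF Y U ab(1,2)] ab(3)
            col_vec_mult[OF u(1) ab(2)] by simp
        also have "\<dots> = M *\<^sub>v (Y *\<^sub>v a) + b $ 0 \<cdot>\<^sub>v y"
          using mult_add_distrib_mat_vec[OF M] Y ab u mult_mat_vec[OF M u(1)] by simp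
        also have "\<dots> = (M * Y) *\<^sub>v a + mat_of_cols n [y] *\<^sub>v b"
          using assoc_mult_mat_vec[OF M Y ab(1)] col_vec_mult[OF y ab(2)] by simp
        finally have "a = 0\<^sub>v q \<and> b = 0\<^sub>v 1"
          using inj[unfolded inj_mat_append_cols[OF MY C]] ab z by auto
        then show "v = 0\<^sub>v (q + 1)" using ab zero_append_vec by metis
      qed
      then have "q + 1 \<le> q" using mx Y' by blast
      then show False by simp
    qed
  qed
  then have eq: "mat_range (M * Y) = mat_range M" using mat_range_mult_subset[OF M Y] by auto
  have "vec_space.rank n M = q"
    using rank_cong_mat_range[OF MY M eq] inj_mat_rank(1)[OF MY iY] by simp
  then show ?thesis using that Y iY eq by simp
qed

section \<open>Comparison of ranges and ranks\<close>

lemma mat_range_subset_factor: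
  fixes M :: "'a::comm_ring_1 mat"
  assumes M: "M \<in> carrier_mat n c" and N: "N \<in> carrier_mat n d"
    and s: "mat_range M \<subseteq> mat_range N"
  obtains X where "X \<in> carrier_mat d c" "M = N * X"
proof -
  have "\<exists>x. x \<in> carrier_vec d \<and> col M j = N *\<^sub>v x" if "j < c" for j
  proof -
    have "col M j = M *\<^sub>v unit_vec c j" using mat_mult_unit_vec[OF M that] by simp
    then have "col M j \<in> mat_range M" using mat_range_iff[OF M] by auto
    then show ?thesis using s mat_range_iff[OF N] by blast
  qed
  then obtain x where x: "\<And>j. j < c \<Longrightarrow> x j \<in> carrier_vec d \<and> col M j = N *\<^sub>v x j" by metis
  let ?X = "mat_of_cols d (map x [0..<c])"
  have X: "?X \<in> carrier_mat d c" using mat_of_cols_carrier(1)[of d "map x [0..<c]"] by simp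
  have "M = N * ?X"
  proof (rule mat_col_eqI)
    fix j assume "j < dim_col (N * ?X)"
    then have j: "j < c" by simp
    have "col (N * ?X) j = N *\<^sub>v col ?X j" using col_mult2[OF N X j] .
    also have "col ?X j = x j" using j x by (simp add: col_mat_of_cols)
    finally show "col M j = col (N * ?X) j" using x j by simp
  qed (use M N X in auto)
  then show ?thesis using that X by blast
qed

lemma inj_mat_factor_right:
  fixes N :: "'a::comm_ring_1 mat"
  assumes "N \<in> carrier_mat n d" "X \<in> carrier_mat d c" "inj_mat (N * X)"
  shows "inj_mat X"
proof (rule inj_matI[OF assms(2)])
  fix v assume v: "v \<in> carrier_vec c" "X *\<^sub>v v = 0\<^sub>v d"
  have "N * X *\<^sub>v v = 0\<^sub>v n"
    using assoc_mult_mat_vec[OF assms(1,2) v(1)] v(2) mat_mult_zero_vec[OF assms(1)] by simp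
  then show "v = 0\<^sub>v c" by (rule inj_matD[OF assms(3) mult_carrier_mat[OF assms(1,2)] v(1)])
qed

lemma inj_mat_mult:
  fixes N :: "'a::comm_ring_1 mat"
  assumes N: "N \<in> carrier_mat n d" and X: "X \<in> carrier_mat d c" and "inj_mat N" "inj_mat X"
  shows "inj_mat (N * X)"
proof (rule inj_matI)
  show "N * X \<in> carrier_mat n c" using N X by auto
  fix v assume v: "v \<in> carrier_vec c" "N * X *\<^sub>v v = 0\<^sub>v n"
  have "X *\<^sub>v v = 0\<^sub>v d"
    using inj_matD[OF assms(3) N mult_mat_vec_carrier[OF X v(1)]]
      assoc_mult_mat_vec[OF N X v(1)] v(2) by simp
  then show "v = 0\<^sub>v c" using inj_matD[OF assms(4) X v(1)] by simp
qed

text \<open>Bases of the two ranges differ by a right factor \<open>X\<close>. Injectivity of the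
  product passes to \<open>X\<close>, and an injective matrix has at least as many rows as
  columns.\<close>

lemma rank_mono:
  fixes M :: "'a::field mat"
  assumes M: "M \<in> carrier_mat n c" and N: "N \<in> carrier_mat n d"
    and s: "mat_range M \<subseteq> mat_range N"
  shows "vec_space.rank n M \<le> vec_space.rank n N"
proof -
  obtain Y where Y: "Y \<in> carrier_mat c (vec_space.rank n M)" "inj_mat (M * Y)"
    "mat_range (M * Y) = mat_range M" by (rule rank_factorization[OF M])
  obtain Z where Z: "Z \<in> carrier_mat d (vec_space.rank n N)" "inj_mat (N * Z)"
    "mat_range (N * Z) = mat_range N" by (rule rank_factorization[OF N])
  have MY: "M * Y \<in> carrier_mat n (vec_space.rank n M)" using M Y by auto
  have NZ: "N * Z \<in> carrier_mat n (vec_space.rank n N)" using N Z by auto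
  have "mat_range (M * Y) \<subseteq> mat_range (N * Z)" using s Y Z by simp
  then obtain X where X: "X \<in> carrier_mat (vec_space.rank n N) (vec_space.rank n M)"
    "M * Y = (N * Z) * X"
    by (rule mat_range_subset_factor[OF MY NZ])
  have "inj_mat X" using inj_mat_factor_right[OF NZ X(1)] Y(2) X(2) by simp
  then show ?thesis using inj_mat_rank(2)[OF X(1)] by simp
qed

lemma inj_mat_rank_le:
  fixes L :: "'a::field mat"
  assumes "L \<in> carrier_mat n p" "inj_mat L" "N \<in> carrier_mat n d" "mat_range L \<subseteq> mat_range N"
  shows "p \<le> vec_space.rank n N"
  using rank_mono[OF assms(1,3,4)] inj_mat_rank(1)[OF assms(1,2)] by simp

lemma rank_le_spanning:
  fixes M :: "'a::field mat"
  assumes "M \<in> carrier_mat n c" "N \<in> carrier_mat n d" "mat_range M \<subseteq> mat_range N"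
  shows "vec_space.rank n M \<le> d"
  using rank_mono[OF assms] vec_space.rank_le_nc[OF assms(2)] by simp

section \<open>Invertible and injective factors\<close>

lemma inj_mat_iff_det:
  fixes M :: "'a::field mat"
  assumes M: "M \<in> carrier_mat n n"
  shows "inj_mat M \<longleftrightarrow> det M \<noteq> 0"
  using det_0_iff_vec_prod_zero_field[OF M] M unfolding inj_mat_def by auto

lemma det_nonzero_inverseE:
  fixes M :: "'a::field mat"
  assumes M: "M \<in> carrier_mat n n" and d: "det M \<noteq> 0"
  obtains P where "P \<in> carrier_mat n n" "P * M = 1\<^sub>m n" "M * P = 1\<^sub>m n"
  using det_non_zero_imp_unit[OF M d, of "()"] unfolding Units_def
  by (auto simp: ring_mat_simps)

text \<open>When the rank equals the number of columns, the factor \<open>Y\<close> of the rank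
  factorization is square and injective, hence invertible, and \<open>M\<close> is recovered from
  the injective \<open>M * Y\<close> by cancelling \<open>Y\<close>.\<close>

lemma inj_mat_iff_rank:
  fixes M :: "'a::field mat"
  assumes M: "M \<in> carrier_mat n c"
  shows "inj_mat M \<longleftrightarrow> vec_space.rank n M = c"
proof
  assume r: "vec_space.rank n M = c"
  obtain Y where Y: "Y \<in> carrier_mat c c" "inj_mat (M * Y)"
    using rank_factorization[OF M] r by metis
  have "det Y \<noteq> 0" using inj_mat_factor_right[OF M Y] inj_mat_iff_det[OF Y(1)] by simp
  then obtain P where P: "P \<in> carrier_mat c c" "P * Y = 1\<^sub>m c" "Y * P = 1\<^sub>m c"
    by (rule det_nonzero_inverseE[OF Y(1)])
  have "inj_mat P"
    using inj_mat_factor_right[OF Y(1) P(1)] P by (simp add: inj_mat_def)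
  then have "inj_mat (M * Y * P)" using inj_mat_mult[OF mult_carrier_mat[OF M Y(1)] P(1) Y(2)] by simp
  also have "M * Y * P = M" using M Y P by (simp add: assoc_mult_mat[OF M Y(1) P(1)])
  finally show "inj_mat M" .
qed (use inj_mat_rank(1)[OF M] in simp)

text \<open>An injective left factor sends a basis of the range of \<open>M\<close> to a basis of
  the range of \<open>P * M\<close>. It serves to move ranks across multiplication by
  \<open>transpose_mat Q\<close>.\<close>

lemma rank_mult_left_inj:
  fixes M :: "'a::field mat"
  assumes P: "P \<in> carrier_mat k n" "inj_mat P" and M: "M \<in> carrier_mat n c"
  shows "vec_space.rank k (P * M) = vec_space.rank n M"
proof -
  obtain Y where Y: "Y \<in> carrier_mat c (vec_space.rank n M)" "inj_mat (M * Y)"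
    "mat_range (M * Y) = mat_range M" by (rule rank_factorization[OF M])
  have MY: "M * Y \<in> carrier_mat n (vec_space.rank n M)" using M Y by auto
  have PMY: "P * (M * Y) \<in> carrier_mat k (vec_space.rank n M)" using P MY by auto
  have PM: "P * M \<in> carrier_mat k c" using P M by auto
  have i: "inj_mat (P * (M * Y))" by (rule inj_mat_mult[OF P(1) MY P(2) Y(2)])
  have im: "mat_range (P * N) = (\<lambda>v. P *\<^sub>v v) ` mat_range N" if "N \<in> carrier_mat n d" for N d
  proof -
    have "mat_range (P * N) = (\<lambda>v. P *\<^sub>v (N *\<^sub>v v)) ` carrier_vec d"
      unfolding mat_range_def using that P(1) by (intro image_cong) auto
    then show ?thesis unfolding mat_range_def using that by (auto simp: image_image)
  qed
  have "mat_range (P * (M * Y)) = mat_range (P * M)" using im[OF MY] im[OF M] Y(3) by simp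
  then show ?thesis using rank_cong_mat_range[OF PMY PM] inj_mat_rank(1)[OF PMY i] by simp
qed

text \<open>Basis extension in which the new vectors are drawn from the range of \<open>B\<close>
  and recorded by their preimages \<open>V\<close>. The matrix \<open>V\<close> is what later enters
  the feedback; with \<open>B\<close> the identity the lemma completes a basis of the whole
  space.\<close>

lemma inj_mat_extend:
  fixes M :: "'a::field mat"
  assumes M: "M \<in> carrier_mat n p" and i: "inj_mat M" and B: "B \<in> carrier_mat n m"
    and q: "p + q \<le> vec_space.rank n (M @\<^sub>c B)"
  obtains V where "V \<in> carrier_mat m q" "inj_mat (M @\<^sub>c B * V)"
proof -
  have "\<exists>V \<in> carrier_mat m q. inj_mat (M @\<^sub>c B * V)" using q
  proof (induction q)
    case 0
    have "inj_mat (M @\<^sub>c B * 0\<^sub>m m 0)"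
    proof (subst inj_mat_append_cols[OF M, of _ 0], goal_cases)
      case 2
      have z: "0\<^sub>m n 0 *\<^sub>v v = (0\<^sub>v n :: 'a vec)" if "v \<in> carrier_vec 0" for v
        using that by (intro eq_vecI) (auto simp: scalar_prod_def)
      show ?case
      proof (intro ballI impI)
        fix u and v :: "'a vec"
        assume u: "u \<in> carrier_vec p" and v: "v \<in> carrier_vec 0"
          and "M *\<^sub>v u + B * 0\<^sub>m m 0 *\<^sub>v v = 0\<^sub>v n"
        then have "M *\<^sub>v u = 0\<^sub>v n" using B M z[OF v] by simp
        then show "u = 0\<^sub>v p \<and> v = 0\<^sub>v 0" using inj_matD[OF i M u] v by auto
      qed
    qed (use B in auto)
    then show ?case by (intro bexI[of _ "0\<^sub>m m 0"]) auto
  next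
    case (Suc q)
    then obtain V where V: "V \<in> carrier_mat m q" "inj_mat (M @\<^sub>c B * V)" by auto
    have BV: "B * V \<in> carrier_mat n q" using B V by auto
    let ?N = "M @\<^sub>c B * V"
    have N: "?N \<in> carrier_mat n (p + q)" using M BV by auto
    have MB: "M @\<^sub>c B \<in> carrier_mat n (p + m)" using M B by auto
    \<comment> \<open>Otherwise the \<open>p + q\<close> columns of \<open>?N\<close> would span the
      range of \<open>[M B]\<close>, whose dimension is at least \<open>p + q + 1\<close>.\<close>
    have "\<exists>u \<in> carrier_vec m. B *\<^sub>v u \<notin> mat_range ?N"
    proof (rule ccontr)
      assume "\<not> ?thesis"
      then have h: "\<And>u. u \<in> carrier_vec m \<Longrightarrow> B *\<^sub>v u \<in> mat_range ?N" by blast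
      have "mat_range (M @\<^sub>c B) \<subseteq> mat_range ?N"
      proof
        fix y assume "y \<in> mat_range (M @\<^sub>c B)"
        then obtain u v where uv: "u \<in> carrier_vec p" "v \<in> carrier_vec m" "y = M *\<^sub>v u + B *\<^sub>v v"
          using mat_range_append_cols[OF M B] by blast
        obtain u' v' where uv': "u' \<in> carrier_vec p" "v' \<in> carrier_vec q"
          "B *\<^sub>v v = M *\<^sub>v u' + B * V *\<^sub>v v'"
          using h[OF uv(2)] mat_range_append_cols[OF M BV] by blast
        have "y = M *\<^sub>v (u + u') + B * V *\<^sub>v v'"
          unfolding uv(3) uv'(3) using M BV uv uv'
          by (simp add: mult_add_distrib_mat_vec[OF M] assoc_add_vec[of _ n])
        then show "y \<in> mat_range ?N" using mat_range_append_cols[OF M BV] uv uv'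
          by (metis add_carrier_vec)
      qed
      then have "vec_space.rank n (M @\<^sub>c B) \<le> p + q" by (rule rank_le_spanning[OF MB N])
      then show False using Suc.prems by simp
    qed
    then obtain u where u: "u \<in> carrier_vec m" "B *\<^sub>v u \<notin> mat_range ?N" by blast
    have Bu: "B *\<^sub>v u \<in> carrier_vec n" using B u by auto
    have inj: "inj_mat (?N @\<^sub>c mat_of_cols n [B *\<^sub>v u])"
      by (rule inj_mat_append_col[OF N V(2) Bu u(2)])
    have C: "mat_of_cols n [B *\<^sub>v u] \<in> carrier_mat n 1"
      using mat_of_cols_carrier(1)[of n "[B *\<^sub>v u]"] by simp
    have U: "mat_of_cols m [u] \<in> carrier_mat m 1" using mat_of_cols_carrier(1)[of m "[u]"] by simp
    let ?V = "V @\<^sub>c mat_of_cols m [u]"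
    have V': "?V \<in> carrier_mat m (Suc q)" using append_cols_carrier[OF V(1) U] by simp
    have BV': "B * ?V \<in> carrier_mat n (Suc q)" using B V' by auto
    have "inj_mat (M @\<^sub>c B * ?V)"
      unfolding inj_mat_append_cols[OF M BV']
    proof (intro ballI impI)
      fix a v assume a: "a \<in> carrier_vec p" and v: "v \<in> carrier_vec (Suc q)"
        and z: "M *\<^sub>v a + B * ?V *\<^sub>v v = 0\<^sub>v n"
      from v obtain b c where bc: "b \<in> carrier_vec q" "c \<in> carrier_vec 1" "v = b @\<^sub>v c"
        using vec_splitE[of v q 1] by auto
      have "B * ?V *\<^sub>v v = B *\<^sub>v (V *\<^sub>v b + c $ 0 \<cdot>\<^sub>v u)"
        using assoc_mult_mat_vec[OF B V' v] append_cols_mult_vec[OF V(1) U bc(1,2)] bc(3)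
          col_vec_mult[OF u(1) bc(2)] by simp
      also have "\<dots> = B * V *\<^sub>v b + mat_of_cols n [B *\<^sub>v u] *\<^sub>v c"
        using mult_add_distrib_mat_vec[OF B] V bc u mult_mat_vec[OF B u(1)]
          assoc_mult_mat_vec[OF B V(1) bc(1)] col_vec_mult[OF Bu bc(2)] by simp
      finally have "?N *\<^sub>v (a @\<^sub>v b) + mat_of_cols n [B *\<^sub>v u] *\<^sub>v c = 0\<^sub>v n"
        using z append_cols_mult_vec[OF M BV a bc(1)] M BV C a bc
        by (simp add: assoc_add_vec[of _ n])
      moreover have "a @\<^sub>v b \<in> carrier_vec (p + q)" using a bc by auto
      ultimately have "a @\<^sub>v b = 0\<^sub>v (p + q) \<and> c = 0\<^sub>v 1"
        using inj[unfolded inj_mat_append_cols[OF N C]] bc by blast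
      then show "a = 0\<^sub>v p \<and> v = 0\<^sub>v (Suc q)"
        using append_vec_zero_iff[OF a bc(1)] bc zero_append_vec[of q 1] by auto
    qed
    then show ?case using V' by blast
  qed
  then show ?thesis using that by blast
qed

subsection \<open>Impulse-freeness as a kernel condition\<close>

text \<open>The bounds need not be attained: if one of them is strict, both sides vanish.\<close>

lemma coeff_mult_degree_bound:
  fixes p q :: "'a::comm_semiring_0 poly"
  assumes "degree p \<le> a" "degree q \<le> b"
  shows "coeff (p * q) (a + b) = coeff p a * coeff q b"
proof (cases "degree p = a \<and> degree q = b")
  case True
  then show ?thesis using coeff_mult_degree_sum[of p q] by auto
next
  case False
  then have "degree p < a \<or> degree q < b" using assms by linarith
  then have "degree (p * q) < a + b" and "coeff p a * coeff q b = 0"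
    using assms degree_mult_le[of p q] by (auto simp: coeff_eq_0)
  then show ?thesis by (simp add: coeff_eq_0)
qed

lemma coeff_prod_degree_bound:
  fixes f :: "'b \<Rightarrow> 'a::comm_semiring_1 poly"
  assumes "finite S" "\<And>i. i \<in> S \<Longrightarrow> degree (f i) \<le> d i"
  shows "degree (prod f S) \<le> sum d S" "coeff (prod f S) (sum d S) = (\<Prod>i\<in>S. coeff (f i) (d i))"
proof -
  have "degree (prod f S) \<le> sum d S \<and> coeff (prod f S) (sum d S) = (\<Prod>i\<in>S. coeff (f i) (d i))"
    using assms
  proof (induction S rule: finite_induct)
    case (insert x S)
    then have IH: "degree (prod f S) \<le> sum d S"
      "coeff (prod f S) (sum d S) = (\<Prod>i\<in>S. coeff (f i) (d i))" by auto
    have x: "degree (f x) \<le> d x" using insert by auto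
    have "degree (f x * prod f S) \<le> d x + sum d S"
      using degree_mult_le[of "f x" "prod f S"] x IH(1) by linarith
    then show ?case using insert(1,2) coeff_mult_degree_bound[OF x IH(1)] IH(2) by simp
  qed auto
  then show "degree (prod f S) \<le> sum d S"
    "coeff (prod f S) (sum d S) = (\<Prod>i\<in>S. coeff (f i) (d i))" by auto
qed

text \<open>Reduces the degree condition on \<open>det (s E - A)\<close> to a single determinant over the reals.\<close>

lemma det_row_degree_bound:
  fixes M :: "'a::comm_ring_1 poly mat"
  assumes M: "M \<in> carrier_mat n n"
    and d: "\<And>i j. i < n \<Longrightarrow> j < n \<Longrightarrow> degree (M $$ (i, j)) \<le> d i"
  shows "degree (det M) \<le> (\<Sum>i<n. d i)"
    "coeff (det M) (\<Sum>i<n. d i) = det (mat n n (\<lambda>(i, j). coeff (M $$ (i, j)) (d i)))"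
proof -
  let ?s = "\<Sum>i<n. d i"
  let ?P = "{p. p permutes {0..<n}}"
  have s: "?s = sum d {0..<n}" by (simp add: atLeast0LessThan)
  have p: "degree (\<Prod>i = 0..<n. M $$ (i, p i)) \<le> ?s"
    "coeff (\<Prod>i = 0..<n. M $$ (i, p i)) ?s = (\<Prod>i = 0..<n. coeff (M $$ (i, p i)) (d i))"
    if "p \<in> ?P" for p
    unfolding s using d permutes_in_image[of p "{0..<n}"] that
    by (auto intro!: coeff_prod_degree_bound)
  have sg: "degree (signof p * q) \<le> degree q" "coeff (signof p * q) k = signof p * coeff q k"
    for p k and q :: "'a poly"
    by (auto simp: sign_def)
  show "degree (det M) \<le> ?s" unfolding det_def'[OF M]
  proof (rule degree_sum_le)
    show "finite ?P" by (simp add: finite_permutations)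
    fix q assume "q \<in> ?P"
    then show "degree (signof q * (\<Prod>i = 0..<n. M $$ (i, q i))) \<le> ?s"
      using order_trans[OF sg(1) p(1)] by blast
  qed
  have "coeff (det M) ?s = (\<Sum>q\<in>?P. signof q * (\<Prod>i = 0..<n. coeff (M $$ (i, q i)) (d i)))"
    unfolding det_def'[OF M] coeff_sum sg(2) using p(2) by (intro sum.cong) auto
  also have "\<dots> = det (mat n n (\<lambda>(i, j). coeff (M $$ (i, j)) (d i)))"
    unfolding det_def'[OF mat_carrier]
    by (intro sum.cong arg_cong2[of _ _ _ _ times] prod.cong) (auto dest: permutes_in_image)
  finally show "coeff (det M) ?s = det (mat n n (\<lambda>(i, j). coeff (M $$ (i, j)) (d i)))" .
qed

text \<open>A constant left factor is pulled out of the determinant, so rows may be transformed by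
  an invertible matrix without changing the degree.\<close>

lemma pencil_det_poly_mult_left:
  assumes N: "N \<in> carrier_mat n n" and E: "E \<in> carrier_mat n n" and A: "A \<in> carrier_mat n n"
  shows "pencil_det_poly (N * E) (N * A) = [:det N:] * pencil_det_poly E A"
proof -
  interpret h: comm_ring_hom "\<lambda>a::real. [:a:]" by unfold_locales auto
  let ?h = "map_mat (\<lambda>a::real. [:a:])"
  have "[:0, 1:] \<cdot>\<^sub>m ?h (N * E) - ?h (N * A) = [:0, 1:] \<cdot>\<^sub>m (?h N * ?h E) - ?h N * ?h A"
    unfolding h.mat_hom_mult[OF N E] h.mat_hom_mult[OF N A] ..
  also have "\<dots> = ?h N * ([:0, 1:] \<cdot>\<^sub>m ?h E) - ?h N * ?h A"
    by (subst mult_smult_distrib[of "?h N" n n "?h E" n]) (use N E in auto)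
  also have "\<dots> = ?h N * ([:0, 1:] \<cdot>\<^sub>m ?h E - ?h A)"
    by (rule mult_minus_distrib_mat[symmetric, of _ n n _ n]) (use N E A in auto)
  finally have "pencil_det_poly (N * E) (N * A) = det (?h N * ([:0, 1:] \<cdot>\<^sub>m ?h E - ?h A))"
    unfolding pencil_det_poly_def by simp
  also have "\<dots> = det (?h N) * det ([:0, 1:] \<cdot>\<^sub>m ?h E - ?h A)"
    by (rule det_mult[of _ n]) (use N E A in \<open>auto intro!: minus_carrier_mat\<close>)
  finally show ?thesis unfolding pencil_det_poly_def by simp
qed

text \<open>In coordinates adapted to the range of \<open>E\<close> only the first \<open>r\<close>
  rows of the pencil contain \<open>s\<close>. The determinant then has degree at most
  \<open>r\<close>, and its coefficient at \<open>s^r\<close> is the determinant of a constant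
  matrix \<open>H\<close> made of the upper rows of \<open>E\<close> and the lower rows of
  \<open>-A\<close>. The kernel of \<open>H\<close> is the set of \<open>x\<close> with
  \<open>E x = 0\<close> and \<open>A x\<close> in the range of \<open>E\<close>.\<close>

lemma regular_impulse_free_iff:
  assumes E: "E \<in> carrier_mat n n" and A: "A \<in> carrier_mat n n"
  shows "regular_impulse_free E A \<longleftrightarrow>
    (\<forall>x \<in> carrier_vec n. \<forall>w \<in> carrier_vec n. E *\<^sub>v x = 0\<^sub>v n \<longrightarrow> A *\<^sub>v x = E *\<^sub>v w \<longrightarrow> x = 0\<^sub>v n)"
proof -
  define r where "r = vec_space.rank n E"
  obtain Y where Y: "Y \<in> carrier_mat n r" "inj_mat (E * Y)" "mat_range (E * Y) = mat_range E"
    using rank_factorization[OF E] unfolding r_def by blast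
  define L where "L = E * Y"
  have L: "L \<in> carrier_mat n r" "inj_mat L" "mat_range L = mat_range E"
    using Y E by (auto simp: L_def)
  have rn: "r \<le> n" using inj_mat_rank(2)[OF L(1,2)] .
  obtain R where R: "R \<in> carrier_mat r n" "E = L * R"
    using mat_range_subset_factor[OF E L(1)] L(3) by auto
  have LI: "L @\<^sub>c 1\<^sub>m n \<in> carrier_mat n (r + n)" using L(1) by auto
  \<comment> \<open>This makes \<open>[L I]\<close> of rank \<open>n\<close>, so the basis
    \<open>L\<close> of the range of \<open>E\<close> can be completed by \<open>n - r\<close>
    columns.\<close>
  have "mat_range (1\<^sub>m n) \<subseteq> mat_range (L @\<^sub>c 1\<^sub>m n)"
  proof
    fix y assume "y \<in> mat_range (1\<^sub>m n :: real mat)"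
    then have y: "y \<in> carrier_vec n" using mat_range_carrier[of "1\<^sub>m n" n n] by auto
    have "y = L *\<^sub>v 0\<^sub>v r + 1\<^sub>m n *\<^sub>v y" using y L(1) by (simp add: mat_mult_zero_vec)
    then show "y \<in> mat_range (L @\<^sub>c 1\<^sub>m n)"
      using mat_range_append_cols[OF L(1) one_carrier_mat] y by (metis zero_carrier_vec)
  qed
  moreover have "inj_mat (1\<^sub>m n :: real mat)" by (rule inj_matI[of _ n n]) auto
  ultimately have "n \<le> vec_space.rank n (L @\<^sub>c 1\<^sub>m n)"
    using inj_mat_rank_le[OF one_carrier_mat _ LI] by blast
  then have "r + (n - r) \<le> vec_space.rank n (L @\<^sub>c 1\<^sub>m n)" using rn by simp
  then obtain V where V: "V \<in> carrier_mat n (n - r)" "inj_mat (L @\<^sub>c 1\<^sub>m n * V)"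
    by (rule inj_mat_extend[OF L(1,2) one_carrier_mat])
  \<comment> \<open>Multiplying by \<open>N\<^sup>-\<^sup>1\<close> makes the last \<open>n - r\<close> rows of \<open>E\<close> vanish.\<close>
  define N where "N = L @\<^sub>c V"
  have N: "N \<in> carrier_mat n n" using append_cols_carrier[OF L(1) V(1)] rn by (simp add: N_def)
  have "det N \<noteq> 0" using V N inj_mat_iff_det[OF N] by (simp add: N_def)
  then obtain P where P: "P \<in> carrier_mat n n" "P * N = 1\<^sub>m n" "N * P = 1\<^sub>m n"
    by (rule det_nonzero_inverseE[OF N])
  define A\<^sub>0 where "A\<^sub>0 = P * A"
  have A0: "A\<^sub>0 \<in> carrier_mat n n" "A = N * A\<^sub>0"
    using P N A by (auto simp: A\<^sub>0_def assoc_mult_mat[OF N P(1) A, symmetric])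
  define R\<^sub>0 where "R\<^sub>0 = P * E"
  have R0: "R\<^sub>0 \<in> carrier_mat n n" "E = N * R\<^sub>0"
    using P N E by (auto simp: R\<^sub>0_def assoc_mult_mat[OF N P(1) E, symmetric])
  have PL: "P *\<^sub>v (L *\<^sub>v z) = z @\<^sub>v 0\<^sub>v (n - r)" if z: "z \<in> carrier_vec r" for z
  proof -
    have "N *\<^sub>v (z @\<^sub>v 0\<^sub>v (n - r)) = L *\<^sub>v z + V *\<^sub>v 0\<^sub>v (n - r)"
      unfolding N_def by (rule append_cols_mult_vec[OF L(1) V(1) z]) simp
    also have "\<dots> = L *\<^sub>v z" using mat_mult_zero_vec[OF V(1)] L(1) z by simp
    finally have "P *\<^sub>v (L *\<^sub>v z) = (P * N) *\<^sub>v (z @\<^sub>v 0\<^sub>v (n - r))"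
      using assoc_mult_mat_vec[OF P(1) N, of "z @\<^sub>v 0\<^sub>v (n - r)"] z rn
      by (metis append_carrier_vec le_add_diff_inverse zero_carrier_vec)
    moreover have "z @\<^sub>v 0\<^sub>v (n - r) \<in> carrier_vec n"
      using append_carrier_vec[OF z, of "0\<^sub>v (n - r)" "n - r"] rn by simp
    ultimately show ?thesis using P(2) by simp
  qed
  have R0x: "R\<^sub>0 *\<^sub>v x = (R *\<^sub>v x) @\<^sub>v 0\<^sub>v (n - r)" if x: "x \<in> carrier_vec n" for x
    using PL[of "R *\<^sub>v x"] x R(1) assoc_mult_mat_vec[OF P(1) E x]
      assoc_mult_mat_vec[OF L(1) R(1) x] R(2) by (simp add: R\<^sub>0_def)
  have R0z: "R\<^sub>0 $$ (i, j) = 0" if "i < n" "j < n" "r \<le> i" for i j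
  proof -
    have "R\<^sub>0 $$ (i, j) = (R\<^sub>0 *\<^sub>v unit_vec n j) $ i"
      using mat_mult_unit_vec[OF R0(1) that(2)] that R0 by simp
    then show ?thesis using R0x[of "unit_vec n j"] that R(1) by simp
  qed
  \<comment> \<open>The leading coefficients row by row: that of \<open>s\<close> in the first
    \<open>r\<close> rows, the constant one in the others.\<close>
  define H where "H = mat n n (\<lambda>(i, j). if i < r then R\<^sub>0 $$ (i, j) else - A\<^sub>0 $$ (i, j))"
  have H: "H \<in> carrier_mat n n" by (simp add: H_def)
  let ?M = "[:0, 1:] \<cdot>\<^sub>m map_mat (\<lambda>a. [:a:]) R\<^sub>0 - map_mat (\<lambda>a. [:a:]) A\<^sub>0"
  let ?d = "\<lambda>i. if i < r then 1 else 0 :: nat"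
  have M: "?M \<in> carrier_mat n n" using R0 A0 by auto
  have Mij: "?M $$ (i, j) = [:- A\<^sub>0 $$ (i, j), R\<^sub>0 $$ (i, j):]" if "i < n" "j < n" for i j
    using that R0 A0 by simp
  have deg: "degree (?M $$ (i, j)) \<le> ?d i" if "i < n" "j < n" for i j
    using Mij[OF that] R0z that by auto
  have "(\<Sum>i<n. ?d i) = card ({..<n} \<inter> {..<r})"
    by (subst sum.inter_restrict[symmetric, where g="\<lambda>_. 1" and B="{..<r}", simplified]) auto
  also have "{..<n} \<inter> {..<r} = {..<r}" using rn by auto
  finally have sd: "(\<Sum>i<n. ?d i) = r" by simp
  have "mat n n (\<lambda>(i, j). coeff (?M $$ (i, j)) (?d i)) = H"
    unfolding H_def by (intro eq_matI) (simp_all del: index_minus_mat add: Mij)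
  then have dM: "degree (det ?M) \<le> r" "coeff (det ?M) r = det H"
    using det_row_degree_bound[OF M deg] sd by simp_all
  have pd: "pencil_det_poly E A = [:det N:] * (det ?M)"
    using pencil_det_poly_mult_left[OF N R0(1) A0(1), folded R0(2) A0(2)]
    unfolding pencil_det_poly_def[of R\<^sub>0] .
  have "regular_impulse_free E A \<longleftrightarrow> det ?M \<noteq> 0 \<and> degree (det ?M) = r"
    unfolding regular_impulse_free_def pd using \<open>det N \<noteq> 0\<close> E by (simp add: r_def)
  \<comment> \<open>A nonzero coefficient at the degree bound \<open>r\<close> gives degree
    \<open>r\<close>; for \<open>r = 0\<close> it also rules out the zero polynomial, whose degree
    is 0 as well.\<close>
  also have "\<dots> \<longleftrightarrow> det H \<noteq> 0"
    using dM by (metis antisym coeff_0 le_degree leading_coeff_0_iff)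
  also have "\<dots> \<longleftrightarrow> inj_mat H" using inj_mat_iff_det[OF H] by simp
  finally have rif: "regular_impulse_free E A \<longleftrightarrow> inj_mat H" .
  \<comment> \<open>The upper rows of \<open>H x\<close> are the coordinates of \<open>E x\<close>
    with respect to \<open>L\<close>. The lower ones vanish iff \<open>A x\<close> has no component
    along the completing columns \<open>V\<close>, that is, iff it lies in the range of
    \<open>L\<close>, which is the range of \<open>E\<close>.\<close>
  have Hx: "H *\<^sub>v x = 0\<^sub>v n \<longleftrightarrow> E *\<^sub>v x = 0\<^sub>v n \<and> (\<exists>w \<in> carrier_vec n. A *\<^sub>v x = E *\<^sub>v w)"
    if x: "x \<in> carrier_vec n" for x
  proof -
    have Hi: "(H *\<^sub>v x) $ i = (if i < r then (R *\<^sub>v x) $ i else - ((A\<^sub>0 *\<^sub>v x) $ i))" if i: "i < n" for i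
    proof (cases "i < r")
      case True
      have "row H i = row R\<^sub>0 i" using True i R0 by (intro eq_vecI) (auto simp: H_def)
      then have "(H *\<^sub>v x) $ i = (R\<^sub>0 *\<^sub>v x) $ i" using i R0 H by simp
      then show ?thesis using R0x[OF x] True i R(1) by simp
    next
      case False
      have "row H i = - row A\<^sub>0 i" using False i A0 by (intro eq_vecI) (auto simp: H_def)
      then have "(H *\<^sub>v x) $ i = - row A\<^sub>0 i \<bullet> x" using i H by simp
      also have "\<dots> = - ((A\<^sub>0 *\<^sub>v x) $ i)" using i A0(1) x by simp
      finally show ?thesis using False by simp
    qed
    have Ex: "E *\<^sub>v x = L *\<^sub>v (R *\<^sub>v x)" using assoc_mult_mat_vec[OF L(1) R(1) x] R(2) by simp
    have Rx: "R *\<^sub>v x \<in> carrier_vec r" using R x by auto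
    have A0x: "A\<^sub>0 *\<^sub>v x \<in> carrier_vec n" using A0 x by auto
    have "H *\<^sub>v x = 0\<^sub>v n \<longleftrightarrow> (\<forall>i<n. (H *\<^sub>v x) $ i = 0)" using H by (auto simp: vec_eq_iff)
    also have "\<dots> \<longleftrightarrow> (\<forall>i<r. (R *\<^sub>v x) $ i = 0) \<and> (\<forall>i. r \<le> i \<longrightarrow> i < n \<longrightarrow> (A\<^sub>0 *\<^sub>v x) $ i = 0)"
      using Hi rn by (metis leD leI less_le_trans neg_equal_0_iff_equal)
    also have "(\<forall>i<r. (R *\<^sub>v x) $ i = 0) \<longleftrightarrow> R *\<^sub>v x = 0\<^sub>v r" using R(1) by (auto simp: vec_eq_iff)
    also have "\<dots> \<longleftrightarrow> E *\<^sub>v x = 0\<^sub>v n"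
    proof
      show "E *\<^sub>v x = 0\<^sub>v n" if "R *\<^sub>v x = 0\<^sub>v r"
        unfolding Ex that by (rule mat_mult_zero_vec[OF L(1)])
      show "R *\<^sub>v x = 0\<^sub>v r" if "E *\<^sub>v x = 0\<^sub>v n"
        using that unfolding Ex by (rule inj_matD[OF L(2,1) Rx])
    qed
    also have "(\<forall>i. r \<le> i \<longrightarrow> i < n \<longrightarrow> (A\<^sub>0 *\<^sub>v x) $ i = 0) \<longleftrightarrow> A *\<^sub>v x \<in> mat_range L"
    proof
      assume z: "\<forall>i. r \<le> i \<longrightarrow> i < n \<longrightarrow> (A\<^sub>0 *\<^sub>v x) $ i = 0"
      let ?u = "vec_first (A\<^sub>0 *\<^sub>v x) r"
      have "A\<^sub>0 *\<^sub>v x = ?u @\<^sub>v 0\<^sub>v (n - r)"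
        using z rn A0x A0(1) by (intro eq_vecI) (auto simp: vec_first_def simp del: index_mult_mat_vec)
      then have "A *\<^sub>v x = N *\<^sub>v (?u @\<^sub>v 0\<^sub>v (n - r))"
        using assoc_mult_mat_vec[OF N A0(1) x] A0(2) by simp
      also have "\<dots> = L *\<^sub>v ?u"
        using append_cols_mult_vec[OF L(1) V(1), of ?u "0\<^sub>v (n - r)"] mat_mult_zero_vec[OF V(1)]
          L(1) mult_mat_vec_carrier[OF L(1), of ?u] by (simp add: N_def)
      finally show "A *\<^sub>v x \<in> mat_range L" using mat_range_iff[OF L(1)] by auto
    next
      assume "A *\<^sub>v x \<in> mat_range L"
      then obtain z where z: "z \<in> carrier_vec r" "A *\<^sub>v x = L *\<^sub>v z" using mat_range_iff[OF L(1)] by auto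
      have "A\<^sub>0 *\<^sub>v x = z @\<^sub>v 0\<^sub>v (n - r)"
        using PL[OF z(1)] z(2) assoc_mult_mat_vec[OF P(1) A x] by (simp add: A\<^sub>0_def)
      then show "\<forall>i. r \<le> i \<longrightarrow> i < n \<longrightarrow> (A\<^sub>0 *\<^sub>v x) $ i = 0"
        using z(1) by (simp del: index_mult_mat_vec)
    qed
    also have "\<dots> \<longleftrightarrow> (\<exists>w \<in> carrier_vec n. A *\<^sub>v x = E *\<^sub>v w)"
      unfolding L(3) by (rule mat_range_iff[OF E])
    finally show ?thesis .
  qed
  show ?thesis unfolding rif inj_mat_def using H Hx by auto
qed

subsection \<open>Bases of nullspaces and output feedback\<close>

lemma minus_vec_eq_zeroD:
  fixes v :: "'a::ab_group_add vec"
  assumes "v \<in> carrier_vec n" "w \<in> carrier_vec n" "v - w = 0\<^sub>v n"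
  shows "v = w"
proof (rule eq_vecI)
  fix i assume "i < dim_vec w"
  then have i: "i < n" using assms by simp
  have "v $ i - w $ i = (v - w) $ i" using i assms(1,2) by simp
  also have "\<dots> = 0" using i assms(3) by simp
  finally show "v $ i = w $ i" by simp
qed (use assms in auto)

lemma add_vec_eq_zeroD:
  fixes a b :: "'a::ab_group_add vec"
  assumes "a \<in> carrier_vec n" "b \<in> carrier_vec n" "a + b = 0\<^sub>v n"
  shows "a = - b"
proof (rule eq_vecI)
  fix i assume "i < dim_vec (- b)"
  then have i: "i < n" using assms by simp
  have "a $ i + b $ i = (a + b) $ i" using i assms(1,2) by simp
  also have "\<dots> = 0" using i assms(3) by simp
  finally show "a $ i = (- b) $ i" using i assms(2) by (simp add: eq_neg_iff_add_eq_0)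
qed (use assms in auto)

text \<open>Orthonormality enters as \<open>transpose_mat S * S = 1\<^sub>m (dim_col S)\<close>,
  which gives injectivity also when there are no columns; the basis property gives the
  range.\<close>

lemma is_S_infD:
  assumes M: "M \<in> carrier_mat k c" and S: "is_S_inf M S"
  shows "S \<in> carrier_mat c (dim_col S)" "inj_mat S" "mat_range S = mat_kernel M"
proof -
  have "dim_row S = c" using S M unfolding is_S_inf_def by auto
  then show Sc: "S \<in> carrier_mat c (dim_col S)" by (intro carrier_matI) auto
  have STS: "transpose_mat S * S = 1\<^sub>m (dim_col S)"
    using S unfolding is_S_inf_def by (intro eq_matI) auto
  have "inj_mat (1\<^sub>m (dim_col S) :: real mat)"
    by (rule inj_matI[of _ "dim_col S" "dim_col S"]) auto
  then have "inj_mat (transpose_mat S * S)" using STS by simp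
  then show "inj_mat S" by (rule inj_mat_factor_right[OF _ Sc, rotated]) (use Sc in simp)
  interpret K: kernel k c M by unfold_locales (rule M)
  have "kernel.basis c M (set (cols S))" using S M unfolding is_S_inf_def by auto
  then have b: "K.span (set (cols S)) = mat_kernel M" "set (cols S) \<subseteq> mat_kernel M"
    unfolding K.Ker.basis_def by auto
  have "mat_range S = K.NC.span (set (cols S))"
    using col_space_mat_range[OF Sc] unfolding K.NC.col_space_def by simp
  then show "mat_range S = mat_kernel M" using b K.span_same[OF b(2)] by simp
qed

section \<open>Gram matrices, generalized inverses and left nullspaces\<close>

lemma scalar_prod_self_eq_0:
  fixes v :: "real vec"
  assumes "v \<in> carrier_vec n" "v \<bullet> v = 0"
  shows "v = 0\<^sub>v n"
proof (rule eq_vecI)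
  fix i assume "i < dim_vec (0\<^sub>v n :: real vec)"
  then have i: "i < n" by simp
  have "(\<Sum>i = 0..<n. v $ i * v $ i) = 0" using assms by (simp add: scalar_prod_def)
  then show "v $ i = 0\<^sub>v n $ i" using i by (subst (asm) sum_nonneg_eq_0_iff) auto
qed (use assms in auto)

lemma scalar_prod_self_ge_0: "0 \<le> (v :: real vec) \<bullet> v"
  by (simp add: scalar_prod_def sum_nonneg)

text \<open>If \<open>L^T L v = 0\<close>, then \<open>|L v|^2 = 0\<close>, which over the reals
  forces \<open>L v = 0\<close>.\<close>

lemma inj_mat_gram:
  fixes L :: "real mat"
  assumes L: "L \<in> carrier_mat n r" "inj_mat L"
  shows "inj_mat (transpose_mat L * L)"
proof (rule inj_matI)
  show "transpose_mat L * L \<in> carrier_mat r r" using L by auto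
  fix v assume v: "v \<in> carrier_vec r" "transpose_mat L * L *\<^sub>v v = 0\<^sub>v r"
  have Lv: "L *\<^sub>v v \<in> carrier_vec n" using L v by auto
  have "(L *\<^sub>v v) \<bullet> (L *\<^sub>v v) = (transpose_mat L *\<^sub>v (L *\<^sub>v v)) \<bullet> v"
    using transpose_vec_mult_scalar[OF L(1) v(1) Lv] by simp
  also have "transpose_mat L *\<^sub>v (L *\<^sub>v v) = 0\<^sub>v r"
    using v assoc_mult_mat_vec[of "transpose_mat L" r n L r v] L by simp
  finally have "(L *\<^sub>v v) \<bullet> (L *\<^sub>v v) = 0" using v by simp
  then have "L *\<^sub>v v = 0\<^sub>v n" using scalar_prod_self_eq_0[OF Lv] by simp
  then show "v = 0\<^sub>v r" using inj_matD[OF L(2,1) v(1)] by simp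
qed

text \<open>For a basis \<open>L = M Y\<close> of the range, \<open>(L^T L)^-1 L^T\<close> is a left
  inverse of \<open>L\<close>. Following it by \<open>Y\<close> gives \<open>G\<close>, so that
  \<open>M G\<close> is the orthogonal projector onto the range of \<open>M\<close>.\<close>

lemma generalized_inverse:
  fixes M :: "real mat"
  assumes M: "M \<in> carrier_mat n c"
  obtains G where "G \<in> carrier_mat c n" "M * G * M = M"
proof -
  define r where "r = vec_space.rank n M"
  obtain Y where Y: "Y \<in> carrier_mat c r" "inj_mat (M * Y)" "mat_range (M * Y) = mat_range M"
    using rank_factorization[OF M] unfolding r_def by blast
  define L where "L = M * Y"
  have L: "L \<in> carrier_mat n r" "inj_mat L" "mat_range L = mat_range M"
    using Y M by (auto simp: L_def)
  obtain R where R: "R \<in> carrier_mat r c" "M = L * R"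
    using mat_range_subset_factor[OF M L(1)] L(3) by auto
  let ?LT = "transpose_mat L"
  have LT: "?LT \<in> carrier_mat r n" using L by simp
  have LTL: "?LT * L \<in> carrier_mat r r" using L by auto
  have "det (?LT * L) \<noteq> 0" using inj_mat_gram[OF L(1,2)] inj_mat_iff_det[OF LTL] by simp
  then obtain P where P: "P \<in> carrier_mat r r" "P * (?LT * L) = 1\<^sub>m r"
    by (rule det_nonzero_inverseE[OF LTL])
  have PL: "P * ?LT \<in> carrier_mat r n" using P LT by auto
  have "M * (Y * (P * ?LT)) * M = L * (P * ?LT) * (L * R)"
    using R(2) assoc_mult_mat[OF M Y(1) PL] by (simp add: L_def)
  also have "\<dots> = L * (P * ?LT * (L * R))"
    by (rule assoc_mult_mat[OF L(1) PL]) (use L R in auto)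
  also have "P * ?LT * (L * R) = P * ?LT * L * R"
    by (rule assoc_mult_mat[OF PL L(1) R(1), symmetric])
  also have "P * ?LT * L = 1\<^sub>m r" using assoc_mult_mat[OF P(1) LT L(1)] P(2) by simp
  finally have "M * (Y * (P * ?LT)) * M = M" using R by simp
  then show ?thesis using that[of "Y * (P * ?LT)"] Y(1) PL by auto
qed

text \<open>The range of \<open>M\<close> is the orthogonal complement of its left nullspace. The
  harder inclusion needs no dimension count: the residual \<open>d = v - M G v\<close> is turned
  into a left null vector \<open>y\<close> with \<open>v \<bullet> y = |d|^2\<close>, and
  orthogonality of \<open>v\<close> to \<open>y\<close> gives \<open>d = 0\<close>.\<close>

lemma is_T_infD:
  assumes M: "M \<in> carrier_mat n c" and T: "is_T_inf M T"
  shows "T \<in> carrier_mat n (dim_col T)"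
    and "v \<in> carrier_vec n \<Longrightarrow>
      transpose_mat T *\<^sub>v v = 0\<^sub>v (dim_col T) \<longleftrightarrow> v \<in> mat_range M"
proof -
  have MT: "transpose_mat M \<in> carrier_mat c n" using M by simp
  obtain t where t: "dim_col T = t" by simp
  note D = is_S_infD[OF MT T[unfolded is_T_inf_def], unfolded t]
  show "T \<in> carrier_mat n (dim_col T)" unfolding t by (rule D(1))
  note Tc = D(1)
  have TT: "transpose_mat T \<in> carrier_mat t n" using Tc by simp
  assume v: "v \<in> carrier_vec n"
  have TTv: "transpose_mat T *\<^sub>v v \<in> carrier_vec t" using TT v by auto
  show "transpose_mat T *\<^sub>v v = 0\<^sub>v (dim_col T) \<longleftrightarrow> v \<in> mat_range M"
    unfolding t
  proof
    assume "v \<in> mat_range M"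
    then obtain u where u: "u \<in> carrier_vec c" "v = M *\<^sub>v u" using mat_range_iff[OF M] by auto
    let ?w = "transpose_mat T *\<^sub>v v"
    have Tw: "T *\<^sub>v ?w \<in> carrier_vec n" using Tc TTv by auto
    have "T *\<^sub>v ?w \<in> mat_kernel (transpose_mat M)"
      using D(3) mat_range_iff[OF Tc] TTv by blast
    then have z: "transpose_mat M *\<^sub>v (T *\<^sub>v ?w) = 0\<^sub>v c" using mat_kernelD[OF MT] by simp
    have "?w \<bullet> ?w = v \<bullet> (T *\<^sub>v ?w)" using transpose_vec_mult_scalar[OF Tc TTv v] by simp
    also have "\<dots> = (T *\<^sub>v ?w) \<bullet> (M *\<^sub>v u)" using comm_scalar_prod[OF v Tw] u by simp
    also have "\<dots> = (transpose_mat M *\<^sub>v (T *\<^sub>v ?w)) \<bullet> u"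
      using transpose_vec_mult_scalar[OF M u(1) Tw] by simp
    also have "\<dots> = 0" using z u by simp
    finally show "?w = 0\<^sub>v t" using scalar_prod_self_eq_0[OF TTv] by simp
  next
    assume z: "transpose_mat T *\<^sub>v v = 0\<^sub>v t"
    obtain G where G: "G \<in> carrier_mat c n" "M * G * M = M" by (rule generalized_inverse[OF M])
    have MG: "M * G \<in> carrier_mat n n" using M G by auto
    define d where "d = v - M * G *\<^sub>v v"
    have d: "d \<in> carrier_vec n" using v MG by (auto simp: d_def)
    \<comment> \<open>From \<open>M G M = M\<close> it follows that
      \<open>M^T (I - (M G)^T) = 0\<close>, so \<open>y\<close> is a left null vector of
      \<open>M\<close>.\<close>
    define y where "y = d - transpose_mat (M * G) *\<^sub>v d"
    have y: "y \<in> carrier_vec n" using d MG by (auto simp: y_def)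
    have "transpose_mat M *\<^sub>v (transpose_mat (M * G) *\<^sub>v d) = transpose_mat (M * G * M) *\<^sub>v d"
      using transpose_mult[OF MG M] assoc_mult_mat_vec[OF MT, of "transpose_mat (M * G)" n d] MG d
      by simp
    then have "transpose_mat M *\<^sub>v y = 0\<^sub>v c"
      unfolding y_def G(2) using d MG MT
      by (subst mult_minus_distrib_mat_vec[OF MT]) auto
    then have "y \<in> mat_range T" unfolding D(3) using mat_kernelI[OF MT y] by simp
    then obtain w where w: "w \<in> carrier_vec t" "y = T *\<^sub>v w"
      using mat_range_iff[OF Tc] by auto
    have "v \<bullet> y = 0" using transpose_vec_mult_scalar[OF Tc w(1) v] z w by simp
    moreover have "d \<bullet> d = v \<bullet> y"
    proof -
      have "v \<bullet> y = v \<bullet> d - v \<bullet> (transpose_mat (M * G) *\<^sub>v d)"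
        unfolding y_def by (rule scalar_prod_minus_distrib[OF v d]) (use MG d in auto)
      also have "v \<bullet> (transpose_mat (M * G) *\<^sub>v d) = (M * G *\<^sub>v v) \<bullet> d"
        using transpose_vec_mult_scalar[of "transpose_mat (M * G)" n n d v] MG d v by simp
      also have "v \<bullet> d - (M * G *\<^sub>v v) \<bullet> d = d \<bullet> d"
        using minus_scalar_prod_distrib[OF v _ d, of "M * G *\<^sub>v v"] MG v by (auto simp: d_def)
      finally show ?thesis ..
    qed
    ultimately have "d = 0\<^sub>v n" using scalar_prod_self_eq_0[OF d] by simp
    then have "v = M * G *\<^sub>v v" using minus_vec_eq_zeroD[OF v, of "M * G *\<^sub>v v"] MG v
      by (auto simp: d_def)
    then have "v = M *\<^sub>v (G *\<^sub>v v)" using assoc_mult_mat_vec[OF M G(1) v] by simp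
    then show "v \<in> mat_range M" using mat_range_iff[OF M] G v by auto
  qed
qed

section \<open>Output feedback and pencils\<close>

lemma output_feedback_mult_vec:
  fixes E :: "'a::comm_ring_1 mat"
  assumes "E \<in> carrier_mat n n" "B \<in> carrier_mat n m" "F \<in> carrier_mat m m" "C \<in> carrier_mat m n"
    and x: "x \<in> carrier_vec n"
  shows "(E + B * F * C) *\<^sub>v x = E *\<^sub>v x + B *\<^sub>v (F *\<^sub>v (C *\<^sub>v x))"
    and "(E - B * F * C) *\<^sub>v x = E *\<^sub>v x - B *\<^sub>v (F *\<^sub>v (C *\<^sub>v x))"
proof -
  have BF: "B * F \<in> carrier_mat n m" and BFC: "B * F * C \<in> carrier_mat n n" using assms by auto
  have "B * F * C *\<^sub>v x = B *\<^sub>v (F *\<^sub>v (C *\<^sub>v x))"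
    using assoc_mult_mat_vec[OF BF assms(4) x] assoc_mult_mat_vec[OF assms(2,3)] assms by simp
  then show "(E + B * F * C) *\<^sub>v x = E *\<^sub>v x + B *\<^sub>v (F *\<^sub>v (C *\<^sub>v x))"
    "(E - B * F * C) *\<^sub>v x = E *\<^sub>v x - B *\<^sub>v (F *\<^sub>v (C *\<^sub>v x))"
    using add_mult_distrib_mat_vec[OF assms(1) BFC x] minus_mult_distrib_mat_vec[OF assms(1) BFC x]
    by simp_all
qed

lemma pencil_carrier [simp, intro]:
  "E \<in> carrier_mat k n \<Longrightarrow> A \<in> carrier_mat k n \<Longrightarrow> pencil s E A \<in> carrier_mat k n"
  unfolding pencil_def by (auto intro!: minus_carrier_mat)

lemma pencil_mult_vec:
  assumes "E \<in> carrier_mat k n" "A \<in> carrier_mat k n" "x \<in> carrier_vec n"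
  shows "pencil s E A *\<^sub>v x = s \<cdot>\<^sub>v (cmat E *\<^sub>v x) - cmat A *\<^sub>v x"
proof -
  have "pencil s E A *\<^sub>v x = (s \<cdot>\<^sub>m cmat E) *\<^sub>v x - cmat A *\<^sub>v x"
    unfolding pencil_def by (rule minus_mult_distrib_mat_vec) (use assms in auto)
  also have "(s \<cdot>\<^sub>m cmat E) *\<^sub>v x = s \<cdot>\<^sub>v (cmat E *\<^sub>v x)"
    using assms by (intro eq_vecI) auto
  finally show ?thesis .
qed

text \<open>Feedback adds a vector in the range of \<open>B\<close> that depends on \<open>x\<close>
  only through \<open>C x\<close>. Hence it can repair neither a deficient range of
  \<open>[sE-A B]\<close> nor a common kernel vector of \<open>sE-A\<close> and
  \<open>C\<close>.\<close>

lemma pencil_output_feedback: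
  assumes E: "E \<in> carrier_mat n n" and A: "A \<in> carrier_mat n n" and B: "B \<in> carrier_mat n m"
    and C: "C \<in> carrier_mat m n" and K: "K \<in> carrier_mat m m" and F: "F \<in> carrier_mat m m"
    and x: "x \<in> carrier_vec n"
  shows "pencil s (E + B * F * C) (A - B * K * C) *\<^sub>v x = pencil s E A *\<^sub>v x +
    cmat B *\<^sub>v (s \<cdot>\<^sub>v (cmat F *\<^sub>v (cmat C *\<^sub>v x)) + cmat K *\<^sub>v (cmat C *\<^sub>v x))"
proof -
  have hBC: "cmat (B * X * C) = cmat B * cmat X * cmat C" if "X \<in> carrier_mat m m" for X
    using of_real_hom.mat_hom_mult[OF mult_carrier_mat[OF B that] C]
      of_real_hom.mat_hom_mult[OF B that] by (rule trans[OF _ arg_cong])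
  have hE: "cmat (E + B * F * C) = cmat E + cmat B * cmat F * cmat C"
    unfolding hBC[OF F, symmetric] using E B F C by (intro eq_matI) auto
  have hA: "cmat (A - B * K * C) = cmat A - cmat B * cmat K * cmat C"
    unfolding hBC[OF K, symmetric] using A B K C by (intro eq_matI) auto
  have cc: "cmat E \<in> carrier_mat n n" "cmat A \<in> carrier_mat n n" "cmat B \<in> carrier_mat n m"
    "cmat C \<in> carrier_mat m n" "cmat K \<in> carrier_mat m m" "cmat F \<in> carrier_mat m m"
    using assms by auto
  define y where "y = cmat F *\<^sub>v (cmat C *\<^sub>v x)"
  define z where "z = cmat K *\<^sub>v (cmat C *\<^sub>v x)"
  have y: "y \<in> carrier_vec m" and z: "z \<in> carrier_vec m" using cc x by (auto simp: y_def z_def)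
  have e: "cmat (E + B * F * C) *\<^sub>v x = cmat E *\<^sub>v x + cmat B *\<^sub>v y"
    unfolding hE y_def by (rule output_feedback_mult_vec(1)[OF cc(1,3,6,4) x])
  have a: "cmat (A - B * K * C) *\<^sub>v x = cmat A *\<^sub>v x - cmat B *\<^sub>v z"
    unfolding hA z_def by (rule output_feedback_mult_vec(2)[OF cc(2,3,5,4) x])
  have b: "cmat B *\<^sub>v (s \<cdot>\<^sub>v y + z) = s \<cdot>\<^sub>v (cmat B *\<^sub>v y) + cmat B *\<^sub>v z"
    using mult_add_distrib_mat_vec[OF cc(3), of "s \<cdot>\<^sub>v y" z] mult_mat_vec[OF cc(3) y] y z by simp
  have "s \<cdot>\<^sub>v (u + w) - (v - t) = s \<cdot>\<^sub>v u - v + (s \<cdot>\<^sub>v w + t)"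
    if "u \<in> carrier_vec n" "v \<in> carrier_vec n" "w \<in> carrier_vec n" "t \<in> carrier_vec n"
    for u v w t :: "complex vec"
    using that by (intro eq_vecI) (auto simp: algebra_simps)
  then have id: "s \<cdot>\<^sub>v (cmat E *\<^sub>v x + cmat B *\<^sub>v y) - (cmat A *\<^sub>v x - cmat B *\<^sub>v z) =
      s \<cdot>\<^sub>v (cmat E *\<^sub>v x) - cmat A *\<^sub>v x + (s \<cdot>\<^sub>v (cmat B *\<^sub>v y) + cmat B *\<^sub>v z)"
    using mult_mat_vec_carrier[OF cc(1) x] mult_mat_vec_carrier[OF cc(2) x]
      mult_mat_vec_carrier[OF cc(3) y] mult_mat_vec_carrier[OF cc(3) z] by blast
  have E': "E + B * F * C \<in> carrier_mat n n" and A': "A - B * K * C \<in> carrier_mat n n"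
    using assms by (auto intro!: minus_carrier_mat)
  show ?thesis
    unfolding pencil_mult_vec[OF E' A' x] pencil_mult_vec[OF E A x] e a id
      y_def[symmetric] z_def[symmetric] b ..
qed

subsection \<open>Necessary conditions\<close>

lemma rank_le_dim_row:
  fixes M :: "'a::field mat"
  assumes M: "M \<in> carrier_mat n c"
  shows "vec_space.rank n M \<le> n"
proof (rule rank_le_spanning[OF M one_carrier_mat])
  show "mat_range M \<subseteq> mat_range (1\<^sub>m n)"
  proof
    fix y assume "y \<in> mat_range M"
    then have y: "y \<in> carrier_vec n" using mat_range_carrier[OF M] by auto
    then have "y = 1\<^sub>m n *\<^sub>v y" by simp
    then show "y \<in> mat_range (1\<^sub>m n)" using mat_range_iff[OF one_carrier_mat[of n]] y by blast
  qed
qed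

lemma add_vec_interchange:
  fixes a b c d :: "'a::ab_semigroup_add vec"
  assumes "a \<in> carrier_vec n" "b \<in> carrier_vec n" "c \<in> carrier_vec n" "d \<in> carrier_vec n"
  shows "a + b + (c + d) = (a + c) + (b + d)"
  using assms by (intro eq_vecI) (auto simp: ac_simps)

lemma mat_mult_uminus_vec:
  fixes M :: "'a::comm_ring_1 mat"
  assumes "M \<in> carrier_mat n c" "v \<in> carrier_vec c"
  shows "M *\<^sub>v (- v) = - (M *\<^sub>v v)"
  using assms by (intro eq_vecI) auto

text \<open>Shifting \<open>v\<close> compensates the feedback, so the range of \<open>[E B]\<close>
  is contained in that of \<open>[E+BFC B]\<close>.\<close>

lemma feedback_sum_regroup:
  fixes E :: "'a::comm_ring_1 mat"
  assumes E: "E \<in> carrier_mat n n" and B: "B \<in> carrier_mat n m"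
    and F: "F \<in> carrier_mat m m" and C: "C \<in> carrier_mat m n"
    and u: "u \<in> carrier_vec n" and v: "v \<in> carrier_vec m"
  shows "E *\<^sub>v u + B *\<^sub>v v =
    (E + B * F * C) *\<^sub>v u + B *\<^sub>v (v - F *\<^sub>v (C *\<^sub>v u))"
proof -
  have y: "F *\<^sub>v (C *\<^sub>v u) \<in> carrier_vec m" using F C u by auto
  have c: "E *\<^sub>v u \<in> carrier_vec n" "B *\<^sub>v v \<in> carrier_vec n" "B *\<^sub>v (F *\<^sub>v (C *\<^sub>v u)) \<in> carrier_vec n"
    using E B u v y by auto
  have "a + b = a + d + (b - d)" if "a \<in> carrier_vec n" "b \<in> carrier_vec n" "d \<in> carrier_vec n"
    for a b d :: "'a vec"
    using that by (intro eq_vecI) auto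
  from this[OF c] show ?thesis
    unfolding output_feedback_mult_vec(1)[OF E B F C u] mult_minus_distrib_mat_vec[OF B v y] .
qed

text \<open>The range of \<open>[E B]\<close> is spanned by a basis of the range of
  \<open>E + B F C\<close> together with one of the range of \<open>B\<close>.\<close>

lemma rank_closed_loop_lower:
  fixes E :: "'a::field mat"
  assumes E: "E \<in> carrier_mat n n" and B: "B \<in> carrier_mat n m"
    and F: "F \<in> carrier_mat m m" and C: "C \<in> carrier_mat m n"
  shows "vec_space.rank n (E @\<^sub>c B) \<le> vec_space.rank n (E + B * F * C) + vec_space.rank n B"
proof -
  let ?E = "E + B * F * C"
  have E': "?E \<in> carrier_mat n n" using assms by auto
  obtain Y where Y: "Y \<in> carrier_mat n (vec_space.rank n ?E)" "mat_range (?E * Y) = mat_range ?E"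
    using rank_factorization[OF E'] by blast
  obtain Z where Z: "Z \<in> carrier_mat m (vec_space.rank n B)" "mat_range (B * Z) = mat_range B"
    using rank_factorization[OF B] by blast
  note EY = mult_carrier_mat[OF E' Y(1)] and BZ = mult_carrier_mat[OF B Z(1)]
  have "mat_range (E @\<^sub>c B) \<subseteq> mat_range (?E * Y @\<^sub>c B * Z)"
  proof
    fix y assume "y \<in> mat_range (E @\<^sub>c B)"
    then obtain u v where uv: "u \<in> carrier_vec n" "v \<in> carrier_vec m" "y = E *\<^sub>v u + B *\<^sub>v v"
      using mat_range_append_cols[OF E B] by blast
    let ?v = "v - F *\<^sub>v (C *\<^sub>v u)"
    have v: "?v \<in> carrier_vec m" using F C uv by auto
    have "?E *\<^sub>v u \<in> mat_range (?E * Y)" "B *\<^sub>v ?v \<in> mat_range (B * Z)"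
      using Y(2) Z(2) mat_range_iff[OF E'] mat_range_iff[OF B] uv(1) v by auto
    then obtain a b where ab: "a \<in> carrier_vec (vec_space.rank n ?E)" "?E *\<^sub>v u = ?E * Y *\<^sub>v a"
      "b \<in> carrier_vec (vec_space.rank n B)" "B *\<^sub>v ?v = B * Z *\<^sub>v b"
      using mat_range_iff[OF EY] mat_range_iff[OF BZ] by blast
    have "y = ?E * Y *\<^sub>v a + B * Z *\<^sub>v b"
      unfolding ab(2,4)[symmetric] uv(3) by (rule feedback_sum_regroup[OF E B F C uv(1,2)])
    then show "y \<in> mat_range (?E * Y @\<^sub>c B * Z)"
      using mat_range_append_cols[OF EY BZ] ab by blast
  qed
  then show ?thesis
    by (rule rank_le_spanning[OF append_cols_carrier[OF E B] append_cols_carrier[OF EY BZ]])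
qed

text \<open>Since \<open>E\<close> and \<open>C\<close> vanish on the range of \<open>S\<close>, the
  kernel criterion for the closed loop keeps \<open>A S y\<close> out of the range of
  \<open>E + B F C\<close> unless \<open>y = 0\<close>. A basis of that range and the
  \<open>k\<close> columns of \<open>A S\<close> are then jointly independent, and all of them lie
  in the range of \<open>[E B]\<close>.\<close>

lemma feedback_obstruction:
  assumes E: "E \<in> carrier_mat n n" and A: "A \<in> carrier_mat n n" and B: "B \<in> carrier_mat n m"
    and C: "C \<in> carrier_mat m n" and K: "K \<in> carrier_mat m m" and F: "F \<in> carrier_mat m m"
    and rif: "regular_impulse_free (E + B * F * C) (A - B * K * C)"
    and S: "S \<in> carrier_mat n k" "inj_mat S"
    and SD: "\<And>y. y \<in> carrier_vec k \<Longrightarrow> E *\<^sub>v (S *\<^sub>v y) = 0\<^sub>v n \<and> C *\<^sub>v (S *\<^sub>v y) = 0\<^sub>v m \<and>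
      A *\<^sub>v (S *\<^sub>v y) \<in> mat_range (E @\<^sub>c B)"
  shows "\<And>y w. y \<in> carrier_vec k \<Longrightarrow> w \<in> carrier_vec n \<Longrightarrow>
      A *\<^sub>v (S *\<^sub>v y) = (E + B * F * C) *\<^sub>v w \<Longrightarrow> y = 0\<^sub>v k"
    and "vec_space.rank n (E + B * F * C) + k \<le> vec_space.rank n (E @\<^sub>c B)"
proof -
  let ?E = "E + B * F * C" and ?A = "A - B * K * C"
  have E': "?E \<in> carrier_mat n n" and A': "?A \<in> carrier_mat n n"
    using assms by (auto intro!: minus_carrier_mat)
  have Bz: "B *\<^sub>v (X *\<^sub>v 0\<^sub>v m) = 0\<^sub>v n" if "X \<in> carrier_mat m m" for X
    using mat_mult_zero_vec[OF that] mat_mult_zero_vec[OF B] by simp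
  have ob: "y = 0\<^sub>v k"
    if y: "y \<in> carrier_vec k" and w: "w \<in> carrier_vec n" and eq: "A *\<^sub>v (S *\<^sub>v y) = ?E *\<^sub>v w" for y w
  proof -
    have x: "S *\<^sub>v y \<in> carrier_vec n" using S y by auto
    have "?E *\<^sub>v (S *\<^sub>v y) = 0\<^sub>v n"
      using output_feedback_mult_vec(1)[OF E B F C x] SD[OF y] Bz[OF F] by simp
    moreover have "?A *\<^sub>v (S *\<^sub>v y) = ?E *\<^sub>v w"
    proof -
      have "?A *\<^sub>v (S *\<^sub>v y) = A *\<^sub>v (S *\<^sub>v y) - 0\<^sub>v n"
        using output_feedback_mult_vec(2)[OF A B K C x] SD[OF y] Bz[OF K] by simp
      also have "\<dots> = A *\<^sub>v (S *\<^sub>v y)" by (rule minus_zero_vec) (use A x in auto)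
      finally show ?thesis using eq by simp
    qed
    ultimately have "S *\<^sub>v y = 0\<^sub>v n" using rif regular_impulse_free_iff[OF E' A'] x w by blast
    then show ?thesis using inj_matD[OF S(2,1) y] by simp
  qed
  then show "\<And>y w. y \<in> carrier_vec k \<Longrightarrow> w \<in> carrier_vec n \<Longrightarrow>
      A *\<^sub>v (S *\<^sub>v y) = ?E *\<^sub>v w \<Longrightarrow> y = 0\<^sub>v k" by blast
  obtain Y where Y: "Y \<in> carrier_mat n (vec_space.rank n ?E)" "inj_mat (?E * Y)"
    using rank_factorization[OF E'] by blast
  note EY = mult_carrier_mat[OF E' Y(1)] and AS = mult_carrier_mat[OF A S(1)]
  have "inj_mat (?E * Y @\<^sub>c A * S)"
    unfolding inj_mat_append_cols[OF EY AS]
  proof (intro ballI impI)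
    fix u v assume u: "u \<in> carrier_vec (vec_space.rank n ?E)" and v: "v \<in> carrier_vec k"
      and z: "?E * Y *\<^sub>v u + A * S *\<^sub>v v = 0\<^sub>v n"
    have Yu: "Y *\<^sub>v u \<in> carrier_vec n" and Sv: "S *\<^sub>v v \<in> carrier_vec n" using Y S u v by auto
    have "A *\<^sub>v (S *\<^sub>v v) = ?E *\<^sub>v (- (Y *\<^sub>v u))"
    proof -
      have "?E *\<^sub>v (Y *\<^sub>v u) + A *\<^sub>v (S *\<^sub>v v) = 0\<^sub>v n"
        using z assoc_mult_mat_vec[OF E' Y(1) u] assoc_mult_mat_vec[OF A S(1) v] by simp
      then have "?E *\<^sub>v (Y *\<^sub>v u) = - (A *\<^sub>v (S *\<^sub>v v))"
        by (rule add_vec_eq_zeroD[OF mult_mat_vec_carrier[OF E' Yu] mult_mat_vec_carrier[OF A Sv]])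
      then have "A *\<^sub>v (S *\<^sub>v v) = - (?E *\<^sub>v (Y *\<^sub>v u))"
        by simp
      also have "\<dots> = ?E *\<^sub>v (- (Y *\<^sub>v u))"
        by (rule mat_mult_uminus_vec[OF E' Yu, symmetric])
      finally show ?thesis .
    qed
    then have v0: "v = 0\<^sub>v k" using ob[OF v, of "- (Y *\<^sub>v u)"] Yu by simp
    have "?E * Y *\<^sub>v u = 0\<^sub>v n" using z mult_mat_vec_carrier[OF EY u]
      unfolding v0 mat_mult_zero_vec[OF AS] by simp
    then show "u = 0\<^sub>v (vec_space.rank n ?E) \<and> v = 0\<^sub>v k" using inj_matD[OF Y(2) EY u] v0 by simp
  qed
  moreover have "mat_range (?E * Y @\<^sub>c A * S) \<subseteq> mat_range (E @\<^sub>c B)"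
  proof
    fix y assume "y \<in> mat_range (?E * Y @\<^sub>c A * S)"
    then obtain u v where u: "u \<in> carrier_vec (vec_space.rank n ?E)" and v: "v \<in> carrier_vec k"
      and y: "y = ?E * Y *\<^sub>v u + A * S *\<^sub>v v"
      using mat_range_append_cols[OF EY AS] by blast
    define p where "p = Y *\<^sub>v u"
    have p: "p \<in> carrier_vec n" using Y u by (auto simp: p_def)
    define q where "q = F *\<^sub>v (C *\<^sub>v p)"
    have q: "q \<in> carrier_vec m" using F C p by (auto simp: q_def)
    obtain a b where ab: "a \<in> carrier_vec n" "b \<in> carrier_vec m" "A *\<^sub>v (S *\<^sub>v v) = E *\<^sub>v a + B *\<^sub>v b"
      using SD[OF v] mat_range_append_cols[OF E B] by blast
    have "y = E *\<^sub>v p + B *\<^sub>v q + (E *\<^sub>v a + B *\<^sub>v b)"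
      unfolding y assoc_mult_mat_vec[OF E' Y(1) u] assoc_mult_mat_vec[OF A S(1) v] ab(3)
        p_def[symmetric] output_feedback_mult_vec(1)[OF E B F C p] q_def ..
    also have "\<dots> = E *\<^sub>v (p + a) + B *\<^sub>v (q + b)"
      unfolding mult_add_distrib_mat_vec[OF E p ab(1)] mult_add_distrib_mat_vec[OF B q ab(2)]
      by (rule add_vec_interchange[where n = n]) (use E B p q ab in auto)
    finally show "y \<in> mat_range (E @\<^sub>c B)"
      unfolding mat_range_append_cols[OF E B]
      using add_carrier_vec[OF p ab(1)] add_carrier_vec[OF q ab(2)] by blast
  qed
  ultimately show "vec_space.rank n ?E + k \<le> vec_space.rank n (E @\<^sub>c B)"
    by (intro inj_mat_rank_le[OF append_cols_carrier[OF EY AS] _ append_cols_carrier[OF E B]])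
qed

text \<open>The range of the closed-loop pencil lies in that of \<open>[sE-A B]\<close>, and its
  kernel contains the common kernel of \<open>sE-A\<close> and \<open>C\<close>. Nonsingularity at
  \<open>s\<close> therefore settles both rank conditions at \<open>s\<close>.\<close>

lemma pencil_rank_of_feedback:
  assumes E: "E \<in> carrier_mat n n" and A: "A \<in> carrier_mat n n" and B: "B \<in> carrier_mat n m"
    and C: "C \<in> carrier_mat m n" and K: "K \<in> carrier_mat m m" and F: "F \<in> carrier_mat m m"
    and d: "det (pencil s (E + B * F * C) (A - B * K * C)) \<noteq> 0"
  shows "vec_space.rank n (pencil s E A @\<^sub>c cmat B) = n"
    and "inj_mat (pencil s E A @\<^sub>r cmat C)"
proof -
  let ?M = "pencil s (E + B * F * C) (A - B * K * C)"
  have E': "E + B * F * C \<in> carrier_mat n n" and A': "A - B * K * C \<in> carrier_mat n n"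
    using assms by (auto intro!: minus_carrier_mat)
  have M: "?M \<in> carrier_mat n n" by (rule pencil_carrier[OF E' A'])
  have P: "pencil s E A \<in> carrier_mat n n" by (rule pencil_carrier[OF E A])
  have cB: "cmat B \<in> carrier_mat n m" and cC: "cmat C \<in> carrier_mat m n"
    and cF: "cmat F \<in> carrier_mat m m" and cK: "cmat K \<in> carrier_mat m m" using assms by auto
  have i: "inj_mat ?M" using inj_mat_iff_det[OF M] d by simp
  have PB: "pencil s E A @\<^sub>c cmat B \<in> carrier_mat n (n + m)" by (rule append_cols_carrier[OF P cB])
  have "mat_range ?M \<subseteq> mat_range (pencil s E A @\<^sub>c cmat B)"
  proof
    fix y assume "y \<in> mat_range ?M"
    then obtain x where x: "x \<in> carrier_vec n" "y = ?M *\<^sub>v x" using mat_range_iff[OF M] by blast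
    let ?v = "s \<cdot>\<^sub>v (cmat F *\<^sub>v (cmat C *\<^sub>v x)) + cmat K *\<^sub>v (cmat C *\<^sub>v x)"
    have "?v \<in> carrier_vec m" using x cC cF cK by auto
    moreover have "y = pencil s E A *\<^sub>v x + cmat B *\<^sub>v ?v"
      unfolding x(2) by (rule pencil_output_feedback[OF E A B C K F x(1)])
    ultimately show "y \<in> mat_range (pencil s E A @\<^sub>c cmat B)"
      using mat_range_append_cols[OF P cB] x(1) by blast
  qed
  then have "n \<le> vec_space.rank n (pencil s E A @\<^sub>c cmat B)" by (rule inj_mat_rank_le[OF M i PB])
  then show "vec_space.rank n (pencil s E A @\<^sub>c cmat B) = n" using rank_le_dim_row[OF PB] by simp
  show "inj_mat (pencil s E A @\<^sub>r cmat C)"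
  proof (rule inj_matI[OF carrier_append_rows[OF P cC]])
    fix x assume x: "x \<in> carrier_vec n" and z: "(pencil s E A @\<^sub>r cmat C) *\<^sub>v x = 0\<^sub>v (n + m)"
    have c: "pencil s E A *\<^sub>v x \<in> carrier_vec n" "cmat C *\<^sub>v x \<in> carrier_vec m" using P cC x by auto
    have z': "pencil s E A *\<^sub>v x = 0\<^sub>v n" "cmat C *\<^sub>v x = 0\<^sub>v m"
      using z append_vec_zero_iff[OF c] mat_mult_append[OF P cC x] by auto
    have s0: "s \<cdot>\<^sub>v 0\<^sub>v m = 0\<^sub>v m" by (intro eq_vecI) auto
    have "?M *\<^sub>v x = 0\<^sub>v n"
      unfolding pencil_output_feedback[OF E A B C K F x] z' mat_mult_zero_vec[OF cF]
        mat_mult_zero_vec[OF cK] s0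
      using mat_mult_zero_vec[OF cB] by simp
    then show "x = 0\<^sub>v n" by (rule inj_matD[OF i M x])
  qed
qed

subsection \<open>Choice of the derivative feedback\<close>

lemma mat_eqI_mult_vec:
  fixes A :: "'a::comm_ring_1 mat"
  assumes A: "A \<in> carrier_mat n c" and B: "B \<in> carrier_mat n c"
    and eq: "\<And>v. v \<in> carrier_vec c \<Longrightarrow> A *\<^sub>v v = B *\<^sub>v v"
  shows "A = B"
proof (rule mat_col_eqI)
  fix j assume "j < dim_col B"
  then have j: "j < c" using B by simp
  show "col A j = col B j"
    using eq[of "unit_vec c j"] mat_mult_unit_vec[OF A j] mat_mult_unit_vec[OF B j] by simp
qed (use A B in auto)

lemma quadratic_nonneg_imp_linear_coeff_0:
  fixes a b :: real
  assumes "\<And>t. 0 \<le> 2 * t * a + t * t * b"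
  shows "a = 0"
proof (rule ccontr)
  assume "a \<noteq> 0"
  \<comment> \<open>Adding the instances \<open>t = 1\<close> and \<open>t = -1\<close> cancels the
    linear terms.\<close>
  have b: "0 \<le> b"
  proof -
    have "0 \<le> (2 * 1 * a + 1 * 1 * b) + (2 * (-1) * a + (-1) * (-1) * b)"
      using assms[of 1] assms[of "-1"] by linarith
    then show ?thesis by simp
  qed
  \<comment> \<open>The minimizer would be \<open>- a / b\<close>; the shifted denominator also
    covers \<open>b = 0\<close>.\<close>
  define t where "t = - a / (b + 1)"
  have "2 * t * a + t * t * b = t * (2 * a + t * b)" by (simp add: algebra_simps)
  also have "2 * a + t * b = a * (b + 2) / (b + 1)"
    using b by (simp add: t_def field_simps)
  also have "t * (a * (b + 2) / (b + 1)) = - (a * a) * (b + 2) / ((b + 1) * (b + 1))"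
    by (simp add: t_def)
  also have "\<dots> < 0"
  proof -
    have "0 < a * a" using \<open>a \<noteq> 0\<close> by (metis not_real_square_gt_zero)
    then have "0 < a * a * (b + 2)" using b by simp
    moreover have "0 < (b + 1) * (b + 1)" using b by simp
    ultimately show ?thesis by (simp add: divide_neg_pos)
  qed
  finally show False using assms[of t] by simp
qed

section \<open>Positive semidefinite forms\<close>

lemma symmetric_scalar_prod:
  fixes E :: "real mat"
  assumes E: "E \<in> carrier_mat n n" "transpose_mat E = E"
    and "x \<in> carrier_vec n" "y \<in> carrier_vec n"
  shows "x \<bullet> (E *\<^sub>v y) = y \<bullet> (E *\<^sub>v x)"
proof -
  have "x \<bullet> (E *\<^sub>v y) = (E *\<^sub>v x) \<bullet> y"
    using transpose_vec_mult_scalar[OF E(1) assms(4,3)] E(2) by simp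
  then show ?thesis using comm_scalar_prod[of y n "E *\<^sub>v x"] assms by auto
qed

text \<open>Move from \<open>x\<close> in the direction \<open>y = E x\<close>. As a polynomial in
  \<open>t\<close>, the form at \<open>x + t y\<close> has constant term 0 and linear coefficient
  \<open>2 |y|^2\<close>, which nonnegativity forces to vanish.\<close>

lemma psd_isotropic_kernel:
  fixes E :: "real mat"
  assumes E: "E \<in> carrier_mat n n" "transpose_mat E = E"
    and psd: "\<And>x. x \<in> carrier_vec n \<Longrightarrow> 0 \<le> x \<bullet> (E *\<^sub>v x)"
    and x: "x \<in> carrier_vec n" "x \<bullet> (E *\<^sub>v x) = 0"
  shows "E *\<^sub>v x = 0\<^sub>v n"
proof -
  define y where "y = E *\<^sub>v x"
  have y: "y \<in> carrier_vec n" using E x by (auto simp: y_def)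
  have Ey: "E *\<^sub>v y \<in> carrier_vec n" using E y by auto
  have "0 \<le> 2 * t * (y \<bullet> y) + t * t * (y \<bullet> (E *\<^sub>v y))" for t
  proof -
    have ty: "t \<cdot>\<^sub>v y \<in> carrier_vec n" using y by simp
    have "E *\<^sub>v (x + t \<cdot>\<^sub>v y) = y + t \<cdot>\<^sub>v (E *\<^sub>v y)"
      unfolding mult_add_distrib_mat_vec[OF E(1) x(1) ty] mult_mat_vec[OF E(1) y] y_def[symmetric] ..
    then have "(x + t \<cdot>\<^sub>v y) \<bullet> (E *\<^sub>v (x + t \<cdot>\<^sub>v y)) =
        x \<bullet> y + t * (x \<bullet> (E *\<^sub>v y)) + t * (y \<bullet> y) + t * t * (y \<bullet> (E *\<^sub>v y))"
      using x(1) y ty Ey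
      by (simp add: add_scalar_prod_distrib[of _ n] scalar_prod_add_distrib[of _ n] algebra_simps)
    moreover have "x \<bullet> (E *\<^sub>v y) = y \<bullet> y"
      using symmetric_scalar_prod[OF E x(1) y] by (simp add: y_def)
    moreover have "x \<bullet> y = 0" using x(2) by (simp add: y_def)
    ultimately show ?thesis using psd[of "x + t \<cdot>\<^sub>v y"] x(1) ty by (simp add: algebra_simps)
  qed
  then have "y \<bullet> y = 0" by (rule quadratic_nonneg_imp_linear_coeff_0)
  then show ?thesis using scalar_prod_self_eq_0[OF y] by (simp add: y_def)
qed

text \<open>The first summand is \<open>E\<close> composed with the \<open>E\<close>-orthogonal
  projector onto the range of \<open>Z\<close>, and it agrees with \<open>E\<close> on
  \<open>ker B^T\<close>. The remainder is symmetric and vanishes on \<open>ker B^T\<close>, so it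
  factors through \<open>B^T\<close> on the right and through \<open>B\<close> on the left, which
  gives \<open>B H B^T\<close>.\<close>

lemma psd_splitting:
  fixes E B :: "real mat"
  assumes E: "E \<in> carrier_mat n n" "transpose_mat E = E"
    and psd: "\<And>x. x \<in> carrier_vec n \<Longrightarrow> 0 \<le> x \<bullet> (E *\<^sub>v x)"
    and B: "B \<in> carrier_mat n m"
  obtains d Z P H where "Z \<in> carrier_mat n d" "P \<in> carrier_mat d d" "H \<in> carrier_mat m m"
    "transpose_mat B * Z = 0\<^sub>m m d" "inj_mat (E * Z)"
    "transpose_mat (E * Z) * Z * P = 1\<^sub>m d" "transpose_mat H = H"
    "E = E * Z * P * transpose_mat (E * Z) + B * H * transpose_mat B"
proof -
  let ?BT = "transpose_mat B"
  have BT: "?BT \<in> carrier_mat m n" using B by simp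
  obtain G where G: "G \<in> carrier_mat n m" "?BT * G * ?BT = ?BT" by (rule generalized_inverse[OF BT])
  have GB: "G * ?BT \<in> carrier_mat n n" using G BT by auto
  \<comment> \<open>\<open>N\<close> projects onto the kernel of \<open>B\<^sup>T\<close>.\<close>
  define N where "N = 1\<^sub>m n - G * ?BT"
  have N: "N \<in> carrier_mat n n" using GB by (auto simp: N_def intro!: minus_carrier_mat)
  have Nx: "N *\<^sub>v x = x - G *\<^sub>v (?BT *\<^sub>v x)" if x: "x \<in> carrier_vec n" for x
    unfolding N_def minus_mult_distrib_mat_vec[OF one_carrier_mat GB x]
      assoc_mult_mat_vec[OF G(1) BT x] using x by simp
  have BN: "?BT *\<^sub>v (N *\<^sub>v x) = 0\<^sub>v m" if x: "x \<in> carrier_vec n" for x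
  proof -
    have Bx: "?BT *\<^sub>v x \<in> carrier_vec m" and GBx: "G *\<^sub>v (?BT *\<^sub>v x) \<in> carrier_vec n"
      using BT G x by auto
    have "?BT *\<^sub>v (G *\<^sub>v (?BT *\<^sub>v x)) = ?BT * G * ?BT *\<^sub>v x"
      using assoc_mult_mat_vec[OF mult_carrier_mat[OF BT G(1)] BT x] assoc_mult_mat_vec[OF BT G(1) Bx]
      by simp
    then have "?BT *\<^sub>v (N *\<^sub>v x) = ?BT *\<^sub>v x - ?BT *\<^sub>v x"
      unfolding Nx[OF x] mult_minus_distrib_mat_vec[OF BT x GBx] G(2) by simp
    then show ?thesis using Bx by simp
  qed
  have EN: "E * N \<in> carrier_mat n n" using E N by auto
  define d where "d = vec_space.rank n (E * N)"
  obtain Y where Y: "Y \<in> carrier_mat n d" "inj_mat (E * N * Y)"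
    "mat_range (E * N * Y) = mat_range (E * N)"
    using rank_factorization[OF EN] unfolding d_def by blast
  define Z where "Z = N * Y"
  have Z: "Z \<in> carrier_mat n d" using N Y by (auto simp: Z_def)
  define L where "L = E * Z"
  have L: "L \<in> carrier_mat n d" using E Z by (auto simp: L_def)
  have LY: "L = E * N * Y" unfolding L_def Z_def by (rule assoc_mult_mat[OF E(1) N Y(1), symmetric])
  have iL: "inj_mat L" and rL: "mat_range L = mat_range (E * N)" using Y LY by auto
  have LT: "transpose_mat L \<in> carrier_mat d n" and ZT: "transpose_mat Z \<in> carrier_mat d n"
    using L Z by auto
  have BZ: "?BT * Z = 0\<^sub>m m d"
  proof (rule mat_eqI_mult_vec)
    fix v :: "real vec" assume v: "v \<in> carrier_vec d"
    have "?BT * Z *\<^sub>v v = ?BT *\<^sub>v (N *\<^sub>v (Y *\<^sub>v v))"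
      using assoc_mult_mat_vec[OF BT Z v] assoc_mult_mat_vec[OF N Y(1) v] by (simp add: Z_def)
    also have "\<dots> = 0\<^sub>v m" by (rule BN) (use Y v in auto)
    also have "\<dots> = 0\<^sub>m m d *\<^sub>v v" using v by (intro eq_vecI) auto
    finally show "?BT * Z *\<^sub>v v = 0\<^sub>m m d *\<^sub>v v" .
  qed (use BT Z in auto)
  define D where "D = transpose_mat L * Z"
  have D: "D \<in> carrier_mat d d" using LT Z by (auto simp: D_def)
  have LTx: "transpose_mat L = transpose_mat Z * E"
    unfolding L_def using transpose_mult[OF E(1) Z] E(2) by simp
  have DT: "transpose_mat D = D"
    unfolding D_def using transpose_mult[OF LT Z] LTx assoc_mult_mat[OF ZT E(1) Z] by (simp add: L_def)
  have DZ: "D *\<^sub>v y = transpose_mat L *\<^sub>v (Z *\<^sub>v y)" if "y \<in> carrier_vec d" for y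
    unfolding D_def by (rule assoc_mult_mat_vec[OF LT Z that])
  \<comment> \<open>\<open>D\<close> is the matrix of the form \<open>E\<close> on the columns of
    \<open>Z\<close>. A kernel vector gives an isotropic \<open>Z y\<close>, hence
    \<open>E Z y = 0\<close>, against injectivity of \<open>L = E Z\<close>.\<close>
  have "inj_mat D"
  proof (rule inj_matI[OF D])
    fix y assume y: "y \<in> carrier_vec d" and z: "D *\<^sub>v y = 0\<^sub>v d"
    have Zy: "Z *\<^sub>v y \<in> carrier_vec n" using Z y by auto
    have Ly: "L *\<^sub>v y = E *\<^sub>v (Z *\<^sub>v y)" unfolding L_def by (rule assoc_mult_mat_vec[OF E(1) Z y])
    have "(Z *\<^sub>v y) \<bullet> (E *\<^sub>v (Z *\<^sub>v y)) = (D *\<^sub>v y) \<bullet> y"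
      unfolding DZ[OF y] Ly[symmetric] by (rule transpose_vec_mult_scalar[OF L y Zy, symmetric])
    also have "\<dots> = 0" using z y by simp
    finally have "E *\<^sub>v (Z *\<^sub>v y) = 0\<^sub>v n" using psd by (intro psd_isotropic_kernel[OF E _ Zy])
    then show "y = 0\<^sub>v d" using inj_matD[OF iL L y] Ly by simp
  qed
  then have "det D \<noteq> 0" using inj_mat_iff_det[OF D] by simp
  then obtain P where P: "P \<in> carrier_mat d d" "P * D = 1\<^sub>m d" "D * P = 1\<^sub>m d"
    by (rule det_nonzero_inverseE[OF D])
  have PT: "transpose_mat P = P"
  proof -
    have PTc: "transpose_mat P \<in> carrier_mat d d" using P by simp
    have "transpose_mat P * D = 1\<^sub>m d"
      using transpose_mult[OF D P(1)] P(3) DT by simp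
    then have "transpose_mat P * D * P = P" using P by simp
    then show ?thesis using assoc_mult_mat[OF PTc D P(1)] P(3) PTc by simp
  qed
  have LP: "L * P \<in> carrier_mat n d" using L P by auto
  \<comment> \<open>With \<open>P = D^-1\<close> the factor \<open>Z P L^T = Z D^-1 Z^T E\<close> is
    the \<open>E\<close>-orthogonal projector onto the range of \<open>Z\<close>, and
    \<open>X\<close> is \<open>E\<close> applied to it.\<close>
  define X where "X = L * P * transpose_mat L"
  have X: "X \<in> carrier_mat n n" using LP LT by (auto simp: X_def)
  have XT: "transpose_mat X = X"
    unfolding X_def using transpose_mult[OF LP LT] transpose_mult[OF L P(1)] PT
      assoc_mult_mat[OF L P(1) LT] by simp
  define M where "M = E - X"
  have M: "M \<in> carrier_mat n n" using E X by (auto simp: M_def intro!: minus_carrier_mat)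
  have MT: "transpose_mat M = M"
    unfolding M_def using transpose_minus[OF E(1) X] E(2) XT by simp
  have M0: "M *\<^sub>v (N *\<^sub>v v) = 0\<^sub>v n" if v: "v \<in> carrier_vec n" for v
  proof -
    have x: "N *\<^sub>v v \<in> carrier_vec n" using N v by auto
    have "E *\<^sub>v (N *\<^sub>v v) \<in> mat_range L"
      unfolding rL mat_range_iff[OF EN]
      by (rule bexI[OF _ v]) (rule assoc_mult_mat_vec[OF E(1) N v, symmetric])
    then obtain y where y: "y \<in> carrier_vec d" "E *\<^sub>v (N *\<^sub>v v) = L *\<^sub>v y"
      using mat_range_iff[OF L] by auto
    have "transpose_mat L *\<^sub>v (N *\<^sub>v v) = transpose_mat Z *\<^sub>v (L *\<^sub>v y)"
      unfolding LTx y(2)[symmetric] by (rule assoc_mult_mat_vec[OF ZT E(1) x])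
    also have "\<dots> = transpose_mat D *\<^sub>v y"
      unfolding D_def using transpose_mult[OF LT Z] assoc_mult_mat_vec[OF ZT L y(1)] by simp
    finally have "transpose_mat L *\<^sub>v (N *\<^sub>v v) = D *\<^sub>v y" unfolding DT .
    then have "X *\<^sub>v (N *\<^sub>v v) = L *\<^sub>v (P *\<^sub>v (D *\<^sub>v y))"
      unfolding X_def using assoc_mult_mat_vec[OF LP LT x] assoc_mult_mat_vec[OF L P(1), of "D *\<^sub>v y"]
        D y by simp
    also have "P *\<^sub>v (D *\<^sub>v y) = y" using assoc_mult_mat_vec[OF P(1) D y(1)] P(2) y by simp
    finally show ?thesis
      unfolding M_def minus_mult_distrib_mat_vec[OF E(1) X x] y(2) using L y by simp
  qed
  have MG: "M * G \<in> carrier_mat n m" using M G by auto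
  \<comment> \<open>\<open>M\<close> vanishes on the range of \<open>N = I - G B^T\<close>.
    Transposing this identity yields the left factor \<open>B\<close> in \<open>M2\<close>, and the
    two combine to \<open>M = B (G^T M G) B^T\<close>.\<close>
  have M1: "M = M * G * ?BT"
  proof (rule mat_eqI_mult_vec[OF M])
    fix v :: "real vec" assume v: "v \<in> carrier_vec n"
    have g: "G *\<^sub>v (?BT *\<^sub>v v) \<in> carrier_vec n" using G BT v by auto
    have "M *\<^sub>v v - M *\<^sub>v (G *\<^sub>v (?BT *\<^sub>v v)) = 0\<^sub>v n"
      using M0[OF v] unfolding Nx[OF v] mult_minus_distrib_mat_vec[OF M v g] .
    then have "M *\<^sub>v v = M *\<^sub>v (G *\<^sub>v (?BT *\<^sub>v v))"
      by (rule minus_vec_eq_zeroD[rotated 2]) (use M v g in auto)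
    also have "\<dots> = M * G * ?BT *\<^sub>v v"
      using assoc_mult_mat_vec[OF MG BT v] assoc_mult_mat_vec[OF M G(1), of "?BT *\<^sub>v v"] BT v by simp
    finally show "M *\<^sub>v v = M * G * ?BT *\<^sub>v v" .
  qed (use MG BT in auto)
  have GT: "transpose_mat G \<in> carrier_mat m n" using G by simp
  define H where "H = transpose_mat G * M * G"
  have GM: "transpose_mat G * M \<in> carrier_mat m n" using GT M by auto
  have H: "H \<in> carrier_mat m m" using GM G by (auto simp: H_def)
  have HT: "transpose_mat H = H"
    unfolding H_def using transpose_mult[OF GM G(1)] transpose_mult[OF GT M] MT
      assoc_mult_mat[OF GT M G(1)] by simp
  have M2: "M = B * (transpose_mat G * M)"
  proof -
    have "M = transpose_mat (M * G * ?BT)" using M1 MT by simp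
    also have "\<dots> = B * (transpose_mat G * transpose_mat M)"
      using transpose_mult[OF MG BT] transpose_mult[OF M G(1)] by simp
    finally show ?thesis unfolding MT .
  qed
  have BGM: "B * (transpose_mat G * M) * G = B * H"
    unfolding H_def by (rule assoc_mult_mat[OF B GM G(1)])
  have "M = M * G * ?BT" by (rule M1)
  also have "M * G = B * H" unfolding BGM[symmetric] by (subst M2) (rule refl)
  finally have "M = B * H * ?BT" .
  moreover have "E = X + M"
    unfolding M_def using E X by (intro eq_matI) auto
  ultimately have "E = X + B * H * ?BT" by simp
  then show ?thesis
    using that[OF Z P(1) H BZ] iL P(3) HT unfolding X_def D_def L_def by blast
qed

lemma add_vec_cancel:
  fixes a b :: "'a::ab_group_add vec"
  assumes "a \<in> carrier_vec n" "b \<in> carrier_vec n"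
  shows "a + b + - a + - b = 0\<^sub>v n"
  using assms by (intro eq_vecI) auto

text \<open>A budget of columns: \<open>W\<close>, \<open>L\<close> and \<open>B V\<close> have to
  be jointly independent inside the range of \<open>[E B]\<close>, which asks for
  \<open>k + d + q = k + r \<le> rank [E B]\<close>. Here \<open>d\<close> is the rank of the part
  that feedback leaves alone and \<open>q\<close> the number of columns of \<open>V\<close>, that
  is, the rank contributed by feedback.\<close>

lemma feedback_choice:
  fixes E B W :: "real mat"
  assumes E: "E \<in> carrier_mat n n" "transpose_mat E = E"
    and psd: "\<And>x. x \<in> carrier_vec n \<Longrightarrow> 0 \<le> x \<bullet> (E *\<^sub>v x)"
    and B: "B \<in> carrier_mat n m" and W: "W \<in> carrier_mat n k"
    and W_inj: "\<And>y w. y \<in> carrier_vec k \<Longrightarrow> w \<in> carrier_vec n \<Longrightarrow> transpose_mat B *\<^sub>v w = 0\<^sub>v m \<Longrightarrow>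
      W *\<^sub>v y = E *\<^sub>v w \<Longrightarrow> y = 0\<^sub>v k"
    and r_ge: "vec_space.rank n (E @\<^sub>c B) \<le> r + vec_space.rank n B"
    and r_le: "r + k \<le> vec_space.rank n (E @\<^sub>c B)"
  obtains F where "F \<in> carrier_mat m m"
    "transpose_mat (E + B * F * transpose_mat B) = E + B * F * transpose_mat B"
    "\<And>x. x \<in> carrier_vec n \<Longrightarrow> 0 \<le> x \<bullet> ((E + B * F * transpose_mat B) *\<^sub>v x)"
    "vec_space.rank n (E + B * F * transpose_mat B) = r"
    "\<And>y u. y \<in> carrier_vec k \<Longrightarrow> u \<in> carrier_vec n \<Longrightarrow>
      W *\<^sub>v y = (E + B * F * transpose_mat B) *\<^sub>v u \<Longrightarrow> y = 0\<^sub>v k"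
proof -
  let ?BT = "transpose_mat B"
  have BT: "?BT \<in> carrier_mat m n" using B by simp
  obtain d Z P H where Z: "Z \<in> carrier_mat n d" and P: "P \<in> carrier_mat d d"
    and H: "H \<in> carrier_mat m m" and BZ: "?BT * Z = 0\<^sub>m m d" and iEZ: "inj_mat (E * Z)"
    and DP: "transpose_mat (E * Z) * Z * P = 1\<^sub>m d" and HT: "transpose_mat H = H"
    and Eeq: "E = E * Z * P * transpose_mat (E * Z) + B * H * ?BT"
    by (rule psd_splitting[OF E psd B])
  define L where "L = E * Z"
  have L: "L \<in> carrier_mat n d" using E Z by (auto simp: L_def)
  have iL: "inj_mat L" using iEZ by (simp add: L_def)
  have LT: "transpose_mat L \<in> carrier_mat d n" using L by simp
  have LP: "L * P \<in> carrier_mat n d" using L P by auto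
  have Lu: "L *\<^sub>v u = E *\<^sub>v (Z *\<^sub>v u)" if "u \<in> carrier_vec d" for u
    unfolding L_def by (rule assoc_mult_mat_vec[OF E(1) Z that])
  have BZu: "?BT *\<^sub>v (Z *\<^sub>v u) = 0\<^sub>v m" if "u \<in> carrier_vec d" for u
  proof -
    have "?BT *\<^sub>v (Z *\<^sub>v u) = 0\<^sub>m m d *\<^sub>v u"
      unfolding BZ[symmetric] by (rule assoc_mult_mat_vec[OF BT Z that, symmetric])
    also have "\<dots> = 0\<^sub>v m" using that by (intro eq_vecI) auto
    finally show ?thesis .
  qed
  have ZL: "(Z *\<^sub>v p) \<bullet> (L *\<^sub>v u) = (transpose_mat L *\<^sub>v (Z *\<^sub>v p)) \<bullet> u"
    if "u \<in> carrier_vec d" "p \<in> carrier_vec d" for u p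
    using transpose_vec_mult_scalar[OF L that(1), of "Z *\<^sub>v p"] Z that by auto
  have DPv: "transpose_mat L *\<^sub>v (Z *\<^sub>v (P *\<^sub>v u)) = u" if u: "u \<in> carrier_vec d" for u
  proof -
    have Pu: "P *\<^sub>v u \<in> carrier_vec d" using P u by auto
    have "transpose_mat L *\<^sub>v (Z *\<^sub>v (P *\<^sub>v u)) = transpose_mat L * Z * P *\<^sub>v u"
      using assoc_mult_mat_vec[OF mult_carrier_mat[OF LT Z] P u] assoc_mult_mat_vec[OF LT Z Pu] by simp
    then show ?thesis using DP u by (simp add: L_def)
  qed
  \<comment> \<open>Pair the relation with \<open>Z P a\<close>: it is orthogonal to the range of
    \<open>B\<close>, and \<open>L^T Z P = I\<close> makes its product with \<open>L a\<close> equal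
    to \<open>|a|^2\<close>.\<close>
  have sum_z: "a = 0\<^sub>v d"
    if a: "a \<in> carrier_vec d" and b: "b \<in> carrier_vec m" and z: "L *\<^sub>v a + B *\<^sub>v b = 0\<^sub>v n" for a b
  proof -
    define q where "q = Z *\<^sub>v (P *\<^sub>v a)"
    have Pa: "P *\<^sub>v a \<in> carrier_vec d" using P a by auto
    have q: "q \<in> carrier_vec n" using Z Pa by (auto simp: q_def)
    have "q \<bullet> (B *\<^sub>v b) = (?BT *\<^sub>v q) \<bullet> b" using transpose_vec_mult_scalar[OF B b q] by simp
    also have "\<dots> = 0" using BZu[OF Pa] b by (simp add: q_def)
    finally have "q \<bullet> (L *\<^sub>v a + B *\<^sub>v b) = q \<bullet> (L *\<^sub>v a)"
      using q L B a b by (subst scalar_prod_add_distrib[of _ n]) auto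
    also have "\<dots> = a \<bullet> a" using ZL[OF a Pa] DPv[OF a] by (simp add: q_def)
    finally have "a \<bullet> a = 0" using z q by simp
    then show ?thesis by (rule scalar_prod_self_eq_0[OF a])
  qed
  let ?\<rho> = "vec_space.rank n (E @\<^sub>c B)"
  note EB = append_cols_carrier[OF E(1) B]
  have d_le: "d + vec_space.rank n B \<le> ?\<rho>"
  proof -
    obtain Y where Y: "Y \<in> carrier_mat m (vec_space.rank n B)" "inj_mat (B * Y)"
      using rank_factorization[OF B] by blast
    note BY = mult_carrier_mat[OF B Y(1)]
    have "inj_mat (L @\<^sub>c B * Y)"
      unfolding inj_mat_append_cols[OF L BY]
    proof (intro ballI impI)
      fix a b assume a: "a \<in> carrier_vec d" and b: "b \<in> carrier_vec (vec_space.rank n B)"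
        and z: "L *\<^sub>v a + B * Y *\<^sub>v b = 0\<^sub>v n"
      have Yb: "Y *\<^sub>v b \<in> carrier_vec m" using Y b by auto
      have a0: "a = 0\<^sub>v d" using sum_z[OF a Yb] z assoc_mult_mat_vec[OF B Y(1) b] by simp
      have "B * Y *\<^sub>v b = 0\<^sub>v n"
        using z mult_mat_vec_carrier[OF BY b] unfolding a0 mat_mult_zero_vec[OF L] by simp
      then show "a = 0\<^sub>v d \<and> b = 0\<^sub>v (vec_space.rank n B)" using inj_matD[OF Y(2) BY b] a0 by simp
    qed
    moreover have "mat_range (L @\<^sub>c B * Y) \<subseteq> mat_range (E @\<^sub>c B)"
    proof
      fix y assume "y \<in> mat_range (L @\<^sub>c B * Y)"
      then obtain a b where a: "a \<in> carrier_vec d" and b: "b \<in> carrier_vec (vec_space.rank n B)"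
        and y: "y = L *\<^sub>v a + B * Y *\<^sub>v b" using mat_range_append_cols[OF L BY] by blast
      have "Z *\<^sub>v a \<in> carrier_vec n" "Y *\<^sub>v b \<in> carrier_vec m" using Z Y a b by auto
      then show "y \<in> mat_range (E @\<^sub>c B)"
        unfolding mat_range_append_cols[OF E(1) B] y Lu[OF a] assoc_mult_mat_vec[OF B Y(1) b] by blast
    qed
    ultimately show ?thesis by (intro inj_mat_rank_le[OF append_cols_carrier[OF L BY] _ EB])
  qed
  have Ex: "E *\<^sub>v x = L *\<^sub>v (P *\<^sub>v (transpose_mat L *\<^sub>v x)) + B *\<^sub>v (H *\<^sub>v (?BT *\<^sub>v x))"
    if x: "x \<in> carrier_vec n" for x
  proof -
    have Lx: "transpose_mat L *\<^sub>v x \<in> carrier_vec d" using LT x by auto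
    have "E *\<^sub>v x = (L * P * transpose_mat L + B * H * ?BT) *\<^sub>v x"
      using Eeq by (simp add: L_def)
    also have "\<dots> = L * P * transpose_mat L *\<^sub>v x + B *\<^sub>v (H *\<^sub>v (?BT *\<^sub>v x))"
      by (rule output_feedback_mult_vec(1)[OF mult_carrier_mat[OF LP LT] B H BT x])
    also have "L * P * transpose_mat L *\<^sub>v x = L *\<^sub>v (P *\<^sub>v (transpose_mat L *\<^sub>v x))"
      unfolding assoc_mult_mat_vec[OF LP LT x] by (rule assoc_mult_mat_vec[OF L P Lx])
    finally show ?thesis .
  qed
  define U where "U = W @\<^sub>c L"
  have U: "U \<in> carrier_mat n (k + d)" unfolding U_def by (rule append_cols_carrier[OF W L])
  \<comment> \<open>The columns of \<open>L\<close> are of the form \<open>E w\<close> with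
    \<open>B^T w = 0\<close>, and such vectors are what \<open>W_inj\<close> keeps away from the
    range of \<open>W\<close>.\<close>
  have iU: "inj_mat U"
    unfolding U_def inj_mat_append_cols[OF W L]
  proof (intro ballI impI)
    fix y u assume y: "y \<in> carrier_vec k" and u: "u \<in> carrier_vec d"
      and z: "W *\<^sub>v y + L *\<^sub>v u = 0\<^sub>v n"
    have nu: "- u \<in> carrier_vec d" using u by simp
    have c: "W *\<^sub>v y \<in> carrier_vec n" "L *\<^sub>v u \<in> carrier_vec n" "Z *\<^sub>v (- u) \<in> carrier_vec n"
      using W L Z y u by auto
    have "W *\<^sub>v y = E *\<^sub>v (Z *\<^sub>v (- u))"
      unfolding Lu[OF nu, symmetric] mat_mult_uminus_vec[OF L u]
      by (rule add_vec_eq_zeroD[OF c(1,2) z])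
    then have y0: "y = 0\<^sub>v k" using W_inj[OF y c(3) BZu[OF nu]] by simp
    have "L *\<^sub>v u = 0\<^sub>v n" using z c(2) unfolding y0 mat_mult_zero_vec[OF W] by simp
    then show "y = 0\<^sub>v k \<and> u = 0\<^sub>v d" using inj_matD[OF iL L u] y0 by simp
  qed
  have UB: "U @\<^sub>c B \<in> carrier_mat n (k + d + m)" by (rule append_cols_carrier[OF U B])
  have "mat_range (E @\<^sub>c B) \<subseteq> mat_range (U @\<^sub>c B)"
  proof
    fix y assume "y \<in> mat_range (E @\<^sub>c B)"
    then obtain u v where u: "u \<in> carrier_vec n" and v: "v \<in> carrier_vec m"
      and y: "y = E *\<^sub>v u + B *\<^sub>v v" using mat_range_append_cols[OF E(1) B] by blast
    define a where "a = P *\<^sub>v (transpose_mat L *\<^sub>v u)"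
    define b where "b = H *\<^sub>v (?BT *\<^sub>v u)"
    have a: "a \<in> carrier_vec d" and b: "b \<in> carrier_vec m" using P LT H BT u by (auto simp: a_def b_def)
    have Ua: "U *\<^sub>v (0\<^sub>v k @\<^sub>v a) = L *\<^sub>v a"
      unfolding U_def append_cols_mult_vec[OF W L zero_carrier_vec a] mat_mult_zero_vec[OF W]
      using L a by simp
    have "y = L *\<^sub>v a + B *\<^sub>v b + B *\<^sub>v v" unfolding y Ex[OF u] a_def b_def ..
    also have "\<dots> = L *\<^sub>v a + B *\<^sub>v (b + v)"
      unfolding mult_add_distrib_mat_vec[OF B b v] by (rule assoc_add_vec[of _ n]) (use L B a b v in auto)
    finally have "y = U *\<^sub>v (0\<^sub>v k @\<^sub>v a) + B *\<^sub>v (b + v)" unfolding Ua .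
    moreover have "0\<^sub>v k @\<^sub>v a \<in> carrier_vec (k + d)" "b + v \<in> carrier_vec m" using a b v by auto
    ultimately show "y \<in> mat_range (U @\<^sub>c B)" unfolding mat_range_append_cols[OF U B] by blast
  qed
  then have "?\<rho> \<le> vec_space.rank n (U @\<^sub>c B)" by (rule rank_mono[OF EB UB])
  \<comment> \<open>\<open>d_le\<close> and \<open>r_ge\<close> together give
    \<open>d \<le> r\<close>, so the subtraction on naturals is exact.\<close>
  moreover define q where "q = r - d"
  have rdq: "r = d + q" using d_le r_ge by (simp add: q_def)
  ultimately have "k + d + q \<le> vec_space.rank n (U @\<^sub>c B)" using r_le by simp
  then obtain V where V: "V \<in> carrier_mat m q" and iUV: "inj_mat (U @\<^sub>c B * V)"
    by (rule inj_mat_extend[OF U iU B])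
  define N where "N = B * V"
  have N: "N \<in> carrier_mat n q" using B V by (auto simp: N_def)
  have VT: "transpose_mat V \<in> carrier_mat q m" and NT: "transpose_mat N \<in> carrier_mat q n"
    using V N by auto
  \<comment> \<open>The full statement separates \<open>W\<close> from the range of the new
    \<open>E\<close>; its instance \<open>y = 0\<close> provides the independence of
    \<open>L\<close> and \<open>N\<close> behind the rank.\<close>
  have inj3: "y = 0\<^sub>v k \<and> a = 0\<^sub>v d \<and> b = 0\<^sub>v q"
    if y: "y \<in> carrier_vec k" and a: "a \<in> carrier_vec d" and b: "b \<in> carrier_vec q"
      and z: "W *\<^sub>v y + L *\<^sub>v a + N *\<^sub>v b = 0\<^sub>v n" for y a b
  proof -
    have ya: "y @\<^sub>v a \<in> carrier_vec (k + d)" using y a by auto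
    have "U *\<^sub>v (y @\<^sub>v a) = W *\<^sub>v y + L *\<^sub>v a"
      unfolding U_def by (rule append_cols_mult_vec[OF W L y a])
    then have "y @\<^sub>v a = 0\<^sub>v (k + d) \<and> b = 0\<^sub>v q"
      using iUV[folded N_def, unfolded inj_mat_append_cols[OF U N]] ya b z by simp
    then show ?thesis using append_vec_zero_iff[OF y a] by simp
  qed
  define F where "F = V * transpose_mat V - H"
  have VV: "V * transpose_mat V \<in> carrier_mat m m" using V by auto
  have F: "F \<in> carrier_mat m m" using VV H by (auto simp: F_def intro!: minus_carrier_mat)
  have FT: "transpose_mat F = F"
    unfolding F_def transpose_minus[OF VV H] HT transpose_mult[OF V VT] by simp
  let ?E = "E + B * F * ?BT"
  have BF: "B * F \<in> carrier_mat n m" and BFB: "B * F * ?BT \<in> carrier_mat n n" using B F BT by auto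
  have E': "?E \<in> carrier_mat n n" using E BFB by auto
  have ET: "transpose_mat ?E = ?E"
  proof -
    have "transpose_mat (B * F * ?BT) = B * (F * ?BT)"
      unfolding transpose_mult[OF BF BT] transpose_mult[OF B F] FT by simp
    also have "\<dots> = B * F * ?BT" by (rule assoc_mult_mat[OF B F BT, symmetric])
    finally show ?thesis unfolding transpose_add[OF E(1) BFB] E(2) by simp
  qed
  have E'x: "?E *\<^sub>v x = L *\<^sub>v (P *\<^sub>v (transpose_mat L *\<^sub>v x)) + N *\<^sub>v (transpose_mat N *\<^sub>v x)"
    if x: "x \<in> carrier_vec n" for x
  proof -
    define b where "b = ?BT *\<^sub>v x"
    have b: "b \<in> carrier_vec m" using BT x by (auto simp: b_def)
    define h where "h = H *\<^sub>v b"
    have h: "h \<in> carrier_vec m" using H b by (auto simp: h_def)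
    define e where "e = transpose_mat V *\<^sub>v b"
    have e: "e \<in> carrier_vec q" using VT b by (auto simp: e_def)
    have Ve: "V *\<^sub>v e \<in> carrier_vec m" using V e by auto
    define l where "l = L *\<^sub>v (P *\<^sub>v (transpose_mat L *\<^sub>v x))"
    have l: "l \<in> carrier_vec n" using L P LT x by (auto simp: l_def)
    have "F *\<^sub>v b = V *\<^sub>v e - h"
      unfolding F_def minus_mult_distrib_mat_vec[OF VV H b] h_def e_def assoc_mult_mat_vec[OF V VT b] ..
    then have "B *\<^sub>v (F *\<^sub>v b) = B *\<^sub>v (V *\<^sub>v e) - B *\<^sub>v h"
      using mult_minus_distrib_mat_vec[OF B Ve h] by simp
    then have "?E *\<^sub>v x = l + B *\<^sub>v h + (B *\<^sub>v (V *\<^sub>v e) - B *\<^sub>v h)"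
      unfolding output_feedback_mult_vec(1)[OF E(1) B F BT x] Ex[OF x] b_def[symmetric]
        h_def[symmetric] l_def[symmetric] by simp
    also have "\<dots> = l + B *\<^sub>v (V *\<^sub>v e)"
      using l B h Ve by (intro eq_vecI) auto
    also have "B *\<^sub>v (V *\<^sub>v e) = N *\<^sub>v e"
      unfolding N_def by (rule assoc_mult_mat_vec[OF B V e, symmetric])
    also have "e = transpose_mat N *\<^sub>v x"
      unfolding N_def transpose_mult[OF B V] e_def b_def by (rule assoc_mult_mat_vec[OF VT BT x, symmetric])
    finally show ?thesis unfolding l_def .
  qed
  have E'psd: "0 \<le> x \<bullet> (?E *\<^sub>v x)" if x: "x \<in> carrier_vec n" for x
  proof -
    define p where "p = transpose_mat L *\<^sub>v x"
    have p: "p \<in> carrier_vec d" using LT x by (auto simp: p_def)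
    define t where "t = transpose_mat N *\<^sub>v x"
    have t: "t \<in> carrier_vec q" using NT x by (auto simp: t_def)
    have Pp: "P *\<^sub>v p \<in> carrier_vec d" using P p by auto
    \<comment> \<open>Chosen so that \<open>p \<bullet> P p = z \<bullet> E z\<close>, using
      \<open>L^T Z P = I\<close>; \<open>P\<close> thus inherits positivity from
      \<open>E\<close>.\<close>
    define z where "z = Z *\<^sub>v (P *\<^sub>v p)"
    have z: "z \<in> carrier_vec n" using Z Pp by (auto simp: z_def)
    have "x \<bullet> (?E *\<^sub>v x) = x \<bullet> (L *\<^sub>v (P *\<^sub>v p)) + x \<bullet> (N *\<^sub>v t)"
      unfolding E'x[OF x] p_def[symmetric] t_def[symmetric]
      by (rule scalar_prod_add_distrib[OF x]) (use L N Pp t in auto)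
    also have "x \<bullet> (N *\<^sub>v t) = t \<bullet> t"
      unfolding transpose_vec_mult_scalar[OF N t x, symmetric] t_def[symmetric] ..
    also have "x \<bullet> (L *\<^sub>v (P *\<^sub>v p)) = p \<bullet> (P *\<^sub>v p)"
      unfolding transpose_vec_mult_scalar[OF L Pp x, symmetric] p_def[symmetric] ..
    also have "\<dots> = z \<bullet> (E *\<^sub>v z)"
      using ZL[OF Pp Pp] DPv[OF p] Lu[OF Pp] by (simp add: z_def)
    finally show ?thesis using psd[OF z] scalar_prod_self_ge_0[of t] by simp
  qed
  have LN: "L @\<^sub>c N \<in> carrier_mat n (d + q)" by (rule append_cols_carrier[OF L N])
  have "mat_range ?E \<subseteq> mat_range (L @\<^sub>c N)"
  proof
    fix y assume "y \<in> mat_range ?E"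
    then obtain x where x: "x \<in> carrier_vec n" "y = ?E *\<^sub>v x" using mat_range_iff[OF E'] by blast
    have "P *\<^sub>v (transpose_mat L *\<^sub>v x) \<in> carrier_vec d" "transpose_mat N *\<^sub>v x \<in> carrier_vec q"
      using P LT NT x by auto
    then show "y \<in> mat_range (L @\<^sub>c N)"
      unfolding mat_range_append_cols[OF L N] x(2) E'x[OF x(1)] by blast
  qed
  then have le: "vec_space.rank n ?E \<le> r" unfolding rdq by (rule rank_le_spanning[OF E' LN])
  have Wz: "W *\<^sub>v 0\<^sub>v k = 0\<^sub>v n" by (rule mat_mult_zero_vec[OF W])
  have kerE': "transpose_mat L *\<^sub>v x = 0\<^sub>v d \<and> transpose_mat N *\<^sub>v x = 0\<^sub>v q"
    if x: "x \<in> carrier_vec n" and z: "?E *\<^sub>v x = 0\<^sub>v n" for x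
  proof -
    define p where "p = transpose_mat L *\<^sub>v x"
    have p: "p \<in> carrier_vec d" using LT x by (auto simp: p_def)
    have t: "transpose_mat N *\<^sub>v x \<in> carrier_vec q" using NT x by auto
    have Pp: "P *\<^sub>v p \<in> carrier_vec d" using P p by auto
    have "W *\<^sub>v 0\<^sub>v k + L *\<^sub>v (P *\<^sub>v p) + N *\<^sub>v (transpose_mat N *\<^sub>v x) = 0\<^sub>v n"
      using z E'x[OF x] L Pp unfolding Wz p_def by simp
    then have "P *\<^sub>v p = 0\<^sub>v d" "transpose_mat N *\<^sub>v x = 0\<^sub>v q"
      using inj3[OF zero_carrier_vec Pp t] by auto
    moreover from this(1) have "p = transpose_mat L *\<^sub>v (Z *\<^sub>v 0\<^sub>v d)" using DPv[OF p] by simp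
    ultimately show ?thesis
      unfolding p_def[symmetric] mat_mult_zero_vec[OF Z] mat_mult_zero_vec[OF LT] by simp
  qed
  \<comment> \<open>The lower bound on the rank: if \<open>?E\<close> kills
    \<open>x = L a + N b\<close>, then \<open>L^T x\<close> and \<open>N^T x\<close> vanish, so
    \<open>x\<close> is orthogonal to itself.\<close>
  have "inj_mat (?E * (L @\<^sub>c N))"
  proof (rule inj_matI[OF mult_carrier_mat[OF E' LN]])
    fix v assume v: "v \<in> carrier_vec (d + q)" and z: "?E * (L @\<^sub>c N) *\<^sub>v v = 0\<^sub>v n"
    from v obtain a b where a: "a \<in> carrier_vec d" and b: "b \<in> carrier_vec q" and vab: "v = a @\<^sub>v b"
      by (rule vec_splitE)
    define x where "x = L *\<^sub>v a + N *\<^sub>v b"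
    have x: "x \<in> carrier_vec n" using L N a b by (auto simp: x_def)
    have "(L @\<^sub>c N) *\<^sub>v v = x"
      unfolding vab x_def by (rule append_cols_mult_vec[OF L N a b])
    then have "?E *\<^sub>v x = 0\<^sub>v n" using z assoc_mult_mat_vec[OF E' LN v] by simp
    note k = kerE'[OF x this]
    have "x \<bullet> x = x \<bullet> (L *\<^sub>v a) + x \<bullet> (N *\<^sub>v b)"
      by (subst (2) x_def) (rule scalar_prod_add_distrib[OF x], use L N a b in auto)
    also have "\<dots> = 0"
      unfolding transpose_vec_mult_scalar[OF L a x, symmetric]
        transpose_vec_mult_scalar[OF N b x, symmetric] using k a b by simp
    finally have x0: "x = 0\<^sub>v n" by (rule scalar_prod_self_eq_0[OF x])
    have "W *\<^sub>v 0\<^sub>v k + L *\<^sub>v a + N *\<^sub>v b = 0\<^sub>v n"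
      unfolding Wz using x0 L a by (simp add: x_def)
    then show "v = 0\<^sub>v (d + q)" using inj3[OF zero_carrier_vec a b] vab zero_append_vec by auto
  qed
  then have "d + q \<le> vec_space.rank n ?E"
    by (rule inj_mat_rank_le[OF mult_carrier_mat[OF E' LN] _ E' mat_range_mult_subset[OF E' LN]])
  then have rk: "vec_space.rank n ?E = r" using le rdq by simp
  have "y = 0\<^sub>v k"
    if y: "y \<in> carrier_vec k" and u: "u \<in> carrier_vec n" and eq: "W *\<^sub>v y = ?E *\<^sub>v u" for y u
  proof -
    define a where "a = P *\<^sub>v (transpose_mat L *\<^sub>v u)"
    define b where "b = transpose_mat N *\<^sub>v u"
    have a: "a \<in> carrier_vec d" and b: "b \<in> carrier_vec q" using P LT NT u by (auto simp: a_def b_def)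
    have "W *\<^sub>v y = L *\<^sub>v a + N *\<^sub>v b" unfolding eq E'x[OF u] a_def b_def ..
    then have "W *\<^sub>v y + L *\<^sub>v (- a) + N *\<^sub>v (- b) = L *\<^sub>v a + N *\<^sub>v b + - (L *\<^sub>v a) + - (N *\<^sub>v b)"
      unfolding mat_mult_uminus_vec[OF L a] mat_mult_uminus_vec[OF N b] by simp
    also have "\<dots> = 0\<^sub>v n"
      by (rule add_vec_cancel[OF mult_mat_vec_carrier[OF L a] mult_mat_vec_carrier[OF N b]])
    finally show ?thesis using inj3[OF y, of "- a" "- b"] a b by simp
  qed
  then show ?thesis using that[OF F ET E'psd rk] by blast
qed

subsection \<open>Stability and port-Hamiltonian structure of the closed loop\<close>

lemma cmat_mult_vec_index:
  assumes M: "M \<in> carrier_mat k n" and x: "x \<in> carrier_vec n" and i: "i < k"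
  shows "(cmat M *\<^sub>v x) $ i = Complex ((M *\<^sub>v map_vec Re x) $ i) ((M *\<^sub>v map_vec Im x) $ i)"
  using assms by (auto simp: complex_eq_iff scalar_prod_def Re_sum Im_sum)

lemma cmat_mult_vec_zero_iff:
  assumes M: "M \<in> carrier_mat k n" and x: "x \<in> carrier_vec n"
  shows "cmat M *\<^sub>v x = 0\<^sub>v k \<longleftrightarrow> M *\<^sub>v map_vec Re x = 0\<^sub>v k \<and> M *\<^sub>v map_vec Im x = 0\<^sub>v k"
proof -
  have "cmat M *\<^sub>v x = 0\<^sub>v k \<longleftrightarrow> (\<forall>i<k. (cmat M *\<^sub>v x) $ i = 0)"
    using M by (auto simp: vec_eq_iff simp del: index_mult_mat_vec)
  also have "\<dots> \<longleftrightarrow> (\<forall>i<k. (M *\<^sub>v map_vec Re x) $ i = 0 \<and> (M *\<^sub>v map_vec Im x) $ i = 0)"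
    using cmat_mult_vec_index[OF M x] by (auto simp: complex_eq_iff simp del: index_mult_mat_vec)
  also have "\<dots> \<longleftrightarrow> M *\<^sub>v map_vec Re x = 0\<^sub>v k \<and> M *\<^sub>v map_vec Im x = 0\<^sub>v k"
    using M by (auto simp: vec_eq_iff simp del: index_mult_mat_vec)
  finally show ?thesis .
qed

text \<open>Real and imaginary parts of \<open>s E x = A x\<close> with \<open>x = a + i b\<close>.
  Working with the real pair lets real semidefiniteness be applied to complex modes.\<close>

lemma pencil_mult_vec_zero_iff:
  assumes E: "E \<in> carrier_mat k n" and A: "A \<in> carrier_mat k n" and x: "x \<in> carrier_vec n"
  defines "a \<equiv> map_vec Re x" and "b \<equiv> map_vec Im x"
  shows "pencil s E A *\<^sub>v x = 0\<^sub>v k \<longleftrightarrow>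
    Re s \<cdot>\<^sub>v (E *\<^sub>v a) - Im s \<cdot>\<^sub>v (E *\<^sub>v b) = A *\<^sub>v a \<and>
    Re s \<cdot>\<^sub>v (E *\<^sub>v b) + Im s \<cdot>\<^sub>v (E *\<^sub>v a) = A *\<^sub>v b"
proof -
  have ab: "a \<in> carrier_vec n" "b \<in> carrier_vec n" using x by (auto simp: a_def b_def)
  define Ea where "Ea = E *\<^sub>v a"
  define Eb where "Eb = E *\<^sub>v b"
  define Aa where "Aa = A *\<^sub>v a"
  define Ab where "Ab = A *\<^sub>v b"
  have d: "dim_vec Ea = k" "dim_vec Eb = k" "dim_vec Aa = k" "dim_vec Ab = k"
    using E A by (auto simp: Ea_def Eb_def Aa_def Ab_def)
  have p: "(pencil s E A *\<^sub>v x) $ i = s * Complex (Ea $ i) (Eb $ i) - Complex (Aa $ i) (Ab $ i)"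
    if i: "i < k" for i
  proof -
    have "(pencil s E A *\<^sub>v x) $ i = s * (cmat E *\<^sub>v x) $ i - (cmat A *\<^sub>v x) $ i"
      unfolding pencil_mult_vec[OF E A x] using i E A by (simp del: index_mult_mat_vec)
    then show ?thesis
      unfolding cmat_mult_vec_index[OF E x i] cmat_mult_vec_index[OF A x i]
        Ea_def Eb_def Aa_def Ab_def a_def b_def .
  qed
  have dp: "dim_vec (pencil s E A *\<^sub>v x) = k" using pencil_carrier[OF E A, of s] by simp
  have "pencil s E A *\<^sub>v x = 0\<^sub>v k \<longleftrightarrow> (\<forall>i<k. (pencil s E A *\<^sub>v x) $ i = 0)"
    using dp by (auto simp: vec_eq_iff simp del: index_mult_mat_vec)
  also have "\<dots> \<longleftrightarrow> (\<forall>i<k. s * Complex (Ea $ i) (Eb $ i) - Complex (Aa $ i) (Ab $ i) = 0)"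
    using p by auto
  also have "\<dots> \<longleftrightarrow> (\<forall>i<k. Re s * Ea $ i - Im s * Eb $ i = Aa $ i \<and> Re s * Eb $ i + Im s * Ea $ i = Ab $ i)"
    by (simp add: complex_eq_iff)
  also have "\<dots> \<longleftrightarrow> Re s \<cdot>\<^sub>v Ea - Im s \<cdot>\<^sub>v Eb = Aa \<and> Re s \<cdot>\<^sub>v Eb + Im s \<cdot>\<^sub>v Ea = Ab"
    using d by (auto simp: vec_eq_iff)
  finally show ?thesis unfolding Ea_def Eb_def Aa_def Ab_def .
qed

lemma pencil_singularE:
  assumes E: "E \<in> carrier_mat n n" and A: "A \<in> carrier_mat n n" and d: "det (pencil s E A) = 0"
  obtains a b where "a \<in> carrier_vec n" "b \<in> carrier_vec n" "\<not> (a = 0\<^sub>v n \<and> b = 0\<^sub>v n)"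
    "Re s \<cdot>\<^sub>v (E *\<^sub>v a) - Im s \<cdot>\<^sub>v (E *\<^sub>v b) = A *\<^sub>v a"
    "Re s \<cdot>\<^sub>v (E *\<^sub>v b) + Im s \<cdot>\<^sub>v (E *\<^sub>v a) = A *\<^sub>v b"
proof -
  obtain x where x: "x \<in> carrier_vec n" "x \<noteq> 0\<^sub>v n" "pencil s E A *\<^sub>v x = 0\<^sub>v n"
    using det_0_iff_vec_prod_zero_field[OF pencil_carrier[OF E A, of s]] d by blast
  have "x = 0\<^sub>v n" if "map_vec Re x = 0\<^sub>v n" "map_vec Im x = 0\<^sub>v n"
  proof (rule eq_vecI)
    fix i assume "i < dim_vec (0\<^sub>v n :: complex vec)"
    then have i: "i < n" by simp
    have "Re (x $ i) = map_vec Re x $ i" "Im (x $ i) = map_vec Im x $ i" using i x(1) by auto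
    then show "x $ i = 0\<^sub>v n $ i" unfolding that using i by (simp add: complex_eq_iff)
  qed (use x in auto)
  then have "\<not> (map_vec Re x = 0\<^sub>v n \<and> map_vec Im x = 0\<^sub>v n)" using x(2) by blast
  moreover have "map_vec Re x \<in> carrier_vec n" "map_vec Im x \<in> carrier_vec n" using x by auto
  ultimately show ?thesis
    using that pencil_mult_vec_zero_iff[OF E A x(1)] x(3) by blast
qed

text \<open>The rank test on \<open>sE-A\<close> and \<open>C\<close>, transferred to real pairs by
  reassembling \<open>x = a + i b\<close>.\<close>

lemma observable_pencil_kernel:
  assumes E: "E \<in> carrier_mat n n" and A: "A \<in> carrier_mat n n" and C: "C \<in> carrier_mat m n"
    and i: "inj_mat (pencil s E A @\<^sub>r cmat C)"
    and a: "a \<in> carrier_vec n" and b: "b \<in> carrier_vec n"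
    and eq: "Re s \<cdot>\<^sub>v (E *\<^sub>v a) - Im s \<cdot>\<^sub>v (E *\<^sub>v b) = A *\<^sub>v a"
      "Re s \<cdot>\<^sub>v (E *\<^sub>v b) + Im s \<cdot>\<^sub>v (E *\<^sub>v a) = A *\<^sub>v b"
    and Cab: "C *\<^sub>v a = 0\<^sub>v m" "C *\<^sub>v b = 0\<^sub>v m"
  shows "a = 0\<^sub>v n" "b = 0\<^sub>v n"
proof -
  define x where "x = vec n (\<lambda>i. Complex (a $ i) (b $ i))"
  have x: "x \<in> carrier_vec n" by (simp add: x_def)
  have R: "map_vec Re x = a" and I: "map_vec Im x = b"
    using a b by (auto simp: x_def intro!: eq_vecI)
  have P: "pencil s E A \<in> carrier_mat n n" by (rule pencil_carrier[OF E A])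
  have cC: "cmat C \<in> carrier_mat m n" using C by simp
  have "pencil s E A *\<^sub>v x = 0\<^sub>v n" using pencil_mult_vec_zero_iff[OF E A x] eq R I by simp
  moreover have "cmat C *\<^sub>v x = 0\<^sub>v m" using cmat_mult_vec_zero_iff[OF C x] Cab R I by simp
  ultimately have "(pencil s E A @\<^sub>r cmat C) *\<^sub>v x = 0\<^sub>v (n + m)"
    using mat_mult_append[OF P cC x] zero_append_vec by simp
  then have "x = 0\<^sub>v n" by (rule inj_matD[OF i carrier_append_rows[OF P cC] x])
  then show "a = 0\<^sub>v n" "b = 0\<^sub>v n" using R I by (auto intro!: eq_vecI)
qed

text \<open>Pair the first equation with \<open>a\<close>, the second with \<open>b\<close>, and
  add. The \<omega>-terms cancel by symmetry of \<open>M\<close>, so \<sigma> times the sum of two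
  nonnegative values of the form is at most \<open>- |D a|^2 - |D b|^2\<close>. Both sides must
  vanish.\<close>

lemma dissipative_pencil_kernel:
  fixes M N D :: "real mat"
  assumes M: "M \<in> carrier_mat n n" "transpose_mat M = M"
    and psd: "\<And>x. x \<in> carrier_vec n \<Longrightarrow> 0 \<le> x \<bullet> (M *\<^sub>v x)"
    and N: "N \<in> carrier_mat n n" and D: "D \<in> carrier_mat m n"
    and diss: "\<And>x. x \<in> carrier_vec n \<Longrightarrow> x \<bullet> (N *\<^sub>v x) \<le> - ((D *\<^sub>v x) \<bullet> (D *\<^sub>v x))"
    and \<sigma>: "0 \<le> \<sigma>" and a: "a \<in> carrier_vec n" and b: "b \<in> carrier_vec n"
    and eq: "\<sigma> \<cdot>\<^sub>v (M *\<^sub>v a) - \<omega> \<cdot>\<^sub>v (M *\<^sub>v b) = N *\<^sub>v a"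
      "\<sigma> \<cdot>\<^sub>v (M *\<^sub>v b) + \<omega> \<cdot>\<^sub>v (M *\<^sub>v a) = N *\<^sub>v b"
  shows "D *\<^sub>v a = 0\<^sub>v m" "D *\<^sub>v b = 0\<^sub>v m"
    "0 < \<sigma> \<Longrightarrow> M *\<^sub>v a = 0\<^sub>v n" "0 < \<sigma> \<Longrightarrow> M *\<^sub>v b = 0\<^sub>v n"
proof -
  have Ma: "M *\<^sub>v a \<in> carrier_vec n" and Mb: "M *\<^sub>v b \<in> carrier_vec n"
    and Da: "D *\<^sub>v a \<in> carrier_vec m" and Db: "D *\<^sub>v b \<in> carrier_vec m" using M D a b by auto
  have "a \<bullet> (N *\<^sub>v a) = \<sigma> * (a \<bullet> (M *\<^sub>v a)) - \<omega> * (a \<bullet> (M *\<^sub>v b))"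
    unfolding eq(1)[symmetric] using a Ma Mb by (subst scalar_prod_minus_distrib[of _ n]) auto
  moreover have "b \<bullet> (N *\<^sub>v b) = \<sigma> * (b \<bullet> (M *\<^sub>v b)) + \<omega> * (b \<bullet> (M *\<^sub>v a))"
    unfolding eq(2)[symmetric] using b Ma Mb by (subst scalar_prod_add_distrib[of _ n]) auto
  moreover have "a \<bullet> (M *\<^sub>v b) = b \<bullet> (M *\<^sub>v a)" by (rule symmetric_scalar_prod[OF M a b])
  ultimately have s: "a \<bullet> (N *\<^sub>v a) + b \<bullet> (N *\<^sub>v b) = \<sigma> * (a \<bullet> (M *\<^sub>v a)) + \<sigma> * (b \<bullet> (M *\<^sub>v b))"
    by (simp add: algebra_simps)
  have p: "0 \<le> \<sigma> * (a \<bullet> (M *\<^sub>v a))" "0 \<le> \<sigma> * (b \<bullet> (M *\<^sub>v b))" using psd a b \<sigma> by auto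
  note g = scalar_prod_self_ge_0[of "D *\<^sub>v a"] scalar_prod_self_ge_0[of "D *\<^sub>v b"]
  have "(D *\<^sub>v a) \<bullet> (D *\<^sub>v a) = 0" "(D *\<^sub>v b) \<bullet> (D *\<^sub>v b) = 0"
    using s p g diss[OF a] diss[OF b] by linarith+
  then show "D *\<^sub>v a = 0\<^sub>v m" "D *\<^sub>v b = 0\<^sub>v m"
    using scalar_prod_self_eq_0[OF Da] scalar_prod_self_eq_0[OF Db] by auto
  have z: "\<sigma> * (a \<bullet> (M *\<^sub>v a)) = 0" "\<sigma> * (b \<bullet> (M *\<^sub>v b)) = 0"
    using s p g diss[OF a] diss[OF b] by linarith+
  show "M *\<^sub>v a = 0\<^sub>v n" if "0 < \<sigma>"
    using psd z that by (intro psd_isotropic_kernel[OF M _ a]) auto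
  show "M *\<^sub>v b = 0\<^sub>v n" if "0 < \<sigma>"
    using psd z that by (intro psd_isotropic_kernel[OF M _ b]) auto
qed

section \<open>Port-Hamiltonian structure under feedback\<close>

lemma pos_semidefD:
  assumes "pos_semidef M" "M \<in> carrier_mat n n"
  shows "transpose_mat M = M" "x \<in> carrier_vec n \<Longrightarrow> 0 \<le> x \<bullet> (M *\<^sub>v x)"
  using assms unfolding pos_semidef_def by auto

lemma pos_semidefI:
  assumes "M \<in> carrier_mat n n" "transpose_mat M = M"
    "\<And>x. x \<in> carrier_vec n \<Longrightarrow> 0 \<le> x \<bullet> (M *\<^sub>v x)"
  shows "pos_semidef M"
  using assms unfolding pos_semidef_def by auto

lemma skew_scalar_prod:
  fixes M :: "real mat"
  assumes M: "M \<in> carrier_mat n n" "M = - transpose_mat M" and x: "x \<in> carrier_vec n"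
  shows "x \<bullet> (M *\<^sub>v x) = 0"
proof -
  have Mx: "M *\<^sub>v x \<in> carrier_vec n" and MT: "transpose_mat M \<in> carrier_mat n n" using M x by auto
  have "M *\<^sub>v x = (- transpose_mat M) *\<^sub>v x" using M(2) by simp
  also have "\<dots> = - (transpose_mat M *\<^sub>v x)" using MT x by (intro eq_vecI) auto
  finally have e: "M *\<^sub>v x = - (transpose_mat M *\<^sub>v x)" .
  have "x \<bullet> (M *\<^sub>v x) = (transpose_mat M *\<^sub>v x) \<bullet> x"
    by (rule transpose_vec_mult_scalar[OF M(1) x x, symmetric])
  also have "\<dots> = x \<bullet> (transpose_mat M *\<^sub>v x)" by (rule comm_scalar_prod[of _ n]) (use MT x in auto)
  also have "\<dots> = - (x \<bullet> (- (transpose_mat M *\<^sub>v x)))"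
    using MT x by (subst scalar_prod_uminus_right) auto
  finally have "x \<bullet> (M *\<^sub>v x) = - (x \<bullet> (M *\<^sub>v x))" unfolding e[symmetric] .
  then show ?thesis by simp
qed

text \<open>Because \<open>Q^T P = 0\<close>, both \<open>(G + P)^T Q\<close> and
  \<open>(G - P)^T Q\<close> reduce to \<open>G^T Q\<close>, so \<open>C = B^T Q\<close>. In
  \<open>Q^T A = Q^T J Q - Q^T R Q\<close> the skew part contributes nothing to the quadratic
  form.\<close>

lemma pH_representation_facts:
  assumes E: "E \<in> carrier_mat n n" and pH: "pH_representation n m E A B C J R Q G P"
  shows "C = transpose_mat B * Q" and "A = (J - R) * Q"
    and "transpose_mat (transpose_mat Q * E) = transpose_mat Q * E"
    and "\<And>x. x \<in> carrier_vec n \<Longrightarrow> 0 \<le> x \<bullet> (transpose_mat Q * E *\<^sub>v x)"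
    and "\<And>x. x \<in> carrier_vec n \<Longrightarrow> x \<bullet> (transpose_mat Q * A *\<^sub>v x) \<le> 0"
proof -
  let ?QT = "transpose_mat Q"
  have J: "J \<in> carrier_mat n n" and R: "R \<in> carrier_mat n n" and Q: "Q \<in> carrier_mat n n"
    and G: "G \<in> carrier_mat n m" and P: "P \<in> carrier_mat n m"
    and A: "A = (J - R) * Q" and B: "B = G - P" and C: "C = transpose_mat (G + P) * Q"
    and psd: "pos_semidef (?QT * E)" and skew: "?QT * J * Q = - transpose_mat (?QT * J * Q)"
    and psdR: "pos_semidef (?QT * R * Q)" and QP: "?QT * P = 0\<^sub>m n m"
    using pH unfolding pH_representation_def by auto
  have QT: "?QT \<in> carrier_mat n n" and GT: "transpose_mat G \<in> carrier_mat m n"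
    and PT: "transpose_mat P \<in> carrier_mat m n" using Q G P by auto
  have "transpose_mat P * Q = transpose_mat (?QT * P)" using transpose_mult[OF QT P] by simp
  then have PQ: "transpose_mat P * Q = 0\<^sub>m m n" unfolding QP by simp
  have GQ: "transpose_mat G * Q \<in> carrier_mat m n" using GT Q by auto
  have "C = transpose_mat G * Q"
    unfolding C transpose_add[OF G P] add_mult_distrib_mat[OF GT PT Q] PQ using GQ by simp
  also have "\<dots> = transpose_mat B * Q"
    unfolding B transpose_minus[OF G P] minus_mult_distrib_mat[OF GT PT Q] PQ
    using GQ by (intro eq_matI) auto
  finally show "C = transpose_mat B * Q" .
  show "A = (J - R) * Q" by (rule A)
  have QE: "?QT * E \<in> carrier_mat n n" using QT E by auto
  show "transpose_mat (?QT * E) = ?QT * E" by (rule pos_semidefD(1)[OF psd QE])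
  show "0 \<le> x \<bullet> (?QT * E *\<^sub>v x)" if "x \<in> carrier_vec n" for x by (rule pos_semidefD(2)[OF psd QE that])
  have QJ: "?QT * J \<in> carrier_mat n n" and QR: "?QT * R \<in> carrier_mat n n" using QT J R by auto
  have QJQ: "?QT * J * Q \<in> carrier_mat n n" and QRQ: "?QT * R * Q \<in> carrier_mat n n"
    using QJ QR Q by auto
  have JR: "J - R \<in> carrier_mat n n" using J R by (auto intro!: minus_carrier_mat)
  have "?QT * A = ?QT * (J - R) * Q" unfolding A by (rule assoc_mult_mat[OF QT JR Q, symmetric])
  also have "\<dots> = ?QT * J * Q - ?QT * R * Q"
    unfolding mult_minus_distrib_mat[OF QT J R] by (rule minus_mult_distrib_mat[OF QJ QR Q])
  finally have QA: "?QT * A = ?QT * J * Q - ?QT * R * Q" .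
  fix x :: "real vec" assume x: "x \<in> carrier_vec n"
  have "x \<bullet> (?QT * A *\<^sub>v x) = x \<bullet> (?QT * J * Q *\<^sub>v x) - x \<bullet> (?QT * R * Q *\<^sub>v x)"
    unfolding QA minus_mult_distrib_mat_vec[OF QJQ QRQ x]
    by (rule scalar_prod_minus_distrib[OF x]) (use QJQ QRQ x in auto)
  also have "\<dots> \<le> 0" using skew_scalar_prod[OF QJQ skew x] pos_semidefD(2)[OF psdR QRQ x] by simp
  finally show "x \<bullet> (?QT * A *\<^sub>v x) \<le> 0" .
qed

lemma minus_minus_mat:
  fixes X Y Z :: "'a::ab_group_add mat"
  assumes "X \<in> carrier_mat n c" "Y \<in> carrier_mat n c" "Z \<in> carrier_mat n c"
  shows "X - Y - Z = X - (Y + Z)"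
  using assms by (intro eq_matI) auto

text \<open>Unit output feedback is pure damping: \<open>B C = B B^T Q\<close> is absorbed into
  \<open>R\<close> and adds \<open>C^T C\<close> to \<open>Q^T R Q\<close>. Since \<open>E'\<close>
  enters only through the semidefiniteness condition, the derivative feedback can be chosen
  independently.\<close>

lemma pH_representation_feedback:
  assumes E: "E \<in> carrier_mat n n" and pH: "pH_representation n m E A B C J R Q G P"
    and E': "E' \<in> carrier_mat n n" and psd: "pos_semidef (transpose_mat Q * E')"
  shows "pH_representation n m E' (A - B * 1\<^sub>m m * C) B C J (R + B * transpose_mat B) Q G P"
proof -
  let ?QT = "transpose_mat Q" and ?X = "B * transpose_mat B"
  have J: "J \<in> carrier_mat n n" and R: "R \<in> carrier_mat n n" and Q: "Q \<in> carrier_mat n n"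
    and G: "G \<in> carrier_mat n m" and P: "P \<in> carrier_mat n m" and A: "A = (J - R) * Q"
    and B: "B = G - P" and C: "C = transpose_mat (G + P) * Q"
    and skew: "?QT * J * Q = - transpose_mat (?QT * J * Q)"
    and psdR: "pos_semidef (?QT * R * Q)" and QP: "?QT * P = 0\<^sub>m n m"
    using pH unfolding pH_representation_def by auto
  note CB = pH_representation_facts(1)[OF E pH]
  have Bc: "B \<in> carrier_mat n m" using B G P by (auto intro!: minus_carrier_mat)
  have BT: "transpose_mat B \<in> carrier_mat m n" using Bc by simp
  have Cc: "C \<in> carrier_mat m n" unfolding CB using BT Q by auto
  have QT: "?QT \<in> carrier_mat n n" using Q by simp
  have X: "?X \<in> carrier_mat n n" using Bc BT by auto
  have RX: "R + ?X \<in> carrier_mat n n" using R X by auto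
  have JQ: "J * Q \<in> carrier_mat n n" and RQ: "R * Q \<in> carrier_mat n n"
    and BC: "B * C \<in> carrier_mat n n" using J R Q Bc Cc by auto
  have XQ: "?X * Q = B * C" unfolding CB by (rule assoc_mult_mat[OF Bc BT Q])
  have "A - B * 1\<^sub>m m * C = J * Q - R * Q - B * C"
    unfolding A minus_mult_distrib_mat[OF J R Q] using Bc by simp
  also have "\<dots> = J * Q - (R * Q + B * C)"
    by (rule minus_minus_mat[OF JQ RQ BC])
  also have "\<dots> = (J - (R + ?X)) * Q"
    unfolding minus_mult_distrib_mat[OF J RX Q] add_mult_distrib_mat[OF R X Q] XQ ..
  finally have A': "A - B * 1\<^sub>m m * C = (J - (R + ?X)) * Q" .
  have QE': "?QT * E' \<in> carrier_mat n n" using QT E' by auto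
  have sym: "?QT * E' = transpose_mat E' * Q"
    using pos_semidefD(1)[OF psd QE'] transpose_mult[OF QT E'] by simp
  have QR: "?QT * R \<in> carrier_mat n n" and QX: "?QT * ?X \<in> carrier_mat n n" using QT R X by auto
  have QRQ: "?QT * R * Q \<in> carrier_mat n n" using QR Q by auto
  have CT: "transpose_mat C \<in> carrier_mat n m" using Cc by simp
  have CC: "transpose_mat C * C \<in> carrier_mat n n" using CT Cc by auto
  have "transpose_mat C = ?QT * B" unfolding CB transpose_mult[OF BT Q] by simp
  then have "?QT * ?X * Q = transpose_mat C * C"
    using assoc_mult_mat[OF QT X Q] XQ assoc_mult_mat[OF QT Bc Cc] by simp
  then have QRXQ: "?QT * (R + ?X) * Q = ?QT * R * Q + transpose_mat C * C"
    unfolding mult_add_distrib_mat[OF QT R X] add_mult_distrib_mat[OF QR QX Q] by simp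
  have "pos_semidef (?QT * (R + ?X) * Q)"
    unfolding QRXQ
  proof (rule pos_semidefI)
    show "?QT * R * Q + transpose_mat C * C \<in> carrier_mat n n" using QRQ CC by auto
    show "transpose_mat (?QT * R * Q + transpose_mat C * C) = ?QT * R * Q + transpose_mat C * C"
      unfolding transpose_add[OF QRQ CC] pos_semidefD(1)[OF psdR QRQ] transpose_mult[OF CT Cc] by simp
    fix x :: "real vec" assume x: "x \<in> carrier_vec n"
    have Cx: "C *\<^sub>v x \<in> carrier_vec m" using Cc x by auto
    have "x \<bullet> ((?QT * R * Q + transpose_mat C * C) *\<^sub>v x) =
        x \<bullet> (?QT * R * Q *\<^sub>v x) + x \<bullet> (transpose_mat C * C *\<^sub>v x)"
      unfolding add_mult_distrib_mat_vec[OF QRQ CC x]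
      by (rule scalar_prod_add_distrib[OF x]) (use QRQ CC x in auto)
    also have "x \<bullet> (transpose_mat C * C *\<^sub>v x) = (C *\<^sub>v x) \<bullet> (C *\<^sub>v x)"
      using transpose_vec_mult_scalar[OF CT Cx x] assoc_mult_mat_vec[OF CT Cc x] by simp
    finally show "0 \<le> x \<bullet> ((?QT * R * Q + transpose_mat C * C) *\<^sub>v x)"
      using pos_semidefD(2)[OF psdR QRQ x] scalar_prod_self_ge_0[of "C *\<^sub>v x"] by simp
  qed
  then show ?thesis
    unfolding pH_representation_def using J RX Q G P A' B C sym psd skew QP by auto
qed

text \<open>\<open>Q\<close> is a right factor of both \<open>A\<close> and \<open>C\<close>, so its
  kernel lies in the common kernel of \<open>A\<close> and \<open>C\<close>, which the rank test at
  \<open>s = 0\<close> makes trivial.\<close>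

lemma pH_representation_Q_inj:
  assumes E: "E \<in> carrier_mat n n" and A: "A \<in> carrier_mat n n" and C: "C \<in> carrier_mat m n"
    and pH: "pH_representation n m E A B C J R Q G P"
    and i: "inj_mat (pencil 0 E A @\<^sub>r cmat C)"
  shows "inj_mat Q"
proof -
  have J: "J \<in> carrier_mat n n" and R: "R \<in> carrier_mat n n" and Q: "Q \<in> carrier_mat n n"
    and G: "G \<in> carrier_mat n m" and P: "P \<in> carrier_mat n m" and B: "B = G - P"
    using pH unfolding pH_representation_def by auto
  have BT: "transpose_mat B \<in> carrier_mat m n" unfolding B using G P by (auto intro!: minus_carrier_mat)
  have JR: "J - R \<in> carrier_mat n n" using J R by (auto intro!: minus_carrier_mat)
  note Ceq = pH_representation_facts(1)[OF E pH] and Aeq = pH_representation_facts(2)[OF E pH]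
  show ?thesis
  proof (rule inj_matI[OF Q])
    fix x assume x: "x \<in> carrier_vec n" and z: "Q *\<^sub>v x = 0\<^sub>v n"
    have Ax: "A *\<^sub>v x = 0\<^sub>v n"
      unfolding Aeq assoc_mult_mat_vec[OF JR Q x] z by (rule mat_mult_zero_vec[OF JR])
    have Cx: "C *\<^sub>v x = 0\<^sub>v m"
      unfolding Ceq assoc_mult_mat_vec[OF BT Q x] z by (rule mat_mult_zero_vec[OF BT])
    have z0: "(0::real) \<cdot>\<^sub>v y - 0 \<cdot>\<^sub>v w = 0\<^sub>v n" "(0::real) \<cdot>\<^sub>v y + 0 \<cdot>\<^sub>v w = 0\<^sub>v n"
      if "y \<in> carrier_vec n" "w \<in> carrier_vec n" for y w
      using that by (auto intro!: eq_vecI)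
    have c: "E *\<^sub>v x \<in> carrier_vec n" "E *\<^sub>v 0\<^sub>v n \<in> carrier_vec n" using E x by auto
    show "x = 0\<^sub>v n"
      by (rule observable_pencil_kernel(1)[OF E A C i x zero_carrier_vec])
        (use z0 c Ax Cx mat_mult_zero_vec[OF A] mat_mult_zero_vec[OF C] in auto)
  qed
qed

text \<open>\<open>F\<close> is chosen for \<open>M = Q^T E\<close>, \<open>N = Q^T B\<close> and
  \<open>W = Q^T A S\<close>, where \<open>N^T = C\<close>. As \<open>Q^T\<close> is injective,
  ranks and the separation of \<open>A S\<close> from ranges carry over between the two settings,
  and the same \<open>F\<close> serves the original system.\<close>

lemma stabilizing_feedback_exists:
  assumes E: "E \<in> carrier_mat n n" and A: "A \<in> carrier_mat n n" and B: "B \<in> carrier_mat n m"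
    and C: "C \<in> carrier_mat m n"
    and pH: "pH_representation n m E A B C J R Q G P"
    and S: "S \<in> carrier_mat n k"
    and S_ker: "\<And>x. x \<in> carrier_vec n \<Longrightarrow> E *\<^sub>v x = 0\<^sub>v n \<Longrightarrow> C *\<^sub>v x = 0\<^sub>v m \<Longrightarrow>
      A *\<^sub>v x \<in> mat_range (E @\<^sub>c B) \<Longrightarrow> x \<in> mat_range S"
    and AS: "\<And>y w. y \<in> carrier_vec k \<Longrightarrow> w \<in> carrier_vec n \<Longrightarrow> C *\<^sub>v w = 0\<^sub>v m \<Longrightarrow>
      A *\<^sub>v (S *\<^sub>v y) = E *\<^sub>v w \<Longrightarrow> y = 0\<^sub>v k"
    and hautus: "\<And>s. Re s = 0 \<Longrightarrow> inj_mat (pencil s E A @\<^sub>r cmat C)"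
    and r_ge: "vec_space.rank n (E @\<^sub>c B) \<le> r + vec_space.rank n B"
    and r_le: "r + k \<le> vec_space.rank n (E @\<^sub>c B)"
  obtains F where "F \<in> carrier_mat m m"
    "regular_impulse_free (E + B * F * C) (A - B * 1\<^sub>m m * C)"
    "\<And>s. det (pencil s (E + B * F * C) (A - B * 1\<^sub>m m * C)) = 0 \<Longrightarrow> Re s < 0"
    "vec_space.rank n (E + B * F * C) = r"
    "admits_pH n m (E + B * F * C) (A - B * 1\<^sub>m m * C) B C"
proof -
  let ?QT = "transpose_mat Q"
  have Q: "Q \<in> carrier_mat n n" using pH unfolding pH_representation_def by auto
  have QT: "?QT \<in> carrier_mat n n" using Q by simp
  have BT: "transpose_mat B \<in> carrier_mat m n" using B by simp
  have "inj_mat Q" by (rule pH_representation_Q_inj[OF E A C pH hautus]) simp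
  then have iQT: "inj_mat ?QT"
    using inj_mat_iff_det[OF Q] inj_mat_iff_det[OF QT] det_transpose[OF Q] by simp
  have QTD: "u = v" if "u \<in> carrier_vec n" "v \<in> carrier_vec n" "?QT *\<^sub>v u = ?QT *\<^sub>v v" for u v
  proof -
    have "?QT *\<^sub>v (u - v) = 0\<^sub>v n"
      unfolding mult_minus_distrib_mat_vec[OF QT that(1,2)] that(3) using QT that by simp
    moreover have "u - v \<in> carrier_vec n" using that by auto
    ultimately have "u - v = 0\<^sub>v n" using inj_matD[OF iQT QT] by blast
    then show ?thesis by (rule minus_vec_eq_zeroD[OF that(1,2)])
  qed
  note Ceq = pH_representation_facts(1)[OF E pH]
  define M where "M = ?QT * E"
  define N where "N = ?QT * B"
  have M: "M \<in> carrier_mat n n" and N: "N \<in> carrier_mat n m" using QT E B by (auto simp: M_def N_def)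
  have NT: "transpose_mat N = C"
    unfolding N_def Ceq using transpose_mult[OF QT B] by simp
  have MT: "transpose_mat M = M" and Mpsd: "\<And>x. x \<in> carrier_vec n \<Longrightarrow> 0 \<le> x \<bullet> (M *\<^sub>v x)"
    unfolding M_def using pH_representation_facts(3,4)[OF E pH] by auto
  have AS': "A * S \<in> carrier_mat n k" using A S by auto
  define W where "W = ?QT * (A * S)"
  have W: "W \<in> carrier_mat n k" using QT AS' by (auto simp: W_def)
  have Wy: "W *\<^sub>v y = ?QT *\<^sub>v (A *\<^sub>v (S *\<^sub>v y))" if y: "y \<in> carrier_vec k" for y
    unfolding W_def assoc_mult_mat_vec[OF QT AS' y] assoc_mult_mat_vec[OF A S y] ..
  have W_inj: "y = 0\<^sub>v k"
    if y: "y \<in> carrier_vec k" and w: "w \<in> carrier_vec n" and Nw: "transpose_mat N *\<^sub>v w = 0\<^sub>v m"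
      and eq: "W *\<^sub>v y = M *\<^sub>v w" for y w
  proof -
    have "?QT *\<^sub>v (A *\<^sub>v (S *\<^sub>v y)) = ?QT *\<^sub>v (E *\<^sub>v w)"
      using eq unfolding Wy[OF y] M_def assoc_mult_mat_vec[OF QT E w] .
    then have "A *\<^sub>v (S *\<^sub>v y) = E *\<^sub>v w" by (rule QTD[rotated 2]) (use A S E y w in auto)
    then show ?thesis using AS[OF y w] Nw unfolding NT by blast
  qed
  note EB = append_cols_carrier[OF E B] and MN = append_cols_carrier[OF M N]
  have "?QT * (E @\<^sub>c B) = M @\<^sub>c N"
  proof (rule mat_eqI_mult_vec[OF mult_carrier_mat[OF QT EB] MN])
    fix v :: "real vec" assume v: "v \<in> carrier_vec (n + m)"
    then obtain a b where a: "a \<in> carrier_vec n" and b: "b \<in> carrier_vec m" and ab: "v = a @\<^sub>v b"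
      by (rule vec_splitE)
    have Ea: "E *\<^sub>v a \<in> carrier_vec n" and Bb: "B *\<^sub>v b \<in> carrier_vec n" using E B a b by auto
    have "?QT * (E @\<^sub>c B) *\<^sub>v v = ?QT *\<^sub>v (E *\<^sub>v a) + ?QT *\<^sub>v (B *\<^sub>v b)"
      unfolding assoc_mult_mat_vec[OF QT EB v] unfolding ab append_cols_mult_vec[OF E B a b]
      by (rule mult_add_distrib_mat_vec[OF QT Ea Bb])
    also have "\<dots> = (M @\<^sub>c N) *\<^sub>v v"
      unfolding ab append_cols_mult_vec[OF M N a b] unfolding M_def N_def
        assoc_mult_mat_vec[OF QT E a] assoc_mult_mat_vec[OF QT B b] ..
    finally show "?QT * (E @\<^sub>c B) *\<^sub>v v = (M @\<^sub>c N) *\<^sub>v v" .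
  qed
  then have rMN: "vec_space.rank n (M @\<^sub>c N) = vec_space.rank n (E @\<^sub>c B)"
    using rank_mult_left_inj[OF QT iQT EB] by simp
  have rN: "vec_space.rank n N = vec_space.rank n B"
    unfolding N_def by (rule rank_mult_left_inj[OF QT iQT B])
  obtain F where F: "F \<in> carrier_mat m m"
    and T': "transpose_mat (M + N * F * transpose_mat N) = M + N * F * transpose_mat N"
    and psd': "\<And>x. x \<in> carrier_vec n \<Longrightarrow> 0 \<le> x \<bullet> ((M + N * F * transpose_mat N) *\<^sub>v x)"
    and rank': "vec_space.rank n (M + N * F * transpose_mat N) = r"
    and W': "\<And>y u. y \<in> carrier_vec k \<Longrightarrow> u \<in> carrier_vec n \<Longrightarrow>
      W *\<^sub>v y = (M + N * F * transpose_mat N) *\<^sub>v u \<Longrightarrow> y = 0\<^sub>v k"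
  proof (rule feedback_choice[OF M MT _ N W _ r_ge[folded rMN rN] r_le[folded rMN]], goal_cases)
    case 1
    show ?case by (rule Mpsd[OF 1(2)])
  next
    case 2
    show ?case by (rule W_inj[OF 2(2-5)])
  next
    case (3 F)
    show ?case by (rule 3(1)[OF 3(2-6)])
  qed
  let ?E = "E + B * F * C" and ?A = "A - B * 1\<^sub>m m * C"
  have BF: "B * F \<in> carrier_mat n m" and BFC: "B * F * C \<in> carrier_mat n n" using B F C by auto
  have E': "?E \<in> carrier_mat n n" and A': "?A \<in> carrier_mat n n"
    using E A B F C by (auto intro!: minus_carrier_mat)
  have QE': "?QT * ?E = M + N * F * transpose_mat N"
    unfolding NT mult_add_distrib_mat[OF QT E BFC] unfolding M_def N_def
      assoc_mult_mat[OF QT BF C, symmetric] assoc_mult_mat[OF QT B F] ..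
  define M' where "M' = ?QT * ?E"
  have M': "M' \<in> carrier_mat n n" using QT E' by (auto simp: M'_def)
  have M'T: "transpose_mat M' = M'" and M'psd: "\<And>x. x \<in> carrier_vec n \<Longrightarrow> 0 \<le> x \<bullet> (M' *\<^sub>v x)"
    using T' psd' unfolding M'_def QE' by auto
  have M'x: "M' *\<^sub>v x = ?QT *\<^sub>v (?E *\<^sub>v x)" if x: "x \<in> carrier_vec n" for x
    unfolding M'_def by (rule assoc_mult_mat_vec[OF QT E' x])
  define N' where "N' = ?QT * ?A"
  have N': "N' \<in> carrier_mat n n" using QT A' by (auto simp: N'_def)
  have N'x: "N' *\<^sub>v x = ?QT *\<^sub>v (?A *\<^sub>v x)" if x: "x \<in> carrier_vec n" for x
    unfolding N'_def by (rule assoc_mult_mat_vec[OF QT A' x])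
  have one: "1\<^sub>m m \<in> carrier_mat m m" by simp
  have diss: "x \<bullet> (N' *\<^sub>v x) \<le> - ((C *\<^sub>v x) \<bullet> (C *\<^sub>v x))" if x: "x \<in> carrier_vec n" for x
  proof -
    have Cx: "C *\<^sub>v x \<in> carrier_vec m" and Ax: "A *\<^sub>v x \<in> carrier_vec n"
      and BCx: "B *\<^sub>v (C *\<^sub>v x) \<in> carrier_vec n" using A B C x by auto
    have "N' *\<^sub>v x = ?QT * A *\<^sub>v x - N *\<^sub>v (C *\<^sub>v x)"
      unfolding N'x[OF x] output_feedback_mult_vec(2)[OF A B one C x] one_mult_mat_vec[OF Cx]
        mult_minus_distrib_mat_vec[OF QT Ax BCx] N_def
        assoc_mult_mat_vec[OF QT A x] assoc_mult_mat_vec[OF QT B Cx] ..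
    then have "x \<bullet> (N' *\<^sub>v x) = x \<bullet> (?QT * A *\<^sub>v x) - x \<bullet> (N *\<^sub>v (C *\<^sub>v x))"
      using scalar_prod_minus_distrib[OF x, of "?QT * A *\<^sub>v x" "N *\<^sub>v (C *\<^sub>v x)"]
        mult_mat_vec_carrier[OF mult_carrier_mat[OF QT A] x] mult_mat_vec_carrier[OF N Cx] by simp
    also have "x \<bullet> (N *\<^sub>v (C *\<^sub>v x)) = (C *\<^sub>v x) \<bullet> (C *\<^sub>v x)"
      unfolding transpose_vec_mult_scalar[OF N Cx x, symmetric] NT ..
    finally show ?thesis using pH_representation_facts(5)[OF E pH x] by simp
  qed
  have Bz: "B *\<^sub>v (X *\<^sub>v 0\<^sub>v m) = 0\<^sub>v n" if "X \<in> carrier_mat m m" for X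
    unfolding mat_mult_zero_vec[OF that] by (rule mat_mult_zero_vec[OF B])
  have E'C: "?E *\<^sub>v x = E *\<^sub>v x" if x: "x \<in> carrier_vec n" and "C *\<^sub>v x = 0\<^sub>v m" for x
    unfolding output_feedback_mult_vec(1)[OF E B F C x] that(2) Bz[OF F]
    by (rule right_zero_vec) (use E x in auto)
  have A'C: "?A *\<^sub>v x = A *\<^sub>v x" if x: "x \<in> carrier_vec n" and "C *\<^sub>v x = 0\<^sub>v m" for x
    unfolding output_feedback_mult_vec(2)[OF A B one C x] that(2) Bz[OF one]
    by (rule minus_zero_vec) (use A x in auto)
  \<comment> \<open>For an impulsive \<open>x\<close> with \<open>?A x = ?E w\<close>, symmetry of
    \<open>M'\<close> gives
    \<open>x \<bullet> N' x = x \<bullet> M' w = w \<bullet> M' x = 0\<close>. Dissipation then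
    yields \<open>C x = 0\<close>, so \<open>x\<close> lies in the range of \<open>S\<close>, and
    the choice of \<open>F\<close> excludes it.\<close>
  have rif: "regular_impulse_free ?E ?A"
    unfolding regular_impulse_free_iff[OF E' A']
  proof (intro ballI impI)
    fix x w assume x: "x \<in> carrier_vec n" and w: "w \<in> carrier_vec n"
      and Ex: "?E *\<^sub>v x = 0\<^sub>v n" and Aw: "?A *\<^sub>v x = ?E *\<^sub>v w"
    have Cx: "C *\<^sub>v x \<in> carrier_vec m" using C x by auto
    have "x \<bullet> (N' *\<^sub>v x) = x \<bullet> (M' *\<^sub>v w)" unfolding N'x[OF x] Aw M'x[OF w] ..
    also have "\<dots> = w \<bullet> (M' *\<^sub>v x)" by (rule symmetric_scalar_prod[OF M' M'T x w])
    also have "\<dots> = 0" unfolding M'x[OF x] Ex mat_mult_zero_vec[OF QT] using w by simp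
    finally have "(C *\<^sub>v x) \<bullet> (C *\<^sub>v x) = 0"
      using diss[OF x] scalar_prod_self_ge_0[of "C *\<^sub>v x"] by simp
    then have Cx0: "C *\<^sub>v x = 0\<^sub>v m" by (rule scalar_prod_self_eq_0[OF Cx])
    have Ex0: "E *\<^sub>v x = 0\<^sub>v n" using Ex E'C[OF x Cx0] by simp
    have Aw': "A *\<^sub>v x = ?E *\<^sub>v w" using Aw A'C[OF x Cx0] by simp
    have "F *\<^sub>v (C *\<^sub>v w) \<in> carrier_vec m" using F C w by auto
    then have "A *\<^sub>v x \<in> mat_range (E @\<^sub>c B)"
      unfolding Aw' mat_range_append_cols[OF E B] output_feedback_mult_vec(1)[OF E B F C w]
      using w by blast
    then obtain y where y: "y \<in> carrier_vec k" "x = S *\<^sub>v y"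
      using S_ker[OF x Ex0 Cx0] mat_range_iff[OF S] by blast
    have "W *\<^sub>v y = (M + N * F * transpose_mat N) *\<^sub>v w"
      unfolding Wy[OF y(1)] y(2)[symmetric] Aw' QE'[symmetric] M'x[OF w, unfolded M'_def] ..
    then have "y = 0\<^sub>v k" by (rule W'[OF y(1) w])
    then show "x = 0\<^sub>v n" using y(2) mat_mult_zero_vec[OF S] by simp
  qed
  have stable: "Re s < 0" if sing: "det (pencil s ?E ?A) = 0" for s
  proof (rule ccontr)
    assume "\<not> Re s < 0"
    then have s: "0 \<le> Re s" by simp
    obtain a b where a: "a \<in> carrier_vec n" and b: "b \<in> carrier_vec n"
      and ne: "\<not> (a = 0\<^sub>v n \<and> b = 0\<^sub>v n)"
      and eq: "Re s \<cdot>\<^sub>v (?E *\<^sub>v a) - Im s \<cdot>\<^sub>v (?E *\<^sub>v b) = ?A *\<^sub>v a"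
        "Re s \<cdot>\<^sub>v (?E *\<^sub>v b) + Im s \<cdot>\<^sub>v (?E *\<^sub>v a) = ?A *\<^sub>v b"
      by (rule pencil_singularE[OF E' A' sing])
    have Ea: "?E *\<^sub>v a \<in> carrier_vec n" and Eb: "?E *\<^sub>v b \<in> carrier_vec n" using E' a b by auto
    have sc: "t \<cdot>\<^sub>v (?E *\<^sub>v c) \<in> carrier_vec n" "?QT *\<^sub>v (t \<cdot>\<^sub>v (?E *\<^sub>v c)) = t \<cdot>\<^sub>v (M' *\<^sub>v c)"
      if c: "c \<in> carrier_vec n" for t c
      using mult_mat_vec_carrier[OF E' c] mult_mat_vec[OF QT mult_mat_vec_carrier[OF E' c]] M'x[OF c]
      by auto
    have eq': "Re s \<cdot>\<^sub>v (M' *\<^sub>v a) - Im s \<cdot>\<^sub>v (M' *\<^sub>v b) = N' *\<^sub>v a"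
      "Re s \<cdot>\<^sub>v (M' *\<^sub>v b) + Im s \<cdot>\<^sub>v (M' *\<^sub>v a) = N' *\<^sub>v b"
      unfolding N'x[OF a] N'x[OF b] eq[symmetric] mult_minus_distrib_mat_vec[OF QT sc(1)[OF a] sc(1)[OF b]]
        mult_add_distrib_mat_vec[OF QT sc(1)[OF b] sc(1)[OF a]] sc(2)[OF a] sc(2)[OF b] by (rule refl)+
    note dk = dissipative_pencil_kernel[OF M' M'T M'psd N' C diss s a b eq']
    have Ca: "C *\<^sub>v a = 0\<^sub>v m" by (rule dk(1))
    have Cb: "C *\<^sub>v b = 0\<^sub>v m" by (rule dk(2))
    have eqA: "Re s \<cdot>\<^sub>v (E *\<^sub>v a) - Im s \<cdot>\<^sub>v (E *\<^sub>v b) = A *\<^sub>v a"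
      "Re s \<cdot>\<^sub>v (E *\<^sub>v b) + Im s \<cdot>\<^sub>v (E *\<^sub>v a) = A *\<^sub>v b"
      using eq unfolding E'C[OF a Ca] E'C[OF b Cb] A'C[OF a Ca] A'C[OF b Cb] by auto
    \<comment> \<open>On the imaginary axis the rank test applies at \<open>s\<close> itself. For
      positive real part the dissipation argument also gives \<open>E a = E b = 0\<close>, hence
      \<open>A a = A b = 0\<close>, and the test applies at 0 instead.\<close>
    show False
    proof (cases "Re s = 0")
      case True
      from observable_pencil_kernel[OF E A C hautus[OF True] a b eqA Ca Cb] ne show False by blast
    next
      case False
      then have pos: "0 < Re s" using s by simp
      have "M' *\<^sub>v a = 0\<^sub>v n" by (rule dk(3)) (simp_all add: pos)
      moreover have "M' *\<^sub>v b = 0\<^sub>v n" by (rule dk(4)) (simp_all add: pos)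
      ultimately have "?QT *\<^sub>v (E *\<^sub>v a) = 0\<^sub>v n" "?QT *\<^sub>v (E *\<^sub>v b) = 0\<^sub>v n"
        using M'x[OF a] M'x[OF b] E'C[OF a Ca] E'C[OF b Cb] by auto
      then have E0: "E *\<^sub>v a = 0\<^sub>v n" "E *\<^sub>v b = 0\<^sub>v n"
        using inj_matD[OF iQT QT mult_mat_vec_carrier[OF E a]]
          inj_matD[OF iQT QT mult_mat_vec_carrier[OF E b]] by auto
      have z: "t \<cdot>\<^sub>v 0\<^sub>v n - u \<cdot>\<^sub>v 0\<^sub>v n = (0\<^sub>v n :: real vec)"
        "t \<cdot>\<^sub>v 0\<^sub>v n + u \<cdot>\<^sub>v 0\<^sub>v n = (0\<^sub>v n :: real vec)" for t u
        by (intro eq_vecI; simp)+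
      have "Re 0 \<cdot>\<^sub>v (E *\<^sub>v a) - Im 0 \<cdot>\<^sub>v (E *\<^sub>v b) = A *\<^sub>v a"
        "Re 0 \<cdot>\<^sub>v (E *\<^sub>v b) + Im 0 \<cdot>\<^sub>v (E *\<^sub>v a) = A *\<^sub>v b"
        using eqA unfolding E0 z by simp_all
      from observable_pencil_kernel[OF E A C hautus a b this Ca Cb] ne show False by auto
    qed
  qed
  have rk: "vec_space.rank n ?E = r"
    using rank_mult_left_inj[OF QT iQT E'] rank' unfolding QE' by simp
  have "pos_semidef (?QT * ?E)"
    using pos_semidefI[OF M' M'T M'psd] unfolding M'_def .
  then have "admits_pH n m ?E ?A B C"
    unfolding admits_pH_def using pH_representation_feedback[OF E pH E'] by blast
  then show ?thesis using that[OF F rif stable rk] by blast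
qed

section \<open>The equivalence of (a) and (b)\<close>

theorem theorem4p2:
  fixes n m :: nat and E A B C S\<^sub>C T\<^sub>E\<^sub>B T\<^sub>a S\<^sub>b :: "real mat" and r :: int
  assumes "E \<in> carrier_mat n n" and "A \<in> carrier_mat n n"
    and "B \<in> carrier_mat n m" and "C \<in> carrier_mat m n"
    and "admits_pH n m E A B C"
    and "is_S_inf C S\<^sub>C"
    and "is_T_inf (E * S\<^sub>C) T\<^sub>a"
    and "is_T_inf (E @\<^sub>c B) T\<^sub>E\<^sub>B"
    and "is_S_inf (E @\<^sub>r (transpose_mat T\<^sub>E\<^sub>B * A) @\<^sub>r C) S\<^sub>b"
  shows "(\<exists>K \<in> carrier_mat m m. \<exists>F \<in> carrier_mat m m.
            regular_impulse_free (E + B * F * C) (A - B * K * C) \<and>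
            regular_asymp_stable (E + B * F * C) (A - B * K * C) \<and>
            int (mat_rank (E + B * F * C)) = r \<and>
            admits_pH n m (E + B * F * C) (A - B * K * C) B C)
     \<longleftrightarrow>
         (mat_rank (transpose_mat T\<^sub>a * A * S\<^sub>b) = dim_col (transpose_mat T\<^sub>a * A * S\<^sub>b) \<and>
          (\<forall>s. Re s = 0 \<longrightarrow>
             mat_rank (pencil s E A @\<^sub>c cmat B) = n \<and>
             mat_rank (pencil s E A @\<^sub>r cmat C) = n) \<and>
          int (mat_rank (E @\<^sub>c B)) - int (mat_rank B) \<le> r \<and>
          r \<le> int (mat_rank (E @\<^sub>c B)) - int (mat_rank (transpose_mat T\<^sub>a * A * S\<^sub>b)))"
    (is "?lhs \<longleftrightarrow> ?rhs")
proof -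
  note E = assms(1) and A = assms(2) and B = assms(3) and C = assms(4)
  note EB = append_cols_carrier[OF E B]
  obtain c where c: "dim_col S\<^sub>C = c" by simp
  note SC = is_S_infD[OF C assms(6), unfolded c]
  have ESC: "E * S\<^sub>C \<in> carrier_mat n c" using E SC(1) by auto
  obtain a where a: "dim_col T\<^sub>a = a" by simp
  note Ta = is_T_infD[OF ESC assms(7), unfolded a]
  obtain e where e: "dim_col T\<^sub>E\<^sub>B = e" by simp
  note TEB = is_T_infD[OF EB assms(8), unfolded e]
  have TT: "transpose_mat T\<^sub>a \<in> carrier_mat a n" and TE: "transpose_mat T\<^sub>E\<^sub>B \<in> carrier_mat e n"
    using Ta(1) TEB(1) by auto
  have TEA: "transpose_mat T\<^sub>E\<^sub>B * A \<in> carrier_mat e n" using TE A by auto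
  have TAC: "(transpose_mat T\<^sub>E\<^sub>B * A) @\<^sub>r C \<in> carrier_mat (e + m) n"
    by (rule carrier_append_rows[OF TEA C])
  have stk: "E @\<^sub>r (transpose_mat T\<^sub>E\<^sub>B * A) @\<^sub>r C \<in> carrier_mat (n + (e + m)) n"
    by (rule carrier_append_rows[OF E TAC])
  obtain k where k: "dim_col S\<^sub>b = k" by simp
  note Sb = is_S_infD[OF stk assms(9), unfolded k]
  \<comment> \<open>The block with \<open>T\<^sub>E\<^sub>B\<close> is the membership of
    \<open>A x\<close> in the range of \<open>[E B]\<close>, written as a linear equation.\<close>
  have Sb_iff: "x \<in> mat_range S\<^sub>b \<longleftrightarrow>
      E *\<^sub>v x = 0\<^sub>v n \<and> A *\<^sub>v x \<in> mat_range (E @\<^sub>c B) \<and> C *\<^sub>v x = 0\<^sub>v m"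
    if x: "x \<in> carrier_vec n" for x
  proof -
    have Ex: "E *\<^sub>v x \<in> carrier_vec n" and Ax: "A *\<^sub>v x \<in> carrier_vec n" and Cx: "C *\<^sub>v x \<in> carrier_vec m"
      and Tx: "transpose_mat T\<^sub>E\<^sub>B * A *\<^sub>v x \<in> carrier_vec e"
      and TCx: "((transpose_mat T\<^sub>E\<^sub>B * A) @\<^sub>r C) *\<^sub>v x \<in> carrier_vec (e + m)"
      by (rule mult_mat_vec_carrier[OF E x] mult_mat_vec_carrier[OF A x] mult_mat_vec_carrier[OF C x]
          mult_mat_vec_carrier[OF TEA x] mult_mat_vec_carrier[OF TAC x])+
    have "x \<in> mat_range S\<^sub>b \<longleftrightarrow> (E @\<^sub>r (transpose_mat T\<^sub>E\<^sub>B * A) @\<^sub>r C) *\<^sub>v x = 0\<^sub>v (n + (e + m))"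
      unfolding Sb(3) mat_kernel[OF stk] using x by simp
    also have "\<dots> \<longleftrightarrow> E *\<^sub>v x = 0\<^sub>v n \<and> transpose_mat T\<^sub>E\<^sub>B * A *\<^sub>v x = 0\<^sub>v e \<and> C *\<^sub>v x = 0\<^sub>v m"
      unfolding mat_mult_append[OF E TAC x] append_vec_zero_iff[OF Ex TCx]
      unfolding mat_mult_append[OF TEA C x] append_vec_zero_iff[OF Tx Cx] ..
    also have "transpose_mat T\<^sub>E\<^sub>B * A *\<^sub>v x = 0\<^sub>v e \<longleftrightarrow> A *\<^sub>v x \<in> mat_range (E @\<^sub>c B)"
      unfolding assoc_mult_mat_vec[OF TE A x] by (rule TEB(2)[OF Ax])
    finally show ?thesis .
  qed
  have Sy: "S\<^sub>b *\<^sub>v y \<in> carrier_vec n \<and> S\<^sub>b *\<^sub>v y \<in> mat_range S\<^sub>b" if "y \<in> carrier_vec k" for y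
    using that Sb(1) mat_range_iff[OF Sb(1)] by auto
  let ?M = "transpose_mat T\<^sub>a * A * S\<^sub>b"
  have TA: "transpose_mat T\<^sub>a * A \<in> carrier_mat a n" using TT A by auto
  have M: "?M \<in> carrier_mat a k" by (rule mult_carrier_mat[OF TA Sb(1)])
  have range_ESC: "v \<in> mat_range (E * S\<^sub>C) \<longleftrightarrow> (\<exists>w \<in> carrier_vec n. C *\<^sub>v w = 0\<^sub>v m \<and> v = E *\<^sub>v w)" for v
  proof -
    have "v \<in> mat_range (E * S\<^sub>C) \<longleftrightarrow> (\<exists>u \<in> carrier_vec c. v = E *\<^sub>v (S\<^sub>C *\<^sub>v u))"
      unfolding mat_range_iff[OF ESC] using assoc_mult_mat_vec[OF E SC(1)] by auto
    also have "\<dots> \<longleftrightarrow> (\<exists>w \<in> mat_range S\<^sub>C. v = E *\<^sub>v w)"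
      unfolding Bex_def mat_range_iff[OF SC(1)] by auto
    also have "\<dots> \<longleftrightarrow> (\<exists>w \<in> carrier_vec n. C *\<^sub>v w = 0\<^sub>v m \<and> v = E *\<^sub>v w)"
      unfolding SC(3) mat_kernel[OF C] by blast
    finally show ?thesis .
  qed
  have M_zero: "?M *\<^sub>v y = 0\<^sub>v a \<longleftrightarrow>
      (\<exists>w \<in> carrier_vec n. C *\<^sub>v w = 0\<^sub>v m \<and> A *\<^sub>v (S\<^sub>b *\<^sub>v y) = E *\<^sub>v w)"
    if y: "y \<in> carrier_vec k" for y
  proof -
    have x: "S\<^sub>b *\<^sub>v y \<in> carrier_vec n" using Sy[OF y] by simp
    have Ax: "A *\<^sub>v (S\<^sub>b *\<^sub>v y) \<in> carrier_vec n" using A x by auto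
    have "?M *\<^sub>v y = transpose_mat T\<^sub>a *\<^sub>v (A *\<^sub>v (S\<^sub>b *\<^sub>v y))"
      unfolding assoc_mult_mat_vec[OF TA Sb(1) y] by (rule assoc_mult_mat_vec[OF TT A x])
    then show ?thesis using Ta(2)[OF Ax] range_ESC by simp
  qed
  \<comment> \<open>Condition (i) without bases: \<open>T\<^sub>a\<close> annihilates
    \<open>E (ker C)\<close> and nothing else, so only \<open>y = 0\<close> may send
    \<open>A S\<^sub>b y\<close> there.\<close>
  have M_inj: "inj_mat ?M \<longleftrightarrow> (\<forall>y \<in> carrier_vec k. \<forall>w \<in> carrier_vec n. C *\<^sub>v w = 0\<^sub>v m \<longrightarrow>
      A *\<^sub>v (S\<^sub>b *\<^sub>v y) = E *\<^sub>v w \<longrightarrow> y = 0\<^sub>v k)"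
    using inj_matI[OF M] inj_matD[OF _ M] M_zero by blast
  have dims: "dim_row (E @\<^sub>c B) = n" "dim_row B = n" "dim_row ?M = a" "dim_col ?M = k"
    "dim_row (pencil s E A @\<^sub>c cmat B) = n" "dim_row (pencil s E A @\<^sub>r cmat C) = n + m" for s
    using carrier_matD[OF EB] carrier_matD[OF B] carrier_matD[OF M]
      carrier_matD(1)[OF append_cols_carrier[OF pencil_carrier[OF E A, of s], of "cmat B" m]]
      carrier_matD(1)[OF carrier_append_rows[OF pencil_carrier[OF E A, of s], of "cmat C" m]] B C
    by auto
  have PC: "inj_mat (pencil s E A @\<^sub>r cmat C) \<longleftrightarrow> vec_space.rank (n + m) (pencil s E A @\<^sub>r cmat C) = n" for s
    by (rule inj_mat_iff_rank[OF carrier_append_rows[OF pencil_carrier[OF E A]]]) (use C in simp)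
  \<comment> \<open>Under (i) the rank in the upper bound of (iii) equals the number
    \<open>k\<close> of columns of \<open>S\<^sub>b\<close>.\<close>
  have rhs: "?rhs \<longleftrightarrow> inj_mat ?M \<and>
      (\<forall>s. Re s = 0 \<longrightarrow> vec_space.rank n (pencil s E A @\<^sub>c cmat B) = n \<and>
        inj_mat (pencil s E A @\<^sub>r cmat C)) \<and>
      int (vec_space.rank n (E @\<^sub>c B)) - int (vec_space.rank n B) \<le> r \<and>
      r \<le> int (vec_space.rank n (E @\<^sub>c B)) - int k"
    unfolding dims PC inj_mat_iff_rank[OF M] by auto
  show ?thesis unfolding rhs
  proof
    assume ?lhs
    then obtain K F where K: "K \<in> carrier_mat m m" and F: "F \<in> carrier_mat m m"
      and rif: "regular_impulse_free (E + B * F * C) (A - B * K * C)"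
      and ras: "regular_asymp_stable (E + B * F * C) (A - B * K * C)"
      and rk: "int (mat_rank (E + B * F * C)) = r" by blast
    have E': "E + B * F * C \<in> carrier_mat n n" using E B F C by auto
    have rk': "int (vec_space.rank n (E + B * F * C)) = r" using rk carrier_matD(1)[OF E'] by simp
    have SD: "E *\<^sub>v (S\<^sub>b *\<^sub>v y) = 0\<^sub>v n \<and> C *\<^sub>v (S\<^sub>b *\<^sub>v y) = 0\<^sub>v m \<and>
        A *\<^sub>v (S\<^sub>b *\<^sub>v y) \<in> mat_range (E @\<^sub>c B)" if "y \<in> carrier_vec k" for y
      using Sb_iff Sy[OF that] by blast
    note ob = feedback_obstruction[OF E A B C K F rif Sb(1,2) SD]
    have "inj_mat ?M"
      unfolding M_inj
    proof (intro ballI impI)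
      fix y w assume y: "y \<in> carrier_vec k" and w: "w \<in> carrier_vec n" and Cw: "C *\<^sub>v w = 0\<^sub>v m"
        and eq: "A *\<^sub>v (S\<^sub>b *\<^sub>v y) = E *\<^sub>v w"
      \<comment> \<open>Feedback is invisible on \<open>ker C\<close>, so \<open>E w\<close> is also
        a value of the closed-loop matrix and the obstruction applies.\<close>
      have "(E + B * F * C) *\<^sub>v w = E *\<^sub>v w + 0\<^sub>v n"
        unfolding output_feedback_mult_vec(1)[OF E B F C w] Cw mat_mult_zero_vec[OF F]
          mat_mult_zero_vec[OF B] ..
      also have "\<dots> = E *\<^sub>v w" by (rule right_zero_vec) (use E w in auto)
      finally show "y = 0\<^sub>v k" using ob(1)[OF _ y w] eq by simp
    qed
    moreover have "det (pencil s (E + B * F * C) (A - B * K * C)) \<noteq> 0" if "Re s = 0" for s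
      using ras that unfolding regular_asymp_stable_def by fastforce
    then have "\<forall>s. Re s = 0 \<longrightarrow> vec_space.rank n (pencil s E A @\<^sub>c cmat B) = n \<and>
        inj_mat (pencil s E A @\<^sub>r cmat C)"
      using pencil_rank_of_feedback[OF E A B C K F] by blast
    moreover have "r \<le> int (vec_space.rank n (E @\<^sub>c B)) - int k"
      unfolding rk'[symmetric] using ob(2) by simp
    moreover have "int (vec_space.rank n (E @\<^sub>c B)) - int (vec_space.rank n B) \<le> r"
      unfolding rk'[symmetric] using rank_closed_loop_lower[OF E B F C] by simp
    ultimately show "inj_mat ?M \<and>
      (\<forall>s. Re s = 0 \<longrightarrow> vec_space.rank n (pencil s E A @\<^sub>c cmat B) = n \<and>
        inj_mat (pencil s E A @\<^sub>r cmat C)) \<and>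
      int (vec_space.rank n (E @\<^sub>c B)) - int (vec_space.rank n B) \<le> r \<and>
      r \<le> int (vec_space.rank n (E @\<^sub>c B)) - int k"
      by blast
  next
    assume b: "inj_mat ?M \<and>
      (\<forall>s. Re s = 0 \<longrightarrow> vec_space.rank n (pencil s E A @\<^sub>c cmat B) = n \<and>
        inj_mat (pencil s E A @\<^sub>r cmat C)) \<and>
      int (vec_space.rank n (E @\<^sub>c B)) - int (vec_space.rank n B) \<le> r \<and>
      r \<le> int (vec_space.rank n (E @\<^sub>c B)) - int k"
    obtain J R Q G P where pH: "pH_representation n m E A B C J R Q G P"
      using assms(5) unfolding admits_pH_def by blast
    \<comment> \<open>With \<open>rank B \<le> rank [E B]\<close> the lower bound in (iii) makes
      \<open>r\<close> nonnegative, so the integer can be traded for a natural number.\<close>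
    have "mat_range B \<subseteq> mat_range (E @\<^sub>c B)"
    proof
      fix y assume "y \<in> mat_range B"
      then obtain v where v: "v \<in> carrier_vec m" "y = B *\<^sub>v v" using mat_range_iff[OF B] by blast
      have "y = E *\<^sub>v 0\<^sub>v n + B *\<^sub>v v"
        unfolding v(2) mat_mult_zero_vec[OF E] by (rule left_zero_vec[symmetric]) (use B v in auto)
      then show "y \<in> mat_range (E @\<^sub>c B)"
        unfolding mat_range_append_cols[OF E B] using v(1) zero_carrier_vec by blast
    qed
    then have "vec_space.rank n B \<le> vec_space.rank n (E @\<^sub>c B)" by (rule rank_mono[OF B EB])
    then have r0: "0 \<le> r" using b by linarith
    define r' where "r' = nat r"
    have r': "r = int r'" using r0 by (simp add: r'_def)
    obtain F where F: "F \<in> carrier_mat m m"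
      and rif: "regular_impulse_free (E + B * F * C) (A - B * 1\<^sub>m m * C)"
      and st: "\<And>s. det (pencil s (E + B * F * C) (A - B * 1\<^sub>m m * C)) = 0 \<Longrightarrow> Re s < 0"
      and rk: "vec_space.rank n (E + B * F * C) = r'"
      and cl: "admits_pH n m (E + B * F * C) (A - B * 1\<^sub>m m * C) B C"
    proof (rule stabilizing_feedback_exists[OF E A B C pH Sb(1), where r = r'])
      show "x \<in> mat_range S\<^sub>b" if "x \<in> carrier_vec n" "E *\<^sub>v x = 0\<^sub>v n" "C *\<^sub>v x = 0\<^sub>v m"
        "A *\<^sub>v x \<in> mat_range (E @\<^sub>c B)" for x
        using Sb_iff that by blast
      show "y = 0\<^sub>v k" if "y \<in> carrier_vec k" "w \<in> carrier_vec n" "C *\<^sub>v w = 0\<^sub>v m"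
        "A *\<^sub>v (S\<^sub>b *\<^sub>v y) = E *\<^sub>v w" for y w
        using b that unfolding M_inj by blast
      show "inj_mat (pencil s E A @\<^sub>r cmat C)" if "Re s = 0" for s using b that by blast
      show "vec_space.rank n (E @\<^sub>c B) \<le> r' + vec_space.rank n B" using b r' by linarith
      show "r' + k \<le> vec_space.rank n (E @\<^sub>c B)" using b r' by linarith
    qed blast
    have E': "E + B * F * C \<in> carrier_mat n n" using E B F C by auto
    \<comment> \<open>The point 0 does not have negative real part, so it is no root; this witnesses
      regularity.\<close>
    have "det (pencil 0 (E + B * F * C) (A - B * 1\<^sub>m m * C)) \<noteq> 0" using st[of 0] by auto
    then have "regular_asymp_stable (E + B * F * C) (A - B * 1\<^sub>m m * C)"
      unfolding regular_asymp_stable_def regular_pair_def using st by blast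
    moreover have "int (mat_rank (E + B * F * C)) = r" using rk r' carrier_matD(1)[OF E'] by simp
    ultimately show ?lhs using rif cl F by (intro bexI[of _ "1\<^sub>m m"] bexI[of _ F]) auto
  qed
qed

end
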